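(* The fundamental heap $h(L)$ of an unoriented framed link $L$ is well defined: the defining relations do not depend on the choice of direction in which an under-arc is traversed at a crossing, and if $D$ and $D'$ are two blackboard framed diagrams of the same framed link $L$, then the groups $h(D)$ and $h(D')$ obtained from them are isomorphic (as groups, hence as heaps).
   Context: A framed link in $3$-space is represented by an (unoriented) link diagram $D$ with the blackboard framing. Two such diagrams represent the same framed link if and only if they are related by planar isotopies, Reidemeister moves of type II and III, and the cancelation move, which inserts or removes two adjacent kinks with crossings of opposite signs on a string. The group $h(D)$ is defined as follows. An arc of $D$ is a maximal piece of $D$ between consecutive under-crossings (or a whole closed component curve that has no under-crossing). The diagram is thickened in the plane to a ribbon diagram, so that each arc is replaced by two parallel boundary strings. Each of these strings is assigned a generator, so there are two generators per arc of $D$. At each crossing there are two relations, one for each of the two boundary strings of the under-arc: choose a direction of traversing the under-arc; if a string labeled $x$ passes under the over-arc, meeting first the over-string labeled $u$ and then the over-string labeled $v$, and continues on the other side as the string labeled $z$, the relation is $z=xu^{-1}v$. Then $h(D)$ is the group with this presentation, regarded as a heap with operation $[x,y,z]=xy^{-1}z$, and $h(L):=h(D)$ for any diagram $D$ of $L$. *)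

theory Defs
  imports "HOL-Analysis.Analysis" "HOL-Algebra.Group"
begin

section \<open>Groups given by generators and relations\<close>

text \<open>A letter \<open>(x, True)\<close> stands for the generator \<open>x\<close>, and \<open>(x, False)\<close> for its inverse. A
  relation \<open>l = r\<close> is a pair of words.\<close>

type_synonym 'a word = "('a \<times> bool) list"

definition words :: "'a set \<Rightarrow> 'a word set" where
  "words X = lists (X \<times> UNIV)"

inductive word_eq :: "'a set \<Rightarrow> ('a word \<times> 'a word) set \<Rightarrow> 'a word \<Rightarrow> 'a word \<Rightarrow> bool"
  for X R where
  refl: "w \<in> words X \<Longrightarrow> word_eq X R w w"
| sym: "word_eq X R u v \<Longrightarrow> word_eq X R v u"
| trans: "word_eq X R u v \<Longrightarrow> word_eq X R v w \<Longrightarrow> word_eq X R u w"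
| append: "word_eq X R u u' \<Longrightarrow> word_eq X R v v' \<Longrightarrow> word_eq X R (u @ v) (u' @ v')"
| cancel: "x \<in> X \<Longrightarrow> word_eq X R [(x, b), (x, \<not> b)] []"
| relation: "(l, r) \<in> R \<Longrightarrow> word_eq X R l r"

definition presented_group :: "'a set \<Rightarrow> ('a word \<times> 'a word) set \<Rightarrow> 'a word set monoid" where
  "presented_group X R =
    \<lparr>carrier = words X // {(u, v). word_eq X R u v},
     monoid.mult = (\<lambda>A B. \<Union>u\<in>A. \<Union>v\<in>B. {w. word_eq X R (u @ v) w}),
     one = {w. word_eq X R [] w}\<rparr>"

definition heap_op :: "('a, 'b) monoid_scheme \<Rightarrow> 'a \<Rightarrow> 'a \<Rightarrow> 'a \<Rightarrow> 'a" where
  "heap_op G x y z = x \<otimes>\<^bsub>G\<^esub> inv\<^bsub>G\<^esub> y \<otimes>\<^bsub>G\<^esub> z"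

definition heap_iso :: "('a, 'c) monoid_scheme \<Rightarrow> ('b, 'd) monoid_scheme \<Rightarrow> ('a \<Rightarrow> 'b) set" where
  "heap_iso G H = {f. bij_betw f (carrier G) (carrier H) \<and>
     (\<forall>x\<in>carrier G. \<forall>y\<in>carrier G. \<forall>z\<in>carrier G.
        f (heap_op G x y z) = heap_op H (f x) (f y) (f z))}"

section \<open>Link diagrams\<close>

text \<open>Diagrams are taken in the \<open>C\<^sup>1\<close> category, and the plane is \<open>\<complex>\<close>. A diagram with \<open>n\<close> components
  is an immersion of \<open>n\<close> numbered copies of the unit circle, together with the set of those points
  of the circles that are the lower preimages of the crossings. The circles carry the
  counterclockwise orientation as an auxiliary datum only: \<open>same_diagram\<close> below identifies diagrams
  that differ in parametrization, orientation or numbering of the components.\<close>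

type_synonym point = "nat \<times> complex"

record diagram =
  ncomp :: nat
  curve :: "point \<Rightarrow> complex"
  under_points :: "point set"

definition points :: "diagram \<Rightarrow> point set" where
  "points D = {..<ncomp D} \<times> sphere 0 1"

definition velocity :: "diagram \<Rightarrow> point \<Rightarrow> complex" where
  "velocity D p = vector_derivative (\<lambda>t. curve D (fst p, snd p * cis t)) (at 0)"

text \<open>The determinant of two plane vectors; it is positive iff \<open>w\<close> points to the left of \<open>v\<close>.\<close>

definition det2 :: "complex \<Rightarrow> complex \<Rightarrow> real" where
  "det2 v w = Re v * Im w - Im v * Re w"

text \<open>A crossing is the pair of its lower and its upper preimage, in this order.\<close>

definition crossings :: "diagram \<Rightarrow> (point \<times> point) set" where
  "crossings D = {(p, q). p \<in> points D \<and> q \<in> points D \<and> p \<noteq> q \<and> curve D p = curve D q \<and>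
     p \<in> under_points D}"

definition link_diagram :: "diagram \<Rightarrow> bool" where
  "link_diagram D \<longleftrightarrow>
     (\<forall>i<ncomp D. (\<lambda>t. curve D (i, cis t)) C1_differentiable_on UNIV) \<and>
     (\<forall>p\<in>points D. velocity D p \<noteq> 0) \<and>
     finite {(p, q). p \<in> points D \<and> q \<in> points D \<and> p \<noteq> q \<and> curve D p = curve D q} \<and>
     (\<forall>p\<in>points D. \<forall>q\<in>points D. \<forall>r\<in>points D.
        curve D p = curve D q \<and> curve D q = curve D r \<longrightarrow> p = q \<or> q = r \<or> p = r) \<and>
     (\<forall>p\<in>points D. \<forall>q\<in>points D. p \<noteq> q \<and> curve D p = curve D q \<longrightarrow>
        det2 (velocity D p) (velocity D q) \<noteq> 0 \<and>
        (p \<in> under_points D \<longleftrightarrow> q \<notin> under_points D)) \<and>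
     (\<forall>p\<in>under_points D. p \<in> points D \<and>
        (\<exists>q\<in>points D. q \<noteq> p \<and> curve D q = curve D p))"

section \<open>The fundamental heap of a diagram\<close>

definition arcs :: "diagram \<Rightarrow> point set set" where
  "arcs D = components (points D - under_points D)"

text \<open>The ribbon of an arc has two boundary strings, one on the left-hand and one on the right-hand
  side of the arc with respect to the auxiliary orientation.\<close>

datatype side = Left_Side | Right_Side

type_synonym string_label = "point set \<times> side"

definition strings :: "diagram \<Rightarrow> string_label set" where
  "strings D = arcs D \<times> UNIV"

datatype direction = Forward | Backward

fun dir_sign :: "direction \<Rightarrow> real" where
  "dir_sign Forward = 1"
| "dir_sign Backward = - 1"

text \<open>The arc that a traveller on the circle through \<open>p\<close> enters when leaving \<open>p\<close> in direction \<open>s\<close>,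
  where \<open>s = 1\<close> means counterclockwise and \<open>s = -1\<close> clockwise.\<close>

definition arc_leaving :: "diagram \<Rightarrow> real \<Rightarrow> point \<Rightarrow> point set" where
  "arc_leaving D s p = (THE A. A \<in> arcs D \<and>
     (\<forall>\<^sub>F t in at_right 0. (fst p, snd p * cis (s * t)) \<in> A))"

definition arc_through :: "diagram \<Rightarrow> point \<Rightarrow> point set" where
  "arc_through D q = connected_component_set (points D - under_points D) q"

text \<open>When the under-strand is traversed with velocity \<open>v\<close> and the over-strand has velocity \<open>w\<close>, the
  left-hand string of the over-arc is met first iff \<open>w\<close> points to the left of \<open>v\<close>.\<close>

definition first_over_side :: "diagram \<Rightarrow> direction \<Rightarrow> point \<times> point \<Rightarrow> side" where
  "first_over_side D d = (\<lambda>(p, q).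
     if det2 (dir_sign d *\<^sub>R velocity D p) (velocity D q) > 0 then Left_Side else Right_Side)"

definition second_over_side :: "diagram \<Rightarrow> direction \<Rightarrow> point \<times> point \<Rightarrow> side" where
  "second_over_side D d = (\<lambda>(p, q).
     if det2 (dir_sign d *\<^sub>R velocity D p) (velocity D q) > 0 then Right_Side else Left_Side)"

text \<open>The relations \<open>z = x u\<inverse> v\<close> for the two strings \<open>x\<close> of the under-arc, when the under-arc is
  traversed in direction \<open>d\<close>.\<close>

definition crossing_relations ::
    "diagram \<Rightarrow> direction \<Rightarrow> point \<times> point \<Rightarrow> (string_label word \<times> string_label word) set" where
  "crossing_relations D d = (\<lambda>(p, q).
     {([((arc_leaving D (dir_sign d) p, s), True)],
       [((arc_leaving D (- dir_sign d) p, s), True),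
        ((arc_through D q, first_over_side D d (p, q)), False),
        ((arc_through D q, second_over_side D d (p, q)), True)]) | s. s \<in> UNIV})"

text \<open>A direction for each crossing has to be chosen in order to write down the presentation.\<close>

definition fundamental_heap ::
    "diagram \<Rightarrow> (point \<times> point \<Rightarrow> direction) \<Rightarrow> string_label word set monoid" where
  "fundamental_heap D \<delta> =
     presented_group (strings D) (\<Union>c\<in>crossings D. crossing_relations D (\<delta> c) c)"

section \<open>Framed equivalence of diagrams\<close>

text \<open>Each circle is reparametrized by a \<open>C\<^sup>1\<close> diffeomorphism, given by its lift to the real line;
  \<open>\<epsilon> i = -1\<close> means that the orientation is reversed.\<close>

definition same_diagram :: "diagram \<Rightarrow> diagram \<Rightarrow> bool" where
  "same_diagram D D' \<longleftrightarrow> (\<exists>\<sigma> \<epsilon> f.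
     bij_betw \<sigma> {..<ncomp D} {..<ncomp D'} \<and>
     (\<forall>i<ncomp D. \<epsilon> i \<in> {1, - 1 :: real} \<and>
        f i C1_differentiable_on UNIV \<and>
        (\<forall>t. vector_derivative (f i) (at t) \<noteq> 0) \<and>
        (\<forall>t. f i (t + 2 * pi) = f i t + \<epsilon> i * (2 * pi)) \<and>
        (\<forall>t. curve D' (\<sigma> i, cis (f i t)) = curve D (i, cis t)) \<and>
        (\<forall>t. (\<sigma> i, cis (f i t)) \<in> under_points D' \<longleftrightarrow> (i, cis t) \<in> under_points D)))"

text \<open>An isotopy of the plane through \<open>C\<^sup>1\<close> diffeomorphisms, starting at the identity.\<close>

definition plane_isotopy :: "(real \<Rightarrow> complex \<Rightarrow> complex) \<Rightarrow> bool" where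
  "plane_isotopy H \<longleftrightarrow>
     H 0 = id \<and>
     continuous_on ({0..1} \<times> UNIV) (\<lambda>(t, x). H t x) \<and>
     (\<forall>t\<in>{0..1}. bij (H t)) \<and>
     (\<exists>H'. (\<forall>t\<in>{0..1}. \<forall>x. (H t has_derivative H' t x) (at x) \<and> inj (H' t x)) \<and>
           (\<forall>v. continuous_on ({0..1} \<times> UNIV) (\<lambda>(t, x). H' t x v)))"

definition planar_isotopic :: "diagram \<Rightarrow> diagram \<Rightarrow> bool" where
  "planar_isotopic D D' \<longleftrightarrow>
     ncomp D' = ncomp D \<and> under_points D' = under_points D \<and>
     (\<exists>H. plane_isotopy H \<and> (\<forall>p\<in>points D. curve D' p = H 1 (curve D p)))"

text \<open>A triple \<open>(i, a, b)\<close> denotes the strand of the \<open>i\<close>-th component between the angles \<open>a\<close> and \<open>b\<close>.\<close>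

type_synonym strand = "nat \<times> real \<times> real"

definition strand_points :: "strand \<Rightarrow> point set" where
  "strand_points = (\<lambda>(i, a, b). (\<lambda>t. (i, cis t)) ` {a..b})"

definition inner_strand_points :: "strand \<Rightarrow> point set" where
  "inner_strand_points = (\<lambda>(i, a, b). (\<lambda>t. (i, cis t)) ` {a<..<b})"

text \<open>\<open>D\<close> and \<open>D'\<close> agree outside a closed topological disc \<open>B\<close> in the plane, which meets both of them
  exactly in the strands of the family \<open>\<S>\<close>, running from boundary to boundary through the interior
  of \<open>B\<close>. As \<open>D\<close> and \<open>D'\<close> coincide off these strands, the strands have the same end points (and
  tangents there) in both diagrams.\<close>

definition local_change :: "diagram \<Rightarrow> diagram \<Rightarrow> strand set \<Rightarrow> bool" where
  "local_change D D' \<S> \<longleftrightarrow>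
     ncomp D' = ncomp D \<and>
     (\<forall>(i, a, b)\<in>\<S>. i < ncomp D \<and> a < b \<and> b < a + 2 * pi) \<and>
     pairwise (\<lambda>S T. disjnt (strand_points S) (strand_points T)) \<S> \<and>
     (\<forall>p\<in>points D - \<Union> (strand_points ` \<S>).
        curve D' p = curve D p \<and> (p \<in> under_points D' \<longleftrightarrow> p \<in> under_points D)) \<and>
     (\<exists>B. B homeomorphic (cball 0 1 :: complex set) \<and>
        (\<forall>E\<in>{D, D'}. \<forall>p\<in>points E.
           (curve E p \<in> B \<longleftrightarrow> p \<in> \<Union> (strand_points ` \<S>)) \<and>
           (curve E p \<in> interior B \<longleftrightarrow> p \<in> \<Union> (inner_strand_points ` \<S>))))"

definition crossings_within :: "diagram \<Rightarrow> strand set \<Rightarrow> (point \<times> point) set" where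
  "crossings_within D \<S> =
     {(p, q) \<in> crossings D. p \<in> \<Union> (strand_points ` \<S>) \<and> q \<in> \<Union> (strand_points ` \<S>)}"

text \<open>The usual sign: positive iff turning the over-strand counterclockwise by less than \<open>\<pi>\<close> gives
  the under-strand. For a self-crossing it does not depend on the orientation.\<close>

definition crossing_sign :: "diagram \<Rightarrow> point \<times> point \<Rightarrow> real" where
  "crossing_sign D = (\<lambda>(p, q). sgn (det2 (velocity D q) (velocity D p)))"

text \<open>Two strands without crossings become two strands that cross twice, \<open>S\<close> under \<open>S'\<close>. That the two
  crossings have opposite signs is forced by the disc; it is recorded for definiteness.\<close>

definition reidemeister2 :: "diagram \<Rightarrow> diagram \<Rightarrow> bool" where
  "reidemeister2 D D' \<longleftrightarrow> (\<exists>S S'.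
     S \<noteq> S' \<and> local_change D D' {S, S'} \<and>
     crossings_within D {S, S'} = {} \<and>
     (\<exists>p1\<in>inner_strand_points S. \<exists>p2\<in>inner_strand_points S.
      \<exists>q1\<in>inner_strand_points S'. \<exists>q2\<in>inner_strand_points S'.
        p1 \<noteq> p2 \<and> crossings_within D' {S, S'} = {(p1, q1), (p2, q2)} \<and>
        crossing_sign D' (p1, q1) = - crossing_sign D' (p2, q2)))"

text \<open>The strands \<open>T\<close>, \<open>M\<close>, \<open>U\<close> (top, middle, bottom) cross pairwise exactly once, \<open>M\<close> and \<open>U\<close> below
  \<open>T\<close> and \<open>U\<close> below \<open>M\<close>. The angle \<open>tm\<close> is the position on \<open>T\<close> of its crossing with \<open>M\<close>, \<open>mt\<close> the
  position on \<open>M\<close> of the same crossing, and so on. The last two equations say that one turns in the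
  same sense at all three corners when walking around the triangle, from the corner \<open>UM\<close> along \<open>U\<close> to
  \<open>UT\<close>, along \<open>T\<close> to \<open>MT\<close> and along \<open>M\<close> back to \<open>UM\<close>; for three strands in a disc they hold
  automatically.\<close>

definition triangle :: "diagram \<Rightarrow> strand \<Rightarrow> strand \<Rightarrow> strand \<Rightarrow>
    real \<Rightarrow> real \<Rightarrow> real \<Rightarrow> real \<Rightarrow> real \<Rightarrow> real \<Rightarrow> bool" where
  "triangle D T M U tm tu mt mu ut um \<longleftrightarrow>
     (let (i, a, b) = T; (j, c, d) = M; (k, e, f) = U;
          T_dir = sgn (tm - tu); M_dir = sgn (mu - mt); U_dir = sgn (ut - um)
      in {tm, tu} \<subseteq> {a<..<b} \<and> {mt, mu} \<subseteq> {c<..<d} \<and> {ut, um} \<subseteq> {e<..<f} \<and>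
         crossings_within D {T, M, U} =
           {((j, cis mt), (i, cis tm)), ((k, cis ut), (i, cis tu)), ((k, cis um), (j, cis mu))} \<and>
         sgn (det2 (M_dir *\<^sub>R velocity D (j, cis mu)) (U_dir *\<^sub>R velocity D (k, cis um))) =
         sgn (det2 (U_dir *\<^sub>R velocity D (k, cis ut)) (T_dir *\<^sub>R velocity D (i, cis tu))) \<and>
         sgn (det2 (U_dir *\<^sub>R velocity D (k, cis ut)) (T_dir *\<^sub>R velocity D (i, cis tu))) =
         sgn (det2 (T_dir *\<^sub>R velocity D (i, cis tm)) (M_dir *\<^sub>R velocity D (j, cis mt))))"

text \<open>Moving a strand across the crossing of the other two reverses, on each of the three strands, the
  order of its two crossings. The signs of the crossings are unchanged (again forced by the disc, as
  the end points of the strands are fixed).\<close>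

definition reidemeister3 :: "diagram \<Rightarrow> diagram \<Rightarrow> bool" where
  "reidemeister3 D D' \<longleftrightarrow> (\<exists>T M U tm tu mt mu ut um tm' tu' mt' mu' ut' um'.
     T \<noteq> M \<and> T \<noteq> U \<and> M \<noteq> U \<and> local_change D D' {T, M, U} \<and>
     triangle D T M U tm tu mt mu ut um \<and>
     triangle D' T M U tm' tu' mt' mu' ut' um' \<and>
     sgn (tm' - tu') = - sgn (tm - tu) \<and>
     sgn (mt' - mu') = - sgn (mt - mu) \<and>
     sgn (ut' - um') = - sgn (ut - um) \<and>
     crossing_sign D' ((fst M, cis mt'), (fst T, cis tm')) =
       crossing_sign D ((fst M, cis mt), (fst T, cis tm)) \<and>
     crossing_sign D' ((fst U, cis ut'), (fst T, cis tu')) =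
       crossing_sign D ((fst U, cis ut), (fst T, cis tu)) \<and>
     crossing_sign D' ((fst U, cis um'), (fst M, cis mu')) =
       crossing_sign D ((fst U, cis um), (fst M, cis mu)))"

text \<open>A strand without crossings becomes a strand whose only crossings are two successive kinks (in a
  disc, a self-crossing at the angles \<open>t1 < t2\<close> with no other crossing between them is a kink), with
  crossings of opposite signs.\<close>

definition insert_cancelling_kinks :: "diagram \<Rightarrow> diagram \<Rightarrow> bool" where
  "insert_cancelling_kinks D D' \<longleftrightarrow> (\<exists>i a b t1 t2 t3 t4 c c'.
     local_change D D' {(i, a, b)} \<and>
     crossings_within D {(i, a, b)} = {} \<and>
     a < t1 \<and> t1 < t2 \<and> t2 < t3 \<and> t3 < t4 \<and> t4 < b \<and>
     crossings_within D' {(i, a, b)} = {c, c'} \<and>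
     c \<in> {((i, cis t1), (i, cis t2)), ((i, cis t2), (i, cis t1))} \<and>
     c' \<in> {((i, cis t3), (i, cis t4)), ((i, cis t4), (i, cis t3))} \<and>
     crossing_sign D' c = - crossing_sign D' c')"

definition framed_move :: "diagram \<Rightarrow> diagram \<Rightarrow> bool" where
  "framed_move D D' \<longleftrightarrow> link_diagram D \<and> link_diagram D' \<and>
     (same_diagram D D' \<or> planar_isotopic D D' \<or> reidemeister2 D D' \<or> reidemeister3 D D' \<or>
      insert_cancelling_kinks D D')"

text \<open>Two blackboard framed diagrams represent the same framed link iff they are related by a finite
  sequence of these moves and their inverses.\<close>

definition same_framed_link :: "diagram \<Rightarrow> diagram \<Rightarrow> bool" where
  "same_framed_link = equivclp framed_move"

end

theory Submission
  imports Defs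
begin

text \<open>For a group \<open>G\<close>, a coloring of \<open>D\<close> assigns to each point off the under-crossings a value
  in \<open>G\<close> for each of the two sides, locally constantly and such that the values jump at an
  under-crossing by right multiplication with \<open>u\<inverse> v\<close>. Colorings of \<open>D\<close> in \<open>G\<close> are the
  homomorphisms from \<open>h(D)\<close> to \<open>G\<close>, so it suffices to show that a move induces, naturally in \<open>G\<close>,
  a bijection between colorings. For the moves in a disc, a coloring is determined by its values off
  the inner parts of the strands, and extends across the new strands because: the two jumps of an R2
  move are inverse to each other; a kink does not change the product \<open>x\<^sub>L\<inverse> x\<^sub>R\<close> of its own
  two strings, so opposite kinks cancel; and in an R3 move the jump across the middle strand is
  conjugated by the jump across the top strand. No planar topology beyond the signs of the crossings
  enters, and an isotopy of the plane preserves these signs as its Jacobian determinant stays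
  positive.\<close>

section \<open>Presentations\<close>

text \<open>The obstacle is that generators are indexed by whole arcs, while a move in a disc splits
  and merges arcs in a global way: several strands of the disc may lie on one arc that closes up
  outside, and a component without under-crossings is a single closed arc. A coloring is therefore a
  function of points subject to local conditions, and arcs enter only where colorings are compared
  with homomorphisms. Naturality in \<open>G\<close> is made concrete by a fixed relation between
  positions (a point and a side) of the two diagrams. The universal coloring of each diagram,
  carried over to the other one along this relation, yields homomorphisms in both directions; since
  a coloring is determined by its values at the related positions, these homomorphisms are mutually
  inverse. A move thus calls for two existence and two uniqueness statements about colorings, except
  for planar isotopies, where the two groups are literally equal.\<close>

lemma word_eq_words:
  assumes "word_eq X R u v" "R \<subseteq> words X \<times> words X"
  shows "u \<in> words X \<and> v \<in> words X"
  using assms by (induction rule: word_eq.induct) (auto simp: words_def)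

lemma word_eq_subst:
  assumes "word_eq X R u v" "\<And>l r. (l, r) \<in> R \<Longrightarrow> word_eq X R' l r"
  shows "word_eq X R' u v"
  using assms by (induction rule: word_eq.induct) (auto intro: word_eq.intros)

lemma word_eq_cong_relations:
  assumes "\<And>l r. (l, r) \<in> R \<Longrightarrow> word_eq X R' l r" "\<And>l r. (l, r) \<in> R' \<Longrightarrow> word_eq X R l r"
  shows "word_eq X R = word_eq X R'"
  using assms word_eq_subst by (intro ext iffI) blast+

section \<open>Inverse words and the group of word classes\<close>

definition inv_word :: "'a word \<Rightarrow> 'a word" where
  "inv_word w = map (\<lambda>(x, b). (x, \<not> b)) (rev w)"

lemma inv_word_in_words: "w \<in> words X \<Longrightarrow> inv_word w \<in> words X"
  by (auto simp: words_def inv_word_def in_lists_conv_set)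

lemma word_eq_inv_word:
  assumes "w \<in> words X"
  shows "word_eq X R (inv_word w @ w) []"
  using assms
proof (induction w)
  case Nil
  show ?case by (auto simp: inv_word_def words_def intro!: word_eq.refl)
next
  case (Cons a w)
  obtain x b where a: "a = (x, b)" by (cases a)
  have x: "x \<in> X" and w: "w \<in> words X" using Cons.prems a by (auto simp: words_def)
  have "word_eq X R ([(x, \<not> b)] @ [(x, b)]) []"
    using word_eq.cancel[OF x, of R "\<not> b"] by simp
  then have "word_eq X R (([(x, \<not> b)] @ [(x, b)]) @ w) ([] @ w)"
    using word_eq.refl[OF w] by (rule word_eq.append)
  then have "word_eq X R (inv_word w @ (([(x, \<not> b)] @ [(x, b)]) @ w)) (inv_word w @ [] @ w)"
    by (rule word_eq.append[OF word_eq.refl[OF inv_word_in_words[OF w]]])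
  then show ?case
    using Cons.IH[OF w] by (auto simp: a inv_word_def intro: word_eq.trans)
qed

definition word_class :: "'a set \<Rightarrow> ('a word \<times> 'a word) set \<Rightarrow> 'a word \<Rightarrow> 'a word set" where
  "word_class X R u = {v. word_eq X R u v}"

lemma word_class_eqI: "word_eq X R u v \<Longrightarrow> word_class X R u = word_class X R v"
  unfolding word_class_def by (blast intro: word_eq.sym word_eq.trans)

lemma carrier_presented_group: "carrier (presented_group X R) = word_class X R ` words X"
  by (auto simp: presented_group_def quotient_def word_class_def)

lemma one_presented_group: "\<one>\<^bsub>presented_group X R\<^esub> = word_class X R []"
  by (simp add: presented_group_def word_class_def)

text \<open>The product is a union over all pairs of representatives; as the congruence respects
  concatenation, all the classes in this union coincide.\<close>

lemma mult_presented_group: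
  assumes "u \<in> words X" "v \<in> words X"
  shows "word_class X R u \<otimes>\<^bsub>presented_group X R\<^esub> word_class X R v = word_class X R (u @ v)"
proof -
  have "word_eq X R u u" "word_eq X R v v" using assms by (auto intro: word_eq.refl)
  then show ?thesis
    by (auto simp: presented_group_def word_class_def
        intro: word_eq.append word_eq.trans word_eq.sym)
qed

lemma append_in_words: "u \<in> words X \<Longrightarrow> v \<in> words X \<Longrightarrow> u @ v \<in> words X"
  by (simp add: words_def)

lemma group_presented_group: "group (presented_group X R)"
proof (rule groupI)
  let ?P = "presented_group X R"
  show "\<one>\<^bsub>?P\<^esub> \<in> carrier ?P"
    unfolding carrier_presented_group one_presented_group by (auto simp: words_def)
  fix x y z
  assume "x \<in> carrier ?P"
  then obtain u where u: "u \<in> words X" "x = word_class X R u"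
    unfolding carrier_presented_group by auto
  have nil: "[] \<in> words X" by (simp add: words_def)
  show "\<one>\<^bsub>?P\<^esub> \<otimes>\<^bsub>?P\<^esub> x = x"
    by (simp add: one_presented_group u mult_presented_group[OF nil u(1)])
  have "word_class X R (inv_word u) \<otimes>\<^bsub>?P\<^esub> x = \<one>\<^bsub>?P\<^esub>"
    using word_eq_inv_word[OF u(1)]
    by (simp add: one_presented_group u mult_presented_group inv_word_in_words word_class_eqI)
  then show "\<exists>y\<in>carrier ?P.
      y \<otimes>\<^bsub>?P\<^esub> x = \<one>\<^bsub>?P\<^esub>"
    using inv_word_in_words[OF u(1)] unfolding carrier_presented_group by blast
  assume "y \<in> carrier ?P"
  then obtain v where v: "v \<in> words X" "y = word_class X R v"
    unfolding carrier_presented_group by auto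
  show "x \<otimes>\<^bsub>?P\<^esub> y \<in> carrier ?P"
    using u v by (auto simp: mult_presented_group carrier_presented_group append_in_words)
  assume "z \<in> carrier ?P"
  then obtain w where w: "w \<in> words X" "z = word_class X R w"
    unfolding carrier_presented_group by auto
  show "x \<otimes>\<^bsub>?P\<^esub> y \<otimes>\<^bsub>?P\<^esub> z =
      x \<otimes>\<^bsub>?P\<^esub> (y \<otimes>\<^bsub>?P\<^esub> z)"
    using u v w by (simp add: mult_presented_group append_in_words)
qed

section \<open>The universal property of a presented group\<close>

definition generator :: "'a set \<Rightarrow> ('a word \<times> 'a word) set \<Rightarrow> 'a \<Rightarrow> 'a word set" where
  "generator X R x = word_class X R [(x, True)]"

lemma generator_closed: "x \<in> X \<Longrightarrow> generator X R x \<in> carrier (presented_group X R)"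
  by (auto simp: generator_def carrier_presented_group words_def)

primrec word_value :: "('g, 'm) monoid_scheme \<Rightarrow> ('a \<Rightarrow> 'g) \<Rightarrow> 'a word \<Rightarrow> 'g" where
  "word_value G f [] = \<one>\<^bsub>G\<^esub>"
| "word_value G f (a # w) =
    (if snd a then f (fst a) else inv\<^bsub>G\<^esub> f (fst a)) \<otimes>\<^bsub>G\<^esub> word_value G f w"

context group
begin

lemma word_value_closed:
  "w \<in> words X \<Longrightarrow> f \<in> X \<rightarrow> carrier G \<Longrightarrow> word_value G f w \<in> carrier G"
  by (induction w) (auto simp: words_def Pi_iff)

lemma word_value_append:
  "u \<in> words X \<Longrightarrow> v \<in> words X \<Longrightarrow> f \<in> X \<rightarrow> carrier G \<Longrightarrow>
   word_value G f (u @ v) = word_value G f u \<otimes> word_value G f v"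
proof (induction u)
  case (Cons a u)
  then have "fst a \<in> X" "u \<in> words X" by (auto simp: words_def)
  with Cons show ?case
    using word_value_closed[of u X f] word_value_closed[of v X f] by (auto simp: m_assoc Pi_iff)
qed (simp add: word_value_closed)

lemma word_value_cong:
  assumes "word_eq X R u v" "R \<subseteq> words X \<times> words X" "f \<in> X \<rightarrow> carrier G"
    "\<And>l r. (l, r) \<in> R \<Longrightarrow> word_value G f l = word_value G f r"
  shows "word_value G f u = word_value G f v"
  using assms
proof (induction rule: word_eq.induct)
  case (append u u' v v')
  then show ?case
    using word_eq_words by (metis word_value_append)
next
  case (cancel x b)
  then show ?case by (auto simp: Pi_iff)
qed auto

text \<open>The class of an inverse letter is the inverse of the class of the generator, so the
  image of any class is computed letter by letter from the images of the generators.\<close>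

lemma word_value_hom:
  assumes "h \<in> hom (presented_group X R) G" "w \<in> words X"
  shows "h (word_class X R w) = word_value G (\<lambda>x. h (generator X R x)) w"
  using assms(2)
proof (induction w)
  interpret P: group "presented_group X R" by (rule group_presented_group)
  interpret h: group_hom "presented_group X R" G h
    using assms(1) by unfold_locales
  {
    case Nil
    then show ?case using h.hom_one by (simp add: one_presented_group)
  next
    case (Cons a w)
    obtain x b where a: "a = (x, b)" by (cases a)
    have x: "x \<in> X" and w: "w \<in> words X" using Cons.prems a by (auto simp: words_def)
    have l: "[(x, c)] \<in> words X" for c using x by (simp add: words_def)
    have "word_class X R [(x, False)] \<otimes>\<^bsub>presented_group X R\<^esub> generator X R x = \<one>\<^bsub>presented_group X R\<^esub>"
      using word_eq.cancel[OF x, of R False]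
      by (simp add: generator_def mult_presented_group l one_presented_group word_class_eqI)
    then have "word_class X R [(x, False)] = inv\<^bsub>presented_group X R\<^esub> generator X R x"
      using generator_closed[OF x] l
      by (intro P.inv_equality[symmetric]) (auto simp: carrier_presented_group)
    then have "h (word_class X R [(x, b)]) =
        (if b then h (generator X R x) else inv h (generator X R x))"
      using generator_closed[OF x] by (auto simp: generator_def)
    moreover have "word_class X R (a # w) =
        word_class X R [(x, b)] \<otimes>\<^bsub>presented_group X R\<^esub> word_class X R w"
      using l w a by (simp add: mult_presented_group)
    ultimately show ?case
      using l w Cons.IH a by (auto simp: carrier_presented_group)
  }
qed

text \<open>Von Dyck's theorem: the value of a word under \<open>f\<close> depends only on its class
  because the relations hold in \<open>G\<close>.\<close>

lemma presented_group_hom_exists: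
  assumes R: "R \<subseteq> words X \<times> words X" and f: "f \<in> X \<rightarrow> carrier G"
    and rel: "\<And>l r. (l, r) \<in> R \<Longrightarrow> word_value G f l = word_value G f r"
  obtains h where "h \<in> hom (presented_group X R) G" "\<And>x. x \<in> X \<Longrightarrow> h (generator X R x) = f x"
proof
  \<comment> \<open>Any representative of the class may be chosen; \<open>word_value_cong\<close>
    makes the value independent of it.\<close>
  define h where "h A = word_value G f (SOME w. w \<in> A)" for A
  have h: "h (word_class X R w) = word_value G f w" if "w \<in> words X" for w
  proof -
    have "w \<in> word_class X R w" using that by (simp add: word_class_def word_eq.refl)
    then have "(SOME v. v \<in> word_class X R w) \<in> word_class X R w" by (rule someI)
    then have "word_eq X R w (SOME v. v \<in> word_class X R w)" by (simp add: word_class_def)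
    then show ?thesis unfolding h_def using word_value_cong[OF _ R f rel] by metis
  qed
  show "h \<in> hom (presented_group X R) G"
    using f by (auto simp: hom_def carrier_presented_group mult_presented_group h append_in_words
        word_value_append intro: word_value_closed)
  show "h (generator X R x) = f x" if "x \<in> X" for x
  proof -
    have "[(x, True)] \<in> words X" using that by (simp add: words_def)
    then show ?thesis using that f by (auto simp: generator_def h Pi_iff)
  qed
qed

lemma presented_group_hom_unique:
  assumes "h \<in> hom (presented_group X R) G" "k \<in> hom (presented_group X R) G"
    and "\<And>x. x \<in> X \<Longrightarrow> h (generator X R x) = k (generator X R x)"
    and "A \<in> carrier (presented_group X R)"
  shows "h A = k A"
proof -
  obtain w where w: "w \<in> words X" "A = word_class X R w"
    using assms(4) by (auto simp: carrier_presented_group)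
  have "word_value G (\<lambda>x. h (generator X R x)) w = word_value G (\<lambda>x. k (generator X R x)) w"
    using w(1) by (induction w) (auto simp: words_def assms(3))
  then show ?thesis using w assms by (simp add: word_value_hom)
qed

end

lemma presented_group_relation:
  assumes "(l, r) \<in> R"
  shows "word_class X R l = word_class X R r"
  using assms by (intro word_class_eqI word_eq.relation)

lemma iso_imp_heap_iso:
  assumes "group G" "group H" "f \<in> iso G H"
  shows "f \<in> heap_iso G H"
proof -
  interpret G: group G by fact
  interpret H: group H by fact
  interpret f: group_hom G H f using assms(3) by unfold_locales (simp add: iso_def)
  show ?thesis using assms(3) by (simp add: heap_iso_def iso_def heap_op_def)
qed

section \<open>Points on the circles\<close>

text \<open>The expression occurring in \<open>velocity\<close> and \<open>arc_leaving\<close>. It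
  turns the local behaviour at a point of a circle into a statement about a filter in one real
  parameter.\<close>

definition rot :: "point \<Rightarrow> real \<Rightarrow> point" where
  "rot p t = (fst p, snd p * cis t)"

abbreviation arc_points :: "diagram \<Rightarrow> point set" where
  "arc_points D \<equiv> points D - under_points D"

lemma rot_0 [simp]: "rot p 0 = p"
  by (simp add: rot_def)

lemma rot_cis [simp]: "rot (i, cis a) t = (i, cis (a + t))"
  by (simp add: rot_def cis_mult)

lemma rot_in_points: "p \<in> points D \<Longrightarrow> rot p t \<in> points D"
  by (auto simp: points_def rot_def norm_mult)

lemma cis_in_points [simp]: "(i, cis t) \<in> points D \<longleftrightarrow> i < ncomp D"
  by (auto simp: points_def)

lemma points_cisE:
  assumes "p \<in> points D"
  obtains i a where "p = (i, cis a)" "i < ncomp D"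
proof -
  obtain i z where p: "p = (i, z)" by (cases p)
  with assms have "i < ncomp D" "norm z = 1" by (auto simp: points_def)
  moreover from this have "z = cis (Arg z)" using rcis_cmod_Arg[of z] by (simp add: rcis_def)
  ultimately show ?thesis using p that by blast
qed

lemma continuous_rot: "continuous_on A (rot p)"
  unfolding rot_def by (intro continuous_intros)

text \<open>There are no triple points, and \<open>p\<close>, \<open>q\<close>, \<open>q'\<close>
  all have the same image.\<close>

lemma crossing_unique:
  assumes "link_diagram D" "(p, q) \<in> crossings D" "(p, q') \<in> crossings D"
  shows "q = q'"
proof -
  have "p \<in> points D" "q \<in> points D" "q' \<in> points D" "p \<noteq> q" "p \<noteq> q'"
    "curve D p = curve D q" "curve D p = curve D q'"
    using assms(2,3) by (auto simp: crossings_def)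
  moreover have "\<forall>p\<in>points D. \<forall>q\<in>points D. \<forall>r\<in>points D.
      curve D p = curve D q \<and> curve D q = curve D r \<longrightarrow> p = q \<or> q = r \<or> p = r"
    using assms(1) unfolding link_diagram_def by blast
  ultimately show ?thesis by metis
qed

lemma under_in_crossing:
  assumes "link_diagram D" "p \<in> under_points D"
  obtains q where "(p, q) \<in> crossings D"
proof -
  have "p \<in> points D" "\<exists>q\<in>points D. q \<noteq> p \<and> curve D q = curve D p"
    using assms unfolding link_diagram_def by blast+
  then obtain q where "q \<in> points D" "q \<noteq> p" "curve D q = curve D p" by blast
  with \<open>p \<in> points D\<close> assms(2) have "(p, q) \<in> crossings D" by (simp add: crossings_def)
  then show ?thesis by (rule that)
qed

lemma crossing_facts:
  assumes "link_diagram D" "(p, q) \<in> crossings D"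
  shows "p \<in> points D" "q \<in> points D" "p \<in> under_points D" "q \<notin> under_points D"
    "det2 (velocity D p) (velocity D q) \<noteq> 0"
proof -
  show *: "p \<in> points D" "q \<in> points D" "p \<in> under_points D"
    using assms(2) by (auto simp: crossings_def)
  have "p \<noteq> q" "curve D p = curve D q" using assms(2) by (auto simp: crossings_def)
  then show "q \<notin> under_points D" "det2 (velocity D p) (velocity D q) \<noteq> 0"
    using assms(1) * unfolding link_diagram_def by blast+
qed

lemma finite_under_points:
  assumes "link_diagram D"
  shows "finite (under_points D)"
proof -
  let ?X = "{(p, q). p \<in> points D \<and> q \<in> points D \<and> p \<noteq> q \<and> curve D p = curve D q}"
  have "under_points D \<subseteq> fst ` ?X"
  proof
    fix p assume "p \<in> under_points D"
    then obtain q where "(p, q) \<in> crossings D" using under_in_crossing assms by blast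
    then have "(p, q) \<in> ?X" by (auto simp: crossings_def)
    then show "p \<in> fst ` ?X" by (rule rev_image_eqI) simp
  qed
  moreover have "finite ?X" using assms unfolding link_diagram_def by blast
  ultimately show ?thesis using finite_surj by blast
qed

section \<open>Neighbourhoods on the circles and local constancy\<close>

lemma rot_tendsto: "(rot p \<longlongrightarrow> p) (at 0)"
proof -
  have "isCont (rot p) 0"
    using continuous_rot[of UNIV p] by (simp add: continuous_on_eq_continuous_at)
  then show ?thesis by (simp add: isCont_def)
qed

lemma eventually_rot_ne:
  assumes "p \<in> points D"
  shows "\<forall>\<^sub>F t in at 0. rot p t \<noteq> p"
proof -
  obtain i a where p: "p = (i, cis a)" using points_cisE[OF assms] .
  have "\<forall>\<^sub>F t in at 0. \<bar>t\<bar> < pi"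
    by (rule order_tendstoD(2)[OF tendsto_rabs_zero[OF tendsto_ident_at]]) simp
  moreover have "\<forall>\<^sub>F t in at 0. t \<noteq> (0::real)"
    by (simp add: eventually_at_filter)
  ultimately show ?thesis
  proof eventually_elim
    case (elim t)
    then have "cos t < 1"
      using cos_monotone_0_pi[of 0 "\<bar>t\<bar>"] by simp
    then have "cis t \<noteq> 1" by (auto simp: complex_eq_iff)
    then show ?case by (simp add: p cis_mult[symmetric])
  qed
qed

lemma eventually_rot_not_under:
  assumes "link_diagram D" "p \<in> points D"
  shows "\<forall>\<^sub>F t in at 0. rot p t \<in> arc_points D"
proof -
  have "closed (under_points D - {p})"
    using finite_under_points[OF assms(1)] by (simp add: finite_imp_closed)
  then have "\<forall>\<^sub>F x in nhds p. x \<in> - (under_points D - {p})"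
    by (intro eventually_nhds_in_open open_Compl) auto
  with rot_tendsto have "\<forall>\<^sub>F t in at 0. rot p t \<in> - (under_points D - {p})"
    by (rule eventually_compose_filterlim[rotated])
  with eventually_rot_ne[OF assms(2)] show ?thesis
    by eventually_elim (use rot_in_points[OF assms(2)] in auto)
qed

text \<open>Translates statements along \<open>rot\<close> into the topology of
  \<open>points D\<close>, where connectedness lives: every point \<open>x\<close> near
  \<open>p\<close> is \<open>rot p t\<close> for the angle \<open>t = Arg (snd x / snd p)\<close>,
  which tends to 0 because \<open>Arg\<close> is continuous at 1.\<close>

lemma eventually_points_of_rot:
  assumes "\<forall>\<^sub>F t in at 0. Q (rot p t)" "p \<in> points D"
  shows "\<forall>\<^sub>F x in at p within points D. Q x"
proof -
  obtain i a where p: "p = (i, cis a)" using points_cisE[OF assms(2)] .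
  let ?g = "\<lambda>x. Arg (snd x / snd p)"
  \<comment> \<open>The numbers of the components carry the discrete topology, so nearby points lie
    on the same circle.\<close>
  have fst: "\<forall>\<^sub>F x in at p within points D. fst x = fst p"
  proof -
    have "open ({fst p} \<times> (UNIV :: complex set))"
      by (intro open_Times) (auto simp: open_discrete)
    then have "\<forall>\<^sub>F x in nhds p. x \<in> {fst p} \<times> UNIV"
      by (intro eventually_nhds_in_open) (auto simp: mem_Times_iff)
    then show ?thesis by (auto simp: eventually_at_filter mem_Times_iff elim: eventually_mono)
  qed
  have "isCont Arg 1" by (rule continuous_at_Arg) (simp add: complex_nonpos_Reals_iff)
  moreover have "((\<lambda>x. snd x / snd p) \<longlongrightarrow> 1) (at p within points D)"
    by (rule tendsto_eq_intros refl | simp add: p)+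
  ultimately have "(?g \<longlongrightarrow> 0) (at p within points D)"
    using isCont_tendsto_compose[of 1 Arg] by fastforce
  moreover have eq: "\<forall>\<^sub>F x in at p within points D. x = rot p (?g x) \<and> x \<noteq> p"
  proof -
    have "\<forall>\<^sub>F x in at p within points D. x \<in> points D \<and> x \<noteq> p"
      by (auto simp: eventually_at_filter)
    with fst show ?thesis
    proof eventually_elim
      case (elim x)
      have "norm (snd x / snd p) = 1" using elim(2) by (auto simp: p points_def norm_divide)
      then have "cis (?g x) = snd x / snd p"
        using rcis_cmod_Arg[of "snd x / snd p"] by (simp add: rcis_def)
      then show ?case using elim by (auto simp: rot_def p prod_eq_iff)
    qed
  qed
  moreover have "\<forall>\<^sub>F x in at p within points D. ?g x \<noteq> 0"
    using eq by eventually_elim (metis rot_0)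
  ultimately have "filterlim ?g (at 0) (at p within points D)"
    by (simp add: filterlim_at)
  then have "\<forall>\<^sub>F x in at p within points D. Q (rot p (?g x))"
    using assms(1) eventually_compose_filterlim by blast
  with eq show ?thesis by eventually_elim metis
qed

lemma constant_on_connected:
  assumes C: "connected C" "C \<subseteq> points D"
    and loc: "\<And>p. p \<in> C \<Longrightarrow> \<forall>\<^sub>F t in at 0. f (rot p t) = f p"
    and xy: "x \<in> C" "y \<in> C"
  shows "f x = f y"
proof -
  have "f constant_on C"
  proof (rule locally_constant_imp_constant[OF C(1)])
    fix a assume a: "a \<in> C"
    have "\<forall>\<^sub>F x in at a within points D. f x = f a"
      using loc[OF a] a C(2) by (intro eventually_points_of_rot) auto
    then have "\<forall>\<^sub>F x in at a within C. f x = f a"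
      using C(2) by (meson at_le filter_leD)
    then obtain S where S: "open S" "a \<in> S" "\<And>x. x \<in> S \<Longrightarrow> x \<noteq> a \<Longrightarrow> x \<in> C \<Longrightarrow> f x = f a"
      unfolding eventually_at_topological by auto
    show "\<exists>T. openin (top_of_set C) T \<and> a \<in> T \<and> (\<forall>x\<in>T. f x = f a)"
      by (rule exI[of _ "C \<inter> S"]) (use S a in auto)
  qed
  then show ?thesis using xy by (auto simp: constant_on_def)
qed

section \<open>Arcs as connected components\<close>

lemma arc_throughI:
  assumes "connected C" "C \<subseteq> arc_points D" "x \<in> C" "y \<in> C"
  shows "arc_through D x = arc_through D y"
proof -
  have "connected_component (arc_points D) x y"
    using assms unfolding connected_component_def by blast
  then show ?thesis
    unfolding arc_through_def by (auto simp: connected_component_eq_eq dest: connected_component_in)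
qed

lemma arc_through_in_arcs: "q \<in> arc_points D \<Longrightarrow> arc_through D q \<in> arcs D"
  unfolding arc_through_def arcs_def by (rule componentsI)

lemma mem_arc_through: "q \<in> arc_points D \<Longrightarrow> q \<in> arc_through D q"
  unfolding arc_through_def by (simp add: connected_component_refl)

lemma arc_eq_arc_through: "A \<in> arcs D \<Longrightarrow> x \<in> A \<Longrightarrow> A = arc_through D x"
  unfolding arcs_def arc_through_def components_def
  using connected_component_eq by blast

lemma arc_subset: "A \<in> arcs D \<Longrightarrow> A \<subseteq> arc_points D"
  unfolding arcs_def by (rule in_components_subset)

lemma arc_connected: "A \<in> arcs D \<Longrightarrow> connected A"
  unfolding arcs_def by (rule in_components_connected)

lemma arc_nonempty: "A \<in> arcs D \<Longrightarrow> A \<noteq> {}"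
  unfolding arcs_def by (rule in_components_nonempty)

lemma connected_rot_image: "connected T \<Longrightarrow> connected (rot p ` T)"
  by (rule connected_continuous_image[OF continuous_rot])

text \<open>Justifies the description by \<open>THE\<close>: the under-points are finite, so a short
  open interval next to \<open>p\<close> is free of them and, being connected, lies in one
  component; two components containing points of it are equal.\<close>

lemma arc_leaving:
  assumes "link_diagram D" "p \<in> points D" "s = 1 \<or> s = - 1"
  shows "arc_leaving D s p \<in> arcs D"
    and "\<forall>\<^sub>F t in at_right 0. rot p (s * t) \<in> arc_leaving D s p"
proof -
  obtain e where e: "e > 0" "\<And>t. t \<noteq> 0 \<Longrightarrow> \<bar>t\<bar> < e \<Longrightarrow> rot p t \<in> arc_points D"
    using eventually_rot_not_under[OF assms(1,2)] unfolding eventually_at by (auto simp: dist_real_def)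
  define C where "C = (\<lambda>t. rot p (s * t)) ` {0<..<e}"
  have C: "connected C" "C \<subseteq> arc_points D" "C \<noteq> {}"
  proof -
    have "connected (rot p ` ((*) s ` {0<..<e}))"
      by (intro connected_rot_image connected_continuous_image continuous_intros) auto
    then show "connected C" by (simp add: C_def image_image)
    show "C \<subseteq> arc_points D" using e(2) assms(3) by (fastforce simp: C_def)
    show "C \<noteq> {}" using e(1) by (auto simp: C_def)
  qed
  define A where "A = arc_through D (rot p (s * (e / 2)))"
  have x: "rot p (s * (e / 2)) \<in> C"
    unfolding C_def by (rule imageI) (use e(1) in auto)
  have A: "A \<in> arcs D" unfolding A_def using x C by (intro arc_through_in_arcs) auto
  have "C \<subseteq> A" unfolding A_def arc_through_def using x C by (intro connected_component_maximal)
  moreover have "\<forall>\<^sub>F t in at_right 0. t \<in> {0<..<e}" using e(1) by (intro eventually_at_right_real)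
  ultimately have ev: "\<forall>\<^sub>F t in at_right 0. rot p (s * t) \<in> A"
    by (auto simp: C_def elim!: eventually_mono)
  have "arc_leaving D s p = A"
    unfolding arc_leaving_def rot_def[symmetric]
  proof (rule the_equality)
    show "A \<in> arcs D \<and> (\<forall>\<^sub>F t in at_right 0. rot p (s * t) \<in> A)" using A ev by simp
    fix B assume B: "B \<in> arcs D \<and> (\<forall>\<^sub>F t in at_right 0. rot p (s * t) \<in> B)"
    with ev have "\<forall>\<^sub>F t in at_right 0. rot p (s * t) \<in> A \<and> rot p (s * t) \<in> B"
      by (simp add: eventually_conj_iff)
    then obtain t where "rot p (s * t) \<in> A" "rot p (s * t) \<in> B"
      using eventually_happens'[of "at_right (0::real)"] by auto
    then show "B = A" using A B arc_eq_arc_through by metis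
  qed
  then show "arc_leaving D s p \<in> arcs D" "\<forall>\<^sub>F t in at_right 0. rot p (s * t) \<in> arc_leaving D s p"
    using A ev by auto
qed

section \<open>Colorings\<close>

lemma dir_sign_cases: "dir_sign d = 1 \<or> dir_sign d = - 1"
  by (cases d) auto

lemma crossing_relations_in_words:
  assumes "link_diagram D" "c \<in> crossings D"
  shows "crossing_relations D d c \<subseteq> words (strings D) \<times> words (strings D)"
proof -
  obtain p q where c: "c = (p, q)" by (cases c)
  note facts = crossing_facts[OF assms(1) assms(2)[unfolded c]]
  have "arc_leaving D (dir_sign d) p \<in> arcs D" "arc_leaving D (- dir_sign d) p \<in> arcs D"
    using dir_sign_cases[of d] by (auto intro!: arc_leaving(1)[OF assms(1) facts(1)])
  moreover have "arc_through D q \<in> arcs D"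
    using facts by (intro arc_through_in_arcs) auto
  ultimately show ?thesis
    by (auto simp: c crossing_relations_def words_def strings_def)
qed

text \<open>Multiply \<open>z = x u\<inverse> v\<close> on the right by \<open>v\<inverse> u\<close>
  and cancel the inner pairs of letters one after the other.\<close>

lemma word_eq_reverse_relation:
  assumes "{x, u, v, z} \<subseteq> X"
    and "word_eq X R [(z, True)] [(x, True), (u, False), (v, True)]"
  shows "word_eq X R [(x, True)] [(z, True), (v, False), (u, True)]"
proof -
  have words: "set w \<subseteq> {x, u, v, z} \<times> UNIV \<Longrightarrow> word_eq X R w w" for w
    using assms(1) by (auto simp: words_def in_lists_conv_set intro!: word_eq.refl)
  have 1: "word_eq X R ([(z, True)] @ [(v, False), (u, True)])
      ([(x, True), (u, False), (v, True)] @ [(v, False), (u, True)])"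
    by (rule word_eq.append[OF assms(2) words]) auto
  have 2: "word_eq X R ([(x, True), (u, False)] @ ([(v, True), (v, \<not> True)] @ [(u, True)]))
      ([(x, True), (u, False)] @ ([] @ [(u, True)]))"
    using assms(1) by (intro word_eq.append[OF words word_eq.append[OF word_eq.cancel words]]) auto
  have 3: "word_eq X R ([(x, True)] @ [(u, False), (u, \<not> False)]) ([(x, True)] @ [])"
    using assms(1) by (intro word_eq.append[OF words word_eq.cancel]) auto
  show ?thesis
    using word_eq.trans[OF 1[simplified] word_eq.trans[OF 2[simplified] 3[simplified]]]
    by (rule word_eq.sym)
qed

text \<open>Reversing the traversal exchanges \<open>x\<close> with \<open>z\<close> and the first
  with the second over-string, so the new relation is the old one solved for the other end of the
  under-string.\<close>

lemma crossing_relation_other_direction: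
  assumes "link_diagram D" "c \<in> crossings D" "(l, r) \<in> crossing_relations D d c"
  shows "word_eq (strings D) (crossing_relations D d' c) l r"
proof (cases "d' = d")
  case True
  then show ?thesis using assms(3) by (auto intro: word_eq.relation)
next
  case False
  then have sign: "dir_sign d' = - dir_sign d" by (cases d; cases d') auto
  obtain p q where c: "c = (p, q)" by (cases c)
  \<comment> \<open>Transversality matters here: the sides are chosen by a strict inequality, and
    only for a non-zero determinant does the opposite sign select the opposite side.\<close>
  have "det2 (velocity D p) (velocity D q) \<noteq> 0"
    using crossing_facts(5)[OF assms(1) assms(2)[unfolded c]] .
  then have sides: "first_over_side D d' c = second_over_side D d c"
      "second_over_side D d' c = first_over_side D d c"
    using sign dir_sign_cases[of d]
    by (auto simp: c first_over_side_def second_over_side_def det2_def)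
  obtain s where s: "l = [((arc_leaving D (dir_sign d) p, s), True)]"
      "r = [((arc_leaving D (- dir_sign d) p, s), True),
        ((arc_through D q, first_over_side D d c), False),
        ((arc_through D q, second_over_side D d c), True)]"
    using assms(3) by (auto simp: c crossing_relations_def)
  have "([((arc_leaving D (- dir_sign d) p, s), True)],
       [((arc_leaving D (dir_sign d) p, s), True),
        ((arc_through D q, second_over_side D d c), False),
        ((arc_through D q, first_over_side D d c), True)]) \<in> crossing_relations D d' c"
    using sides sign by (auto simp: c crossing_relations_def)
  then have rel: "word_eq (strings D) (crossing_relations D d' c)
       [((arc_leaving D (- dir_sign d) p, s), True)]
       [((arc_leaving D (dir_sign d) p, s), True),
        ((arc_through D q, second_over_side D d c), False),
        ((arc_through D q, first_over_side D d c), True)]"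
    by (rule word_eq.relation)
  have "l \<in> words (strings D)" "r \<in> words (strings D)"
    using crossing_relations_in_words[OF assms(1,2)] assms(3) by blast+
  then show ?thesis
    unfolding s by (intro word_eq_reverse_relation[OF _ rel]) (auto simp: words_def)
qed

lemma word_eq_crossing_direction:
  assumes "link_diagram D" "c \<in> crossings D"
  shows "word_eq (strings D) (crossing_relations D d c) =
    word_eq (strings D) (crossing_relations D d' c)"
  by (rule word_eq_cong_relations) (rule crossing_relation_other_direction[OF assms], assumption)+

text \<open>The generators are the same and the relations generate the same congruence; as the
  elements are the classes of this congruence, the groups are equal and not merely
  isomorphic.\<close>

lemma fundamental_heap_direction:
  assumes "link_diagram D"
  shows "fundamental_heap D \<delta> = fundamental_heap D \<delta>'"
proof -
  have "word_eq (strings D) (\<Union>c\<in>crossings D. crossing_relations D (\<delta>1 c) c) l r"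
    if "(l, r) \<in> (\<Union>c\<in>crossings D. crossing_relations D (\<delta>2 c) c)" for \<delta>1 \<delta>2 l r
  proof -
    obtain c where c: "c \<in> crossings D" "(l, r) \<in> crossing_relations D (\<delta>2 c) c"
      using \<open>(l, r) \<in> _\<close> by blast
    then have "word_eq (strings D) (crossing_relations D (\<delta>1 c) c) l r"
      using crossing_relation_other_direction[OF assms] by blast
    then show ?thesis by (rule word_eq_subst) (use c(1) in \<open>auto intro!: word_eq.relation\<close>)
  qed
  then have "word_eq (strings D) (\<Union>c\<in>crossings D. crossing_relations D (\<delta> c) c) =
      word_eq (strings D) (\<Union>c\<in>crossings D. crossing_relations D (\<delta>' c) c)"
    by (intro word_eq_cong_relations) auto
  then show ?thesis by (simp add: fundamental_heap_def presented_group_def)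
qed

section \<open>Colorings and their jumps at under-crossings\<close>

text \<open>The factor \<open>u\<inverse> v\<close> of the defining relation, read off at the upper
  preimage of the crossing. That point is not an under-point, so the coloring has a meaningful value
  there.\<close>

definition jump :: "('g, 'm) monoid_scheme \<Rightarrow> diagram \<Rightarrow> (point \<Rightarrow> side \<Rightarrow> 'g) \<Rightarrow> point \<times> point \<Rightarrow> 'g"
  where "jump G D \<phi> c = inv\<^bsub>G\<^esub> \<phi> (snd c) (first_over_side D Forward c)
    \<otimes>\<^bsub>G\<^esub> \<phi> (snd c) (second_over_side D Forward c)"

text \<open>The relation is expressed by one-sided limits because the value of a coloring at the
  under-point itself is left arbitrary. The same factor \<open>k\<close> serves both boundary
  strings.\<close>

abbreviation jumps_by ::
    "('g, 'm) monoid_scheme \<Rightarrow> (point \<Rightarrow> side \<Rightarrow> 'g) \<Rightarrow> point \<Rightarrow> 'g \<Rightarrow> bool" where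
  "jumps_by G \<phi> p k \<equiv> \<exists>x z. (\<forall>\<^sub>F t in at_left 0. \<phi> (rot p t) = x) \<and>
     (\<forall>\<^sub>F t in at_right 0. \<phi> (rot p t) = z) \<and> (\<forall>s. z s = x s \<otimes>\<^bsub>G\<^esub> k)"

definition coloring :: "('g, 'm) monoid_scheme \<Rightarrow> diagram \<Rightarrow> (point \<Rightarrow> side \<Rightarrow> 'g) \<Rightarrow> bool" where
  "coloring G D \<phi> \<longleftrightarrow>
     (\<forall>p\<in>arc_points D. \<phi> p \<in> UNIV \<rightarrow> carrier G \<and> (\<forall>\<^sub>F t in at 0. \<phi> (rot p t) = \<phi> p)) \<and>
     (\<forall>c\<in>crossings D. jumps_by G \<phi> (fst c) (jump G D \<phi> c))"

lemma coloring_closed: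
  "coloring G D \<phi> \<Longrightarrow> p \<in> points D \<Longrightarrow> p \<notin> under_points D \<Longrightarrow> \<phi> p s \<in> carrier G"
  by (auto simp: coloring_def)

lemma coloring_connected:
  assumes "coloring G D \<phi>" "connected C" "C \<subseteq> arc_points D" "x \<in> C" "y \<in> C"
  shows "\<phi> x = \<phi> y"
  using assms by (intro constant_on_connected[of C D]) (auto simp: coloring_def)

lemma jump_closed:
  assumes "group G" "link_diagram D" "coloring G D \<phi>" "c \<in> crossings D"
  shows "jump G D \<phi> c \<in> carrier G"
proof -
  interpret group G by fact
  have "snd c \<in> points D" "snd c \<notin> under_points D"
    using crossing_facts[OF assms(2), of "fst c" "snd c"] assms(4) by auto
  then show ?thesis using coloring_closed[OF assms(3)] by (simp add: jump_def)
qed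

text \<open>The one-sided limits are values at nearby points; these are not under-points, so the
  limits lie in the carrier.\<close>

lemma coloring_crossing:
  assumes "group G" "link_diagram D" "coloring G D \<phi>" "c \<in> crossings D"
  obtains x z where "\<forall>\<^sub>F t in at_left 0. \<phi> (rot (fst c) t) = x"
    "\<forall>\<^sub>F t in at_right 0. \<phi> (rot (fst c) t) = z" "\<And>s. x s \<in> carrier G" "\<And>s. z s \<in> carrier G"
    "\<And>s. z s = x s \<otimes>\<^bsub>G\<^esub> jump G D \<phi> c"
proof -
  interpret group G by fact
  obtain x z where xz: "\<forall>\<^sub>F t in at_left 0. \<phi> (rot (fst c) t) = x"
      "\<forall>\<^sub>F t in at_right 0. \<phi> (rot (fst c) t) = z" "\<And>s. z s = x s \<otimes>\<^bsub>G\<^esub> jump G D \<phi> c"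
    using assms(3,4) by (auto simp: coloring_def)
  have "fst c \<in> points D"
    using crossing_facts[OF assms(2), of "fst c" "snd c"] assms(4) by auto
  then have "\<forall>\<^sub>F t in at_left 0. rot (fst c) t \<in> arc_points D"
    using eventually_rot_not_under[OF assms(2)] by (simp add: eventually_at_split)
  with xz(1) have "\<forall>\<^sub>F t in at_left (0::real). \<forall>s. x s \<in> carrier G"
    by eventually_elim (use coloring_closed[OF assms(3)] in blast)
  then have x: "x s \<in> carrier G" for s
    using eventually_happens'[of "at_left (0::real)"] by auto
  then have "z s \<in> carrier G" for s
    using xz(3) jump_closed[OF assms] by simp
  with xz x show ?thesis using that by blast
qed

text \<open>Lets an endomorphism of the group of a diagram be compared with the identity by
  comparing two colorings.\<close>

lemma coloring_hom:
  assumes "group G" "group H" "h \<in> hom G H" "link_diagram D" "coloring G D \<phi>"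
  shows "coloring H D (\<lambda>p s. h (\<phi> p s))"
proof -
  interpret h: group_hom G H h
    using assms by (simp add: group_hom_def group_hom_axioms_def)
  have jump: "jump H D (\<lambda>p s. h (\<phi> p s)) c = h (jump G D \<phi> c)" if "c \<in> crossings D" for c
  proof -
    have "snd c \<in> points D" "snd c \<notin> under_points D"
      using crossing_facts[OF assms(4), of "fst c" "snd c"] that by auto
    then show ?thesis using coloring_closed[OF assms(5)] by (simp add: jump_def)
  qed
  show ?thesis unfolding coloring_def
  proof (intro conjI ballI)
    fix p assume p: "p \<in> arc_points D"
    then show "(\<lambda>s. h (\<phi> p s)) \<in> UNIV \<rightarrow> carrier H"
      using coloring_closed[OF assms(5)] by auto
    have "\<forall>\<^sub>F t in at 0. \<phi> (rot p t) = \<phi> p" using p assms(5) by (simp add: coloring_def)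
    then show "\<forall>\<^sub>F t in at 0. (\<lambda>s. h (\<phi> (rot p t) s)) = (\<lambda>s. h (\<phi> p s))"
      by eventually_elim simp
  next
    fix c assume c: "c \<in> crossings D"
    obtain x z where xz: "\<forall>\<^sub>F t in at_left 0. \<phi> (rot (fst c) t) = x"
        "\<forall>\<^sub>F t in at_right 0. \<phi> (rot (fst c) t) = z" "\<And>s. x s \<in> carrier G"
        "\<And>s. z s = x s \<otimes>\<^bsub>G\<^esub> jump G D \<phi> c"
      by (rule coloring_crossing[OF assms(1,4,5) c]) blast
    show "jumps_by H (\<lambda>p s. h (\<phi> p s)) (fst c) (jump H D (\<lambda>p s. h (\<phi> p s)) c)"
      using xz jump[OF c] jump_closed[OF assms(1,4,5) c]
      by (intro exI[of _ "\<lambda>s. h (x s)"] exI[of _ "\<lambda>s. h (z s)"]) (auto elim: eventually_mono)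
  qed
qed

section \<open>The universal coloring and the homomorphisms given by colorings\<close>

type_synonym heap_monoid = "string_label word set monoid"

abbreviation heap_relations :: "diagram \<Rightarrow> (string_label word \<times> string_label word) set" where
  "heap_relations D \<equiv> \<Union>c\<in>crossings D. crossing_relations D Forward c"

abbreviation heap_group :: "diagram \<Rightarrow> heap_monoid" where
  "heap_group D \<equiv> presented_group (strings D) (heap_relations D)"

text \<open>The coloring of \<open>D\<close> in its own group that corresponds to the identity
  homomorphism.\<close>

definition univ_coloring :: "diagram \<Rightarrow> point \<Rightarrow> side \<Rightarrow> string_label word set" where
  "univ_coloring D p s = generator (strings D) (heap_relations D) (arc_through D p, s)"

lemma univ_coloring_closed:
  assumes "p \<in> arc_points D"
  shows "univ_coloring D p s \<in> carrier (heap_group D)"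
  unfolding univ_coloring_def using arc_through_in_arcs[OF assms]
  by (intro generator_closed) (simp add: strings_def)

lemma generator_eq_univ_coloring:
  assumes "(A, s) \<in> strings D"
  obtains p where "p \<in> arc_points D"
    "generator (strings D) (heap_relations D) (A, s) = univ_coloring D p s"
proof -
  have A: "A \<in> arcs D" using assms by (simp add: strings_def)
  then obtain p where p: "p \<in> A" using arc_nonempty by blast
  show ?thesis
    using that[of p] A p arc_subset[OF A] arc_eq_arc_through[OF A p]
    by (auto simp: univ_coloring_def)
qed

lemma univ_coloring_leaving:
  assumes "link_diagram D" "p \<in> points D" "s = 1 \<or> s = - 1"
  shows "\<forall>\<^sub>F t in at_right 0. univ_coloring D (rot p (s * t)) =
    (\<lambda>d. generator (strings D) (heap_relations D) (arc_leaving D s p, d))"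
  using arc_leaving(2)[OF assms]
proof eventually_elim
  case (elim t)
  then have "arc_leaving D s p = arc_through D (rot p (s * t))"
    using arc_leaving(1)[OF assms] arc_eq_arc_through by blast
  then show ?case by (simp add: univ_coloring_def fun_eq_iff)
qed

lemma eventually_at_left_0: "(\<forall>\<^sub>F t in at_left 0. P t) \<longleftrightarrow> (\<forall>\<^sub>F t in at_right (0::real). P (- 1 * t))"
  using eventually_filtermap[of P uminus "at_right (0::real)"] by (simp add: at_left_minus[of 0])

text \<open>Points of a short interval free of under-points lie on one arc and get the same
  generator; the jump condition at a crossing is the defining relation for the direction
  \<open>Forward\<close>.\<close>

lemma coloring_univ_coloring:
  assumes "link_diagram D"
  shows "coloring (heap_group D) D (univ_coloring D)"
  unfolding coloring_def
proof (intro conjI ballI)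
  fix p assume p: "p \<in> arc_points D"
  then show "univ_coloring D p \<in> UNIV \<rightarrow> carrier (heap_group D)"
    using univ_coloring_closed by auto
  obtain e where e: "e > 0" "\<And>t. t \<noteq> 0 \<Longrightarrow> \<bar>t\<bar> < e \<Longrightarrow> rot p t \<in> arc_points D"
    using eventually_rot_not_under[OF assms(1), of p] p unfolding eventually_at
    by (auto simp: dist_real_def)
  have "univ_coloring D (rot p t) = univ_coloring D p" if "t \<in> {-e<..<e}" for t
  proof -
    have "arc_through D (rot p t) = arc_through D (rot p 0)"
    proof (rule arc_throughI)
      show "connected (rot p ` {-e<..<e})" by (intro connected_rot_image) auto
      show "rot p ` {-e<..<e} \<subseteq> arc_points D"
      proof
        fix x assume "x \<in> rot p ` {-e<..<e}"
        then obtain t where "x = rot p t" "\<bar>t\<bar> < e" by auto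
        then show "x \<in> arc_points D" using e(2)[of t] p by (cases "t = 0") auto
      qed
      show "rot p t \<in> rot p ` {-e<..<e}" "rot p 0 \<in> rot p ` {-e<..<e}"
        by (rule imageI, use that e(1) in simp)+
    qed
    then show ?thesis by (simp add: univ_coloring_def fun_eq_iff)
  qed
  moreover have "\<forall>\<^sub>F t in at 0. t \<in> {-e<..<e}"
    using e(1) by (intro eventually_at_in_open') auto
  ultimately show "\<forall>\<^sub>F t in at 0. univ_coloring D (rot p t) = univ_coloring D p"
    by (auto elim: eventually_mono)
next
  fix c assume c: "c \<in> crossings D"
  obtain p q where pq: "c = (p, q)" by (cases c)
  note facts = crossing_facts[OF assms(1) c[unfolded pq]]
  interpret group "heap_group D" by (rule group_presented_group)
  define g where "g = generator (strings D) (heap_relations D)"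
  have g_closed: "g (A, s) \<in> carrier (heap_group D)" if "A \<in> arcs D" for A s
    unfolding g_def using that by (intro generator_closed) (simp add: strings_def)
  have q: "arc_through D q \<in> arcs D" using facts by (intro arc_through_in_arcs) auto
  have l: "arc_leaving D (- 1) p \<in> arcs D" "arc_leaving D 1 p \<in> arcs D"
    using arc_leaving(1)[OF assms(1) facts(1)] by auto
  have "g (arc_leaving D 1 p, s) = g (arc_leaving D (- 1) p, s) \<otimes>\<^bsub>heap_group D\<^esub>
      jump (heap_group D) D (univ_coloring D) c" for s
  proof -
    let ?r = "[((arc_leaving D (- 1) p, s), True),
        ((arc_through D q, first_over_side D Forward c), False),
        ((arc_through D q, second_over_side D Forward c), True)]"
    have r: "?r \<in> words (strings D)" using l q by (auto simp: words_def strings_def)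
    have "([((arc_leaving D 1 p, s), True)], ?r) \<in> heap_relations D"
      using c by (auto simp: pq crossing_relations_def intro!: bexI[of _ "(p, q)"])
    then have "g (arc_leaving D 1 p, s) = word_class (strings D) (heap_relations D) ?r"
      by (simp add: g_def generator_def presented_group_relation)
    \<comment> \<open>The identity homomorphism shows that the class of a word is the product of the
      classes of its letters.\<close>
    also have "\<dots> = word_value (heap_group D) g ?r"
      using word_value_hom[of id, OF _ r] by (simp add: g_def hom_def)
    also have "\<dots> = g (arc_leaving D (- 1) p, s) \<otimes>\<^bsub>heap_group D\<^esub>
        jump (heap_group D) D (univ_coloring D) c"
      using g_closed q l by (simp add: jump_def univ_coloring_def g_def[symmetric] pq m_assoc)
    finally show ?thesis .
  qed
  then show "jumps_by (heap_group D) (univ_coloring D) (fst c)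
      (jump (heap_group D) D (univ_coloring D) c)"
    using univ_coloring_leaving[OF assms facts(1), of 1]
      univ_coloring_leaving[OF assms facts(1), of "- 1"]
    by (intro exI[of _ "\<lambda>s. g (arc_leaving D (- 1) p, s)"] exI[of _ "\<lambda>s. g (arc_leaving D 1 p, s)"])
      (simp add: eventually_at_left_0 pq g_def)
qed

text \<open>A coloring is constant on each arc because arcs are connected, so it assigns values to
  the strings; the jump conditions are exactly the relations that these values have to
  satisfy.\<close>

lemma hom_of_coloring:
  assumes "group G" "link_diagram D" "coloring G D \<phi>"
  obtains h where "h \<in> hom (heap_group D) G"
    "\<And>p s. p \<in> arc_points D \<Longrightarrow> h (univ_coloring D p s) = \<phi> p s"
proof -
  interpret group G by fact
  define f where "f = (\<lambda>(A, s). \<phi> (SOME x. x \<in> A) s)"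
  have f: "f (A, s) = \<phi> x s" if "A \<in> arcs D" "x \<in> A" for A x s
  proof -
    have "(SOME x. x \<in> A) \<in> A" using that(2) by (rule someI)
    then have "\<phi> (SOME x. x \<in> A) = \<phi> x"
      using coloring_connected[OF assms(3) arc_connected[OF that(1)] arc_subset[OF that(1)]] that(2)
      by blast
    then show ?thesis by (simp add: f_def)
  qed
  have f_closed: "f \<in> strings D \<rightarrow> carrier G"
  proof
    fix a assume "a \<in> strings D"
    then obtain A s where a: "a = (A, s)" "A \<in> arcs D" by (auto simp: strings_def)
    moreover obtain x where "x \<in> A" using arc_nonempty[OF a(2)] by blast
    ultimately show "f a \<in> carrier G"
      using f[of A x s] arc_subset[of A D] coloring_closed[OF assms(3), of x] by auto
  qed
  \<comment> \<open>The arc leaving \<open>p\<close> contains all points sufficiently close to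
    \<open>p\<close> on that side, so its value is the one-sided limit there.\<close>
  have f_leaving: "f (arc_leaving D e p, s) = x s"
    if "p \<in> points D" "e = 1 \<or> e = - 1" "\<forall>\<^sub>F t in at_right 0. \<phi> (rot p (e * t)) = x" for p e x s
  proof -
    have "\<forall>\<^sub>F t in at_right (0::real). f (arc_leaving D e p, s) = x s"
      using arc_leaving(2)[OF assms(2) that(1,2)] that(3)
      by eventually_elim (use f arc_leaving(1)[OF assms(2) that(1,2)] in metis)
    then show ?thesis using eventually_happens'[of "at_right (0::real)"] by auto
  qed
  have rel: "word_value G f l = word_value G f r" if "(l, r) \<in> heap_relations D" for l r
  proof -
    obtain c where c: "c \<in> crossings D" "(l, r) \<in> crossing_relations D Forward c"
      using \<open>(l, r) \<in> heap_relations D\<close> by auto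
    obtain p q where pq: "c = (p, q)" by (cases c)
    note facts = crossing_facts[OF assms(2) c(1)[unfolded pq]]
    obtain s where lr: "l = [((arc_leaving D 1 p, s), True)]"
      "r = [((arc_leaving D (- 1) p, s), True), ((arc_through D q, first_over_side D Forward c), False),
        ((arc_through D q, second_over_side D Forward c), True)]"
      using c(2) by (auto simp: pq crossing_relations_def)
    obtain x z where xz: "\<forall>\<^sub>F t in at_left 0. \<phi> (rot p t) = x"
        "\<forall>\<^sub>F t in at_right 0. \<phi> (rot p t) = z" "\<And>s. z s = x s \<otimes>\<^bsub>G\<^esub> jump G D \<phi> c"
      using assms(3) c(1) by (fastforce simp: coloring_def pq)
    have x: "f (arc_leaving D (- 1) p, s) = x s"
      using xz(1) by (intro f_leaving facts) (auto simp: eventually_at_left_0)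
    have z: "f (arc_leaving D 1 p, s) = z s"
      using xz(2) by (intro f_leaving facts) auto
    have q: "f (arc_through D q, s') = \<phi> q s'" for s'
      using facts by (intro f arc_through_in_arcs mem_arc_through) auto
    have "f (arc_leaving D 1 p, s) \<in> carrier G" "f (arc_leaving D (- 1) p, s) \<in> carrier G"
      using arc_leaving(1)[OF assms(2) facts(1)] f_closed by (auto simp: strings_def Pi_iff)
    then show ?thesis
      using coloring_closed[OF assms(3) facts(2,4)]
      by (simp add: lr x z q xz(3) jump_def pq m_assoc)
  qed
  have R: "heap_relations D \<subseteq> words (strings D) \<times> words (strings D)"
    using crossing_relations_in_words[OF assms(2)] by blast
  obtain h where h: "h \<in> hom (heap_group D) G"
      "\<And>x. x \<in> strings D \<Longrightarrow> h (generator (strings D) (heap_relations D) x) = f x"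
    using presented_group_hom_exists[OF R f_closed rel] by blast
  have "h (univ_coloring D p s) = \<phi> p s" if "p \<in> arc_points D" for p s
    using that h(2) f arc_through_in_arcs[OF that] mem_arc_through[OF that]
    by (simp add: univ_coloring_def strings_def)
  with h(1) show ?thesis using that by blast
qed

section \<open>From bijections of colorings to isomorphisms of groups\<close>

text \<open>The relation \<open>W\<close> is fixed before \<open>G\<close>, which expresses
  naturality. A definition quantifies over groups of one type only; \<open>heap_monoid\<close>
  contains the groups of all diagrams, and these are the groups to which the property is
  applied.\<close>

definition colorings_extend ::
    "diagram \<Rightarrow> diagram \<Rightarrow> ((point \<times> side) \<times> (point \<times> side)) set \<Rightarrow> bool" where
  "colorings_extend D D' W \<longleftrightarrow>
     (\<forall>(G :: heap_monoid) \<phi>. group G \<and> coloring G D \<phi> \<longrightarrow>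
        (\<exists>\<phi>'. coloring G D' \<phi>' \<and> (\<forall>((p, s), (p', s'))\<in>W. \<phi>' p' s' = \<phi> p s)))"

definition colorings_determined :: "diagram \<Rightarrow> (point \<times> side) set \<Rightarrow> bool" where
  "colorings_determined D V \<longleftrightarrow>
     (\<forall>(G :: heap_monoid) \<phi> \<psi>.
        group G \<and> coloring G D \<phi> \<and> coloring G D \<psi> \<and> (\<forall>(p, s)\<in>V. \<phi> p s = \<psi> p s) \<longrightarrow>
        (\<forall>p\<in>arc_points D. \<phi> p = \<psi> p))"

text \<open>The universal coloring of \<open>D'\<close> yields a coloring of \<open>D\<close> in the
  group of \<open>D'\<close>, that is, a homomorphism from the group of \<open>D\<close>. Extending
  colorings from \<open>D'\<close> to \<open>D\<close> hence gives a homomorphism in the opposite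
  direction.\<close>

lemma hom_of_extension:
  assumes "link_diagram D" "link_diagram D'" "colorings_extend D' D W"
    and "fst ` snd ` W \<subseteq> arc_points D"
  shows "\<exists>h\<in>hom (heap_group D) (heap_group D').
    \<forall>((p', s'), (p, s))\<in>W. h (univ_coloring D p s) = univ_coloring D' p' s'"
proof -
  have "\<exists>\<phi>. coloring (heap_group D') D \<phi> \<and>
      (\<forall>((p', s'), (p, s))\<in>W. \<phi> p s = univ_coloring D' p' s')"
    using assms(3)[unfolded colorings_extend_def, rule_format,
        OF conjI[OF group_presented_group coloring_univ_coloring[OF assms(2)]]] .
  then obtain \<phi> where \<phi>: "coloring (heap_group D') D \<phi>"
      "\<forall>((p', s'), (p, s))\<in>W. \<phi> p s = univ_coloring D' p' s'"
    by (elim exE conjE)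
  obtain h where h: "h \<in> hom (heap_group D) (heap_group D')"
      "\<And>p s. p \<in> arc_points D \<Longrightarrow> h (univ_coloring D p s) = \<phi> p s"
    using hom_of_coloring[OF group_presented_group assms(1) \<phi>(1)] by blast
  have "h (univ_coloring D p s) = univ_coloring D' p' s'"
    if "((p', s'), (p, s)) \<in> W" for p s p' s'
  proof -
    have "p \<in> fst ` snd ` W" using that by force
    then have "p \<in> arc_points D" using assms(4) by (rule subsetD[rotated])
    then have "h (univ_coloring D p s) = \<phi> p s" by (rule h(2))
    also have "\<dots> = univ_coloring D' p' s'"
      using bspec[OF \<phi>(2) that] by simp
    finally show ?thesis .
  qed
  with h(1) show ?thesis by blast
qed

text \<open>The composite maps the universal coloring to a coloring of \<open>D\<close> that agrees
  with it on \<open>V\<close>. As \<open>V\<close> determines colorings, the composite fixes every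
  generator and is the identity.\<close>

lemma comp_hom_eq_id:
  assumes "link_diagram D" "colorings_determined D V" "group H"
    and h: "h \<in> hom (heap_group D) H" and k: "k \<in> hom H (heap_group D)"
    and V: "\<And>p s. (p, s) \<in> V \<Longrightarrow> k (h (univ_coloring D p s)) = univ_coloring D p s"
    and A: "A \<in> carrier (heap_group D)"
  shows "k (h A) = A"
proof -
  interpret D: group "heap_group D" by (rule group_presented_group)
  have kh: "(\<lambda>x. k (h x)) \<in> hom (heap_group D) (heap_group D)"
    using hom_compose[OF h k] by (simp add: o_def)
  have "coloring (heap_group D) D (\<lambda>p s. k (h (univ_coloring D p s)))"
    by (rule coloring_hom[OF _ _ kh assms(1) coloring_univ_coloring[OF assms(1)]])
      (rule group_presented_group)+
  then have eq: "(\<lambda>s. k (h (univ_coloring D p s))) = univ_coloring D p"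
    if "p \<in> arc_points D" for p
    using assms(2) coloring_univ_coloring[OF assms(1)] V that group_presented_group
    unfolding colorings_determined_def by blast
  have "k (h A) = id A"
  proof (rule D.presented_group_hom_unique[OF kh _ _ A])
    show "id \<in> hom (heap_group D) (heap_group D)" by (simp add: hom_def)
    fix x assume "x \<in> strings D"
    then obtain B s p where "x = (B, s)" "p \<in> arc_points D"
        "generator (strings D) (heap_relations D) x = univ_coloring D p s"
      by (cases x) (metis generator_eq_univ_coloring)
    then show "k (h (generator (strings D) (heap_relations D) x)) =
        id (generator (strings D) (heap_relations D) x)"
      using eq[of p] by (simp add: fun_eq_iff)
  qed
  then show ?thesis by simp
qed

text \<open>A form of the Yoneda argument: both homomorphisms respect the matching \<open>W\<close>
  of positions, so each of the two composites fixes the universal coloring at the positions that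
  determine it.\<close>

lemma heap_group_iso:
  assumes "link_diagram D" "link_diagram D'"
    and "colorings_extend D D' W" "colorings_extend D' D (W\<inverse>)"
    and "colorings_determined D (fst ` W)" "colorings_determined D' (snd ` W)"
    and "fst ` fst ` W \<subseteq> arc_points D" "fst ` snd ` W \<subseteq> arc_points D'"
  shows "heap_group D \<cong> heap_group D'"
proof -
  have "snd ` W\<inverse> = fst ` W" by force
  then have W: "fst ` snd ` W\<inverse> \<subseteq> arc_points D" using assms(7) by simp
  obtain h where h: "h \<in> hom (heap_group D) (heap_group D')"
    "\<forall>((p', s'), (p, s))\<in>W\<inverse>. h (univ_coloring D p s) = univ_coloring D' p' s'"
    using hom_of_extension[OF assms(1,2,4) W] by (elim bexE)
  obtain k where k: "k \<in> hom (heap_group D') (heap_group D)"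
    "\<forall>((p, s), (p', s'))\<in>W. k (univ_coloring D' p' s') = univ_coloring D p s"
    using hom_of_extension[OF assms(2,1,3,8)] by (elim bexE)
  have W_h: "h (univ_coloring D p s) = univ_coloring D' p' s'"
    and W_k: "k (univ_coloring D' p' s') = univ_coloring D p s"
    if "((p, s), (p', s')) \<in> W" for p s p' s'
    using bspec[OF h(2) converseI[OF that]] bspec[OF k(2) that] by simp_all
  have kh: "k (h A) = A" if "A \<in> carrier (heap_group D)" for A
  proof (rule comp_hom_eq_id[OF assms(1,5) group_presented_group h(1) k(1) _ that])
    fix p s assume "(p, s) \<in> fst ` W"
    then obtain p' s' where "((p, s), (p', s')) \<in> W" by force
    then show "k (h (univ_coloring D p s)) = univ_coloring D p s"
      by (simp add: W_h W_k)
  qed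
  have hk: "h (k A) = A" if "A \<in> carrier (heap_group D')" for A
  proof (rule comp_hom_eq_id[OF assms(2,6) group_presented_group k(1) h(1) _ that])
    fix p' s' assume "(p', s') \<in> snd ` W"
    then obtain p s where "((p, s), (p', s')) \<in> W" by force
    then show "h (k (univ_coloring D' p' s')) = univ_coloring D' p' s'"
      by (simp add: W_h W_k)
  qed
  have "bij_betw h (carrier (heap_group D)) (carrier (heap_group D'))"
    using kh hk h(1) k(1) by (intro bij_betw_byWitness[where f' = k]) (auto simp: hom_def)
  then show ?thesis using h(1) by (auto simp: is_iso_def iso_def)
qed

section \<open>Tangent vectors of the curves\<close>

lemma has_velocity:
  assumes "link_diagram D" "i < ncomp D"
  shows "((\<lambda>t. curve D (i, cis t)) has_vector_derivative velocity D (i, cis a)) (at a)"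
proof -
  have "(\<lambda>t. curve D (i, cis t)) C1_differentiable_on UNIV"
    using assms unfolding link_diagram_def by blast
  then obtain v where v: "((\<lambda>t. curve D (i, cis t)) has_vector_derivative v) (at a)"
    unfolding C1_differentiable_on_def by auto
  have "((\<lambda>t. a + t) has_vector_derivative 1) (at 0)"
    by (auto intro!: derivative_eq_intros)
  from vector_diff_chain_at[OF this, of "\<lambda>t. curve D (i, cis t)" v] v
  have "((\<lambda>t. curve D (i, cis a * cis t)) has_vector_derivative v) (at 0)"
    by (simp add: o_def cis_mult)
  then have "velocity D (i, cis a) = v"
    unfolding velocity_def by (simp add: vector_derivative_at)
  with v show ?thesis by simp
qed

lemma velocity_eqI:
  assumes "link_diagram D" "i < ncomp D"
    "((\<lambda>t. curve D (i, cis t)) has_vector_derivative v) (at a)"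
  shows "velocity D (i, cis a) = v"
  using has_velocity[OF assms(1,2)] assms(3) vector_derivative_unique_at by blast

section \<open>Planar isotopies\<close>

text \<open>Multiplicativity of the determinant; \<open>det2 (L 1) (L \<i>)\<close> is the
  determinant of \<open>L\<close>.\<close>

lemma det2_linear:
  assumes "linear L"
  shows "det2 (L v) (L w) = det2 (L 1) (L \<i>) * det2 v w"
proof -
  interpret linear L by fact
  have *: "L z = Re z *\<^sub>R L 1 + Im z *\<^sub>R L \<i>" for z
  proof -
    have "L z = L (Re z *\<^sub>R 1 + Im z *\<^sub>R \<i>)"
      by (rule arg_cong[of _ _ L]) (simp add: complex_eq_iff)
    then show ?thesis by (simp add: add scaleR)
  qed
  show ?thesis
    by (subst *[of v], subst *[of w]) (simp add: det2_def algebra_simps)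
qed

lemma det2_injective:
  assumes "linear L" "inj L"
  shows "det2 (L 1) (L \<i>) \<noteq> 0"
proof
  interpret linear L by fact
  assume det: "det2 (L 1) (L \<i>) = 0"
  \<comment> \<open>The coefficients are those of Cramer's rule: each of the two combinations of
    \<open>L 1\<close> and \<open>L \<i>\<close> has one coordinate that vanishes identically and
    one that is the determinant up to sign.\<close>
  have "L (Im (L \<i>) *\<^sub>R 1 - Im (L 1) *\<^sub>R \<i>) = 0" "L (Re (L \<i>) *\<^sub>R 1 - Re (L 1) *\<^sub>R \<i>) = 0"
    unfolding diff scaleR using det by (auto simp: complex_eq_iff det2_def algebra_simps)
  then have "Im (L \<i>) *\<^sub>R 1 - Im (L 1) *\<^sub>R \<i> = 0" "Re (L \<i>) *\<^sub>R 1 - Re (L 1) *\<^sub>R \<i> = 0"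
    using assms(2) linear_injective_0[OF assms(1)] by blast+
  then have "L 1 = 0" by (auto simp: complex_eq_iff)
  then show False using assms(2) linear_injective_0[OF assms(1)] by force
qed

text \<open>At a fixed point \<open>x\<close> the Jacobian determinant is continuous in the time,
  never zero, and equal to 1 at time 0; the intermediate value theorem keeps it positive.\<close>

lemma plane_isotopy_det2_pos:
  assumes "plane_isotopy H"
  obtains L where "(H 1 has_derivative L) (at x)" "det2 (L 1) (L \<i>) > 0"
proof -
  obtain H' where H': "\<And>t x. t \<in> {0..1} \<Longrightarrow> (H t has_derivative H' t x) (at x)"
      "\<And>t x. t \<in> {0..1} \<Longrightarrow> inj (H' t x)"
      "\<And>v. continuous_on ({0..1} \<times> UNIV) (\<lambda>(t, x). H' t x v)"
    using assms unfolding plane_isotopy_def by blast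
  define f where "f t = det2 (H' t x 1) (H' t x \<i>)" for t
  have cont: "continuous_on {0..1} (\<lambda>t. H' t x v)" for v
  proof -
    have "continuous_on {0..1} ((\<lambda>(t, x). H' t x v) \<circ> (\<lambda>t. (t, x)))"
      by (rule continuous_on_compose[OF _ continuous_on_subset[OF H'(3)]])
        (auto intro!: continuous_intros)
    then show ?thesis by (simp add: o_def)
  qed
  have f_cont: "continuous_on {0..1} f"
    unfolding f_def det2_def by (intro continuous_intros cont)
  have f_ne: "f t \<noteq> 0" if "t \<in> {0..1}" for t
    unfolding f_def using H'(1,2)[OF that] by (intro det2_injective has_derivative_linear) auto
  have "(H 0 has_derivative (\<lambda>v. v)) (at x)"
    using assms by (simp add: plane_isotopy_def id_def)
  then have "H' 0 x = (\<lambda>v. v)"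
    using has_derivative_unique[OF H'(1)[of 0 x]] by simp
  then have "f 0 = 1" by (simp add: f_def det2_def)
  have "f 1 > 0"
  proof (rule ccontr)
    assume "\<not> f 1 > 0"
    then obtain t where "t \<in> {0..1}" "f t = 0"
      using IVT2'[of f 1 0 0] f_cont \<open>f 0 = 1\<close> by auto
    then show False using f_ne by blast
  qed
  then show ?thesis using that H'(1)[of 1 x] by (simp add: f_def)
qed

text \<open>Parameters and under-points are the same in both diagrams, so arcs and crossings
  coincide as sets. Only the order of the over-strings could change, and it depends on the sign of a
  determinant that the isotopy preserves.\<close>

lemma planar_isotopic_heap_group:
  assumes "link_diagram D" "link_diagram D'" "planar_isotopic D D'"
  shows "heap_group D' = heap_group D"
proof -
  obtain H where H: "plane_isotopy H" "\<And>p. p \<in> points D \<Longrightarrow> curve D' p = H 1 (curve D p)"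
    and n: "ncomp D' = ncomp D" and under: "under_points D' = under_points D"
    using assms(3) unfolding planar_isotopic_def by blast
  have points: "points D' = points D" by (simp add: points_def n)
  have "inj (H 1)" using H(1) unfolding plane_isotopy_def bij_def by auto
  then have crossings: "crossings D' = crossings D"
    unfolding crossings_def points under using H(2) by (auto simp: inj_eq)
  have det: "sgn (det2 (velocity D' p) (velocity D' q)) = sgn (det2 (velocity D p) (velocity D q))"
    if pq: "(p, q) \<in> crossings D" for p q
  proof -
    obtain L where L: "(H 1 has_derivative L) (at (curve D p))" "det2 (L 1) (L \<i>) > 0"
      using plane_isotopy_det2_pos[OF H(1)] .
    have lin: "linear L" using L(1) has_derivative_linear by blast
    have vel: "velocity D' r = L (velocity D r)" if r: "r \<in> points D" "curve D r = curve D p" for r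
    proof -
      obtain i a where i: "r = (i, cis a)" "i < ncomp D" using points_cisE[OF r(1)] .
      have "((\<lambda>t. curve D (i, cis t)) has_derivative (\<lambda>t. t *\<^sub>R velocity D r)) (at a)"
        using has_velocity[OF assms(1) i(2)] by (simp add: has_vector_derivative_def i(1))
      then have "((\<lambda>t. H 1 (curve D (i, cis t))) has_derivative (\<lambda>t. L (t *\<^sub>R velocity D r))) (at a)"
        using L(1) r(2) i(1) by (intro has_derivative_compose[of _ _ a UNIV "H 1"]) auto
      then have "((\<lambda>t. curve D' (i, cis t)) has_vector_derivative L (velocity D r)) (at a)"
        using H(2) i(2) linear_scale[OF lin] by (simp add: has_vector_derivative_def)
      then show ?thesis using velocity_eqI[OF assms(2)] i n by simp
    qed
    have "p \<in> points D" "q \<in> points D" "curve D q = curve D p"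
      using pq by (auto simp: crossings_def)
    then have "velocity D' p = L (velocity D p)" "velocity D' q = L (velocity D q)"
      using vel by auto
    then have "det2 (velocity D' p) (velocity D' q) =
        det2 (L 1) (L \<i>) * det2 (velocity D p) (velocity D q)"
      by (simp only: det2_linear[OF lin, symmetric])
    then show ?thesis using L(2) by (simp add: sgn_mult)
  qed
  have "crossing_relations D' Forward c = crossing_relations D Forward c" if "c \<in> crossings D" for c
  proof -
    obtain p q where c: "c = (p, q)" by (cases c)
    have "det2 (velocity D' p) (velocity D' q) > 0 \<longleftrightarrow> det2 (velocity D p) (velocity D q) > 0"
      using det[of p q] that c by (metis sgn_greater)
    then show ?thesis
      by (simp add: c crossing_relations_def first_over_side_def second_over_side_def
          arc_leaving_def arc_through_def arcs_def points under)
  qed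
  then show ?thesis
    by (simp add: strings_def arcs_def points under crossings)
qed

section \<open>Reparametrizations\<close>

lemma cis_eq_cis_iff: "cis x = cis y \<longleftrightarrow> (\<exists>k::int. x = y + 2 * pi * k)"
proof
  assume "cis x = cis y"
  then have "sin x = sin y \<and> cos x = cos y" by (auto simp: complex_eq_iff)
  then show "\<exists>k::int. x = y + 2 * pi * k"
    unfolding sin_cos_eq_iff by (auto simp: algebra_simps)
next
  assume "\<exists>k::int. x = y + 2 * pi * k"
  then show "cis x = cis y"
    by (metis cis_multiple_2pi cis_mult mult.right_neutral Ints_of_int mult.commute)
qed

text \<open>The body of \<open>same_diagram\<close> with its witnesses as parameters, so that points
  can be transported by them and they can be inverted.\<close>

definition reparametrizes ::
    "diagram \<Rightarrow> diagram \<Rightarrow> (nat \<Rightarrow> nat) \<Rightarrow> (nat \<Rightarrow> real) \<Rightarrow> (nat \<Rightarrow> real \<Rightarrow> real) \<Rightarrow> bool" where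
  "reparametrizes D D' \<sigma> \<epsilon> f \<longleftrightarrow>
     bij_betw \<sigma> {..<ncomp D} {..<ncomp D'} \<and>
     (\<forall>i<ncomp D. \<epsilon> i \<in> {1, - 1 :: real} \<and>
        f i C1_differentiable_on UNIV \<and>
        (\<forall>t. vector_derivative (f i) (at t) \<noteq> 0) \<and>
        (\<forall>t. f i (t + 2 * pi) = f i t + \<epsilon> i * (2 * pi)) \<and>
        (\<forall>t. curve D' (\<sigma> i, cis (f i t)) = curve D (i, cis t)) \<and>
        (\<forall>t. (\<sigma> i, cis (f i t)) \<in> under_points D' \<longleftrightarrow> (i, cis t) \<in> under_points D))"

lemma same_diagram_iff: "same_diagram D D' \<longleftrightarrow> (\<exists>\<sigma> \<epsilon> f. reparametrizes D D' \<sigma> \<epsilon> f)"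
  unfolding same_diagram_def reparametrizes_def ..

section \<open>Lifts of circle diffeomorphisms of degree \<open>e\<close>\<close>

locale circle_lift =
  fixes F :: "real \<Rightarrow> real" and e :: real
  assumes e: "e \<in> {1, - 1}"
    and C1: "F C1_differentiable_on UNIV"
    and nz: "vector_derivative F (at t) \<noteq> 0"
    and period: "F (t + 2 * pi) = F t + e * (2 * pi)"
begin

abbreviation F' :: "real \<Rightarrow> real" where "F' t \<equiv> vector_derivative F (at t)"

lemma has_deriv: "(F has_vector_derivative F' t) (at t)"
  using C1 by (auto simp: C1_differentiable_on_eq vector_derivative_works)

lemma has_real_deriv: "(F has_real_derivative F' t) (at t)"
  using has_deriv by (simp add: has_real_derivative_iff_has_vector_derivative)

lemma cont: "continuous_on A F"
  using has_real_deriv DERIV_isCont continuous_at_imp_continuous_on by blast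

lemma cont': "continuous_on A F'"
  using C1 by (auto simp: C1_differentiable_on_eq intro: continuous_on_subset)

lemma increasing_if_deriv_pos:
  assumes "\<And>t. s * F' t > 0" "x < y"
  shows "s * F x < s * F y"
proof (rule DERIV_pos_imp_increasing[OF assms(2)])
  fix t
  show "\<exists>y. ((\<lambda>x. s * F x) has_real_derivative y) (at t) \<and> y > 0"
    using assms(1) DERIV_cmult[OF has_real_deriv] by blast
qed

text \<open>The derivative is continuous without zeros, hence of constant sign, and the increment
  \<open>e * (2 * pi)\<close> over one period shows that this sign is that of
  \<open>e\<close>.\<close>

lemma deriv_pos: "e * F' t > 0"
proof -
  have const_sign: "s * F' u > 0" if s: "s \<noteq> 0" "s * F' t > 0" for s t u
  proof (rule ccontr)
    assume "\<not> s * F' u > 0"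
    then have "s * F' u < 0" using nz s(1) by (metis linorder_neqE_linordered_idom mult_eq_0_iff)
    moreover have "connected (range (\<lambda>t. s * F' t))"
      by (intro connected_continuous_image continuous_intros cont') simp
    ultimately have "0 \<in> range (\<lambda>t. s * F' t)"
      using s(2) by (meson connectedD_interval less_imp_le rangeI)
    then show False using nz s(1) by auto
  qed
  have "\<not> (- e) * F' t > 0"
  proof
    assume "(- e) * F' t > 0"
    then have "(- e) * F' u > 0" for u using const_sign[of "- e"] e by auto
    then have "(- e) * F 0 < (- e) * F (0 + 2 * pi)" by (intro increasing_if_deriv_pos) auto
    then show False unfolding period using e by auto
  qed
  moreover have "e * F' t \<noteq> 0" using nz e by auto
  ultimately show ?thesis by (simp add: not_less order_less_le)
qed

lemma increasing: "x < y \<Longrightarrow> e * F x < e * F y"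
  using increasing_if_deriv_pos deriv_pos by blast

lemma inj: "inj F"
  by (rule injI) (metis increasing linorder_less_linear order_less_irrefl)

lemma period_int: "F (t + 2 * pi * of_int k) = F t + e * (2 * pi * of_int k)"
proof (induction k rule: int_induct[where k = 0])
  case (step1 k)
  then show ?case using period[of "t + 2 * pi * of_int k"] by (simp add: algebra_simps)
next
  case (step2 k)
  then show ?case using period[of "t + 2 * pi * of_int (k - 1)"] by (simp add: algebra_simps)
qed simp

lemma cis_cong: "cis s = cis t \<Longrightarrow> cis (F s) = cis (F t)"
proof -
  assume "cis s = cis t"
  then obtain k :: int where k: "s = t + 2 * pi * k" by (auto simp: cis_eq_cis_iff)
  have "F s = F t + 2 * pi * of_int (if e = 1 then k else - k)"
    using e unfolding k period_int by auto
  then show ?thesis unfolding cis_eq_cis_iff by blast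
qed

text \<open>The range is connected and, by periodicity, unbounded in both directions.\<close>

lemma surj: "surj F"
proof -
  have "\<exists>x. F x = y" for y
  proof -
  obtain k :: int where k: "\<bar>y - F 0\<bar> < of_int k" using ex_less_of_int by blast
  have "1 * of_int k \<le> 2 * pi * of_int k" using k pi_gt3 by (intro mult_right_mono) auto
  then have "\<bar>y - F 0\<bar> < 2 * pi * of_int k" using k by simp
  then have "F 0 - 2 * pi * of_int k \<le> y" "y \<le> F 0 + 2 * pi * of_int k" by linarith+
  moreover have "F 0 - 2 * pi * of_int k \<in> range F" "F 0 + 2 * pi * of_int k \<in> range F"
    using period_int[of 0 k] period_int[of 0 "- k"] e by (auto intro: range_eqI[OF HOL.sym])
  ultimately have "\<exists>a b. F a \<le> y \<and> y \<le> F b" by (metis rangeE)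
  then obtain a b where "F a \<le> y" "y \<le> F b" by blast
  moreover have "connected (range F)" by (intro connected_continuous_image cont) simp
  ultimately have "y \<in> range F" by (meson connectedD_interval rangeI)
  then show ?thesis by auto
  qed
  then show ?thesis unfolding surj_def by metis
qed

abbreviation Finv :: "real \<Rightarrow> real" where "Finv \<equiv> inv_into UNIV F"

lemma F_Finv: "F (Finv y) = y" and Finv_F: "Finv (F x) = x"
  using surj inj by (simp_all add: surj_f_inv_f)

lemma inv_deriv: "(Finv has_real_derivative inverse (F' (Finv y))) (at y)"
proof -
  have "(Finv has_real_derivative inverse (F' (Finv y))) (at (F (Finv y)))"
    unfolding has_field_derivative_def
    by (rule has_derivative_inverse_strong[OF open_UNIV UNIV_I cont Finv_F
          has_real_deriv[unfolded has_field_derivative_def]])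
      (use nz in \<open>simp add: fun_eq_iff\<close>)
  then show ?thesis by (simp add: F_Finv)
qed

text \<open>The inverse lift has the same degree because \<open>e * e = 1\<close>. This makes the
  notion of the same diagram symmetric.\<close>

lemma circle_lift_inv: "circle_lift Finv e"
proof
  show "e \<in> {1, - 1}" by (rule e)
  have D: "(Finv has_vector_derivative inverse (F' (Finv y))) (at y)" for y
    using inv_deriv by (simp add: has_real_derivative_iff_has_vector_derivative)
  have "continuous_on UNIV Finv"
    using inv_deriv DERIV_isCont continuous_at_imp_continuous_on by blast
  then have "continuous_on UNIV (F' \<circ> Finv)"
    by (rule continuous_on_compose[OF _ cont'])
  then have "continuous_on UNIV (\<lambda>y. inverse (F' (Finv y)))"
    using nz by (intro continuous_on_inverse) (auto simp: o_def)
  then show "Finv C1_differentiable_on UNIV"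
    unfolding C1_differentiable_on_def by (intro exI conjI) (use D in auto)
  show "vector_derivative Finv (at t) \<noteq> 0" for t
    using nz vector_derivative_at[OF D] by simp
  show "Finv (t + 2 * pi) = Finv t + e * (2 * pi)" for t
  proof -
    have "F (Finv t + e * (2 * pi)) = t + 2 * pi"
      using period_int[of "Finv t" 1] period_int[of "Finv t" "- 1"] e by (auto simp: F_Finv)
    then show ?thesis by (metis Finv_F)
  qed
qed

text \<open>The lift in coordinates centred at \<open>a\<close> and \<open>F a\<close>: turning by
  \<open>t\<close> at a point corresponds to turning by \<open>shift a t\<close> at its
  image.\<close>

definition shift :: "real \<Rightarrow> real \<Rightarrow> real" where "shift a t = F (a + t) - F a"

lemma shift_sgn: "t \<noteq> 0 \<Longrightarrow> sgn (shift a t) = e * sgn t"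
  using increasing[of a "a + t"] increasing[of "a + t" a] e
  by (cases "t > 0") (auto simp: shift_def)

lemma shift_tendsto: "(shift a \<longlongrightarrow> 0) (at 0 within A)"
proof -
  have "continuous_on UNIV (shift a)"
    unfolding shift_def by (intro continuous_intros continuous_on_compose2[OF cont]) auto
  then have "(shift a \<longlongrightarrow> shift a 0) (at 0 within A)"
    by (meson UNIV_I continuous_on_def tendsto_within_subset subset_UNIV)
  then show ?thesis by (simp add: shift_def)
qed

lemma shift_at: "filterlim (shift a) (at 0) (at 0)"
proof -
  have "shift a t \<noteq> 0" if "t \<noteq> 0" for t using shift_sgn[OF that, of a] that e by (auto simp: sgn_0_0)
  then have "\<forall>\<^sub>F t in at 0. shift a t \<noteq> 0" by (simp add: eventually_at_filter)
  then show ?thesis using shift_tendsto by (simp add: filterlim_at)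
qed

text \<open>Reversing the orientation exchanges the two sides of a point on its circle; for
  under-points this exchanges the one-sided limits of a coloring.\<close>

lemma shift_at_side:
  shows "e = 1 \<Longrightarrow> filterlim (shift a) (at_right 0) (at_right 0)"
    and "e = 1 \<Longrightarrow> filterlim (shift a) (at_left 0) (at_left 0)"
    and "e = - 1 \<Longrightarrow> filterlim (shift a) (at_left 0) (at_right 0)"
    and "e = - 1 \<Longrightarrow> filterlim (shift a) (at_right 0) (at_left 0)"
proof -
  have "sgn (shift a t) = e" if "t > 0" for t using shift_sgn[of t a] that by simp
  then have "e = 1 \<Longrightarrow> shift a t > 0" "e = - 1 \<Longrightarrow> shift a t < 0" if "t > 0" for t
    using that by (metis sgn_1_pos, metis sgn_1_neg)
  moreover have "sgn (shift a t) = - e" if "t < 0" for t using shift_sgn[of t a] that by simp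
  then have "e = 1 \<Longrightarrow> shift a t < 0" "e = - 1 \<Longrightarrow> shift a t > 0" if "t < 0" for t
    using that by (metis sgn_1_neg, metis sgn_1_pos minus_minus)
  ultimately show
      "e = 1 \<Longrightarrow> filterlim (shift a) (at_right 0) (at_right 0)"
      "e = 1 \<Longrightarrow> filterlim (shift a) (at_left 0) (at_left 0)"
      "e = - 1 \<Longrightarrow> filterlim (shift a) (at_left 0) (at_right 0)"
      "e = - 1 \<Longrightarrow> filterlim (shift a) (at_right 0) (at_left 0)"
    using shift_tendsto
    by (auto simp: filterlim_at eventually_at_filter intro!: always_eventually) (metis less_irrefl)+
qed

end

section \<open>Transporting points and colorings along a reparametrization\<close>

fun flip :: "real \<Rightarrow> side \<Rightarrow> side" where
  "flip e s = (if e = 1 then s else (case s of Left_Side \<Rightarrow> Right_Side | Right_Side \<Rightarrow> Left_Side))"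

text \<open>\<open>Arg\<close> picks one angle of the point; by \<open>cis_cong\<close> any other
  angle gives the same image.\<close>

definition transport :: "(nat \<Rightarrow> nat) \<Rightarrow> (nat \<Rightarrow> real \<Rightarrow> real) \<Rightarrow> point \<Rightarrow> point" where
  "transport \<sigma> f p = (\<sigma> (fst p), cis (f (fst p) (Arg (snd p))))"

lemma reparametrizesD:
  assumes "reparametrizes D D' \<sigma> \<epsilon> f"
  shows "bij_betw \<sigma> {..<ncomp D} {..<ncomp D'}"
    and "i < ncomp D \<Longrightarrow> circle_lift (f i) (\<epsilon> i)"
    and "i < ncomp D \<Longrightarrow> curve D' (\<sigma> i, cis (f i t)) = curve D (i, cis t)"
    and "i < ncomp D \<Longrightarrow> (\<sigma> i, cis (f i t)) \<in> under_points D' \<longleftrightarrow> (i, cis t) \<in> under_points D"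
    and "i < ncomp D \<Longrightarrow> \<sigma> i < ncomp D'"
proof -
  show bij: "bij_betw \<sigma> {..<ncomp D} {..<ncomp D'}"
    using assms by (simp add: reparametrizes_def)
  assume "i < ncomp D"
  then show "circle_lift (f i) (\<epsilon> i)"
    "curve D' (\<sigma> i, cis (f i t)) = curve D (i, cis t)"
    "(\<sigma> i, cis (f i t)) \<in> under_points D' \<longleftrightarrow> (i, cis t) \<in> under_points D" "\<sigma> i < ncomp D'"
    using assms bij_betw_apply[OF bij, of i] by (simp_all add: reparametrizes_def circle_lift_def)
qed

lemma transport_cis:
  assumes "reparametrizes D D' \<sigma> \<epsilon> f" "i < ncomp D"
  shows "transport \<sigma> f (i, cis t) = (\<sigma> i, cis (f i t))"
proof -
  interpret circle_lift "f i" "\<epsilon> i" using reparametrizesD(2)[OF assms] .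
  have "cis (Arg (cis t)) = cis t"
    using rcis_cmod_Arg[of "cis t"] by (simp add: rcis_def)
  then show ?thesis by (simp add: transport_def cis_cong[OF \<open>cis (Arg (cis t)) = cis t\<close>])
qed

lemma transport_rot:
  assumes "reparametrizes D D' \<sigma> \<epsilon> f" "i < ncomp D"
  shows "transport \<sigma> f (rot (i, cis a) t) =
    rot (transport \<sigma> f (i, cis a)) (circle_lift.shift (f i) a t)"
proof -
  interpret circle_lift "f i" "\<epsilon> i" using reparametrizesD(2)[OF assms] .
  show ?thesis using transport_cis[OF assms] by (simp add: shift_def)
qed

lemma transport_points:
  assumes "reparametrizes D D' \<sigma> \<epsilon> f" "p \<in> points D"
  shows "transport \<sigma> f p \<in> points D'"
    and "curve D' (transport \<sigma> f p) = curve D p"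
    and "transport \<sigma> f p \<in> under_points D' \<longleftrightarrow> p \<in> under_points D"
proof -
  obtain i a where p: "p = (i, cis a)" "i < ncomp D" using points_cisE[OF assms(2)] .
  show "transport \<sigma> f p \<in> points D'" "curve D' (transport \<sigma> f p) = curve D p"
    "transport \<sigma> f p \<in> under_points D' \<longleftrightarrow> p \<in> under_points D"
    using transport_cis[OF assms(1) p(2)] reparametrizesD(3-)[OF assms(1) p(2)] p by simp_all
qed

lemma transport_surj:
  assumes "reparametrizes D D' \<sigma> \<epsilon> f" "q \<in> points D'"
  obtains p where "p \<in> points D" "transport \<sigma> f p = q"
proof -
  obtain j b where q: "q = (j, cis b)" "j < ncomp D'" using points_cisE[OF assms(2)] .
  then obtain i where i: "i < ncomp D" "\<sigma> i = j"
    using reparametrizesD(1)[OF assms(1)] unfolding bij_betw_def by (metis imageE lessThan_iff)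
  interpret circle_lift "f i" "\<epsilon> i" using reparametrizesD(2)[OF assms(1) i(1)] .
  show ?thesis
    using that[of "(i, cis (Finv b))"] transport_cis[OF assms(1) i(1)] q i by (simp add: F_Finv)
qed

text \<open>By the chain rule the velocities differ by the derivative of the lift, whose sign is
  \<open>\<epsilon> (fst p)\<close>; the factor \<open>r\<close> is its absolute value.\<close>

lemma velocity_transport:
  assumes "reparametrizes D D' \<sigma> \<epsilon> f" "link_diagram D" "link_diagram D'" "p \<in> points D"
  obtains r where "r > 0" "velocity D p = (\<epsilon> (fst p) * r) *\<^sub>R velocity D' (transport \<sigma> f p)"
proof -
  obtain i a where p: "p = (i, cis a)" "i < ncomp D" using points_cisE[OF assms(4)] .
  interpret circle_lift "f i" "\<epsilon> i" using reparametrizesD(2)[OF assms(1) p(2)] .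
  have "((\<lambda>t. curve D' (\<sigma> i, cis t)) \<circ> f i has_vector_derivative
      F' a *\<^sub>R velocity D' (\<sigma> i, cis (f i a))) (at a)"
    by (rule vector_diff_chain_at[OF has_deriv
          has_velocity[OF assms(3) reparametrizesD(5)[OF assms(1) p(2)]]])
  then have "((\<lambda>t. curve D (i, cis t)) has_vector_derivative
      F' a *\<^sub>R velocity D' (\<sigma> i, cis (f i a))) (at a)"
    using reparametrizesD(3)[OF assms(1) p(2)] by (simp add: o_def)
  then have "velocity D p = F' a *\<^sub>R velocity D' (transport \<sigma> f p)"
    using velocity_eqI[OF assms(2) p(2)] transport_cis[OF assms(1) p(2)] p by simp
  moreover have "F' a = \<epsilon> i * (\<epsilon> i * F' a)" using e by auto
  ultimately show ?thesis using that[of "\<epsilon> i * F' a"] deriv_pos[of a] p by simp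
qed

lemma transport_crossing:
  assumes "reparametrizes D D' \<sigma> \<epsilon> f" "link_diagram D" "link_diagram D'" "(p, q) \<in> crossings D"
  shows "(transport \<sigma> f p, transport \<sigma> f q) \<in> crossings D'"
    and "sgn (det2 (velocity D p) (velocity D q)) = \<epsilon> (fst p) * \<epsilon> (fst q) *
      sgn (det2 (velocity D' (transport \<sigma> f p)) (velocity D' (transport \<sigma> f q)))"
proof -
  note facts = crossing_facts[OF assms(2,4)]
  note tp = transport_points[OF assms(1) facts(1)] and tq = transport_points[OF assms(1) facts(2)]
  have "curve D p = curve D q" using assms(4) by (simp add: crossings_def)
  then show "(transport \<sigma> f p, transport \<sigma> f q) \<in> crossings D'"
    using facts tp tq by (auto simp: crossings_def)
  obtain r where r: "r > 0" "velocity D p = (\<epsilon> (fst p) * r) *\<^sub>R velocity D' (transport \<sigma> f p)"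
    by (rule velocity_transport[OF assms(1-3) facts(1)])
  obtain r' where r': "r' > 0" "velocity D q = (\<epsilon> (fst q) * r') *\<^sub>R velocity D' (transport \<sigma> f q)"
    by (rule velocity_transport[OF assms(1-3) facts(2)])
  have e: "\<epsilon> (fst p) \<in> {1, - 1}" "\<epsilon> (fst q) \<in> {1, - 1}"
    using facts(1,2) circle_lift.e[OF reparametrizesD(2)[OF assms(1)]]
    by (simp_all add: points_def mem_Times_iff)
  have "det2 (velocity D p) (velocity D q) = (\<epsilon> (fst p) * \<epsilon> (fst q)) * (r * r') *
      det2 (velocity D' (transport \<sigma> f p)) (velocity D' (transport \<sigma> f q))"
    unfolding r(2) r'(2) by (simp add: det2_def algebra_simps)
  then show "sgn (det2 (velocity D p) (velocity D q)) = \<epsilon> (fst p) * \<epsilon> (fst q) *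
      sgn (det2 (velocity D' (transport \<sigma> f p)) (velocity D' (transport \<sigma> f q)))"
    using r(1) r'(1) e by (auto simp: sgn_mult)
qed

lemma flip_flip [simp]: "flip e (flip e s) = s"
  by (cases s) auto

lemma sgn_eq_signs:
  assumes "sgn d = e * e' * sgn d'" "d' \<noteq> 0" "e \<in> {1, - 1}" "e' \<in> {1, - 1}"
  shows "(d :: real) > 0 \<longleftrightarrow> (d' > 0 \<longleftrightarrow> e = e')"
proof -
  have "d > 0 \<longleftrightarrow> sgn d > 0" by simp
  also have "\<dots> \<longleftrightarrow> (d' > 0 \<longleftrightarrow> e = e')"
    unfolding assms(1) using assms(2-4) by (cases d' "0 :: real" rule: linorder_cases) auto
  finally show ?thesis .
qed

text \<open>Reversing the over-strand changes the sign of the determinant and also exchanges the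
  names of its two strings, so the jump stays the same. Reversing the under-strand exchanges the two
  limits and inverts the jump, which is again the same condition.\<close>

lemma coloring_pullback:
  assumes "reparametrizes D D' \<sigma> \<epsilon> f" "link_diagram D" "link_diagram D'"
    and "group G" "coloring G D' \<phi>"
  shows "coloring G D (\<lambda>p s. \<phi> (transport \<sigma> f p) (flip (\<epsilon> (fst p)) s))"
    (is "coloring G D ?\<psi>")
  unfolding coloring_def
proof (intro conjI ballI)
  fix p assume p: "p \<in> arc_points D"
  then have p': "transport \<sigma> f p \<in> points D'" "transport \<sigma> f p \<notin> under_points D'"
    using transport_points[OF assms(1)] by auto
  then show "?\<psi> p \<in> UNIV \<rightarrow> carrier G" using coloring_closed[OF assms(5)] by auto
  obtain i a where i: "p = (i, cis a)" "i < ncomp D" using p points_cisE by blast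
  interpret circle_lift "f i" "\<epsilon> i" using reparametrizesD(2)[OF assms(1) i(2)] .
  have "\<forall>\<^sub>F t in at 0. \<phi> (rot (transport \<sigma> f p) t) = \<phi> (transport \<sigma> f p)"
    using assms(5) p' by (simp add: coloring_def)
  then have "\<forall>\<^sub>F t in at 0. \<phi> (rot (transport \<sigma> f p) (shift a t)) = \<phi> (transport \<sigma> f p)"
    using shift_at by (rule eventually_compose_filterlim)
  then show "\<forall>\<^sub>F t in at 0. ?\<psi> (rot p t) = ?\<psi> p"
    unfolding i(1) transport_rot[OF assms(1) i(2)] by eventually_elim (simp add: rot_def)
next
  fix c assume c: "c \<in> crossings D"
  obtain p q where pq: "c = (p, q)" by (cases c)
  note facts = crossing_facts[OF assms(2) c[unfolded pq]]
  note tc = transport_crossing[OF assms(1-3) c[unfolded pq]]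
  interpret group G by fact
  let ?p = "transport \<sigma> f p" and ?q = "transport \<sigma> f q"
  obtain i a where i: "p = (i, cis a)" "i < ncomp D" using facts(1) points_cisE by blast
  obtain j b where j: "q = (j, cis b)" "j < ncomp D" using facts(2) points_cisE by blast
  interpret circle_lift "f i" "\<epsilon> i" using reparametrizesD(2)[OF assms(1) i(2)] .
  have ej: "\<epsilon> j \<in> {1, - 1}" using circle_lift.e[OF reparametrizesD(2)[OF assms(1) j(2)]] .
  obtain x z where xz: "\<forall>\<^sub>F t in at_left 0. \<phi> (rot ?p t) = x"
      "\<forall>\<^sub>F t in at_right 0. \<phi> (rot ?p t) = z" "\<And>s. x s \<in> carrier G" "\<And>s. z s \<in> carrier G"
      "\<And>s. z s = x s \<otimes>\<^bsub>G\<^esub> jump G D' \<phi> (?p, ?q)"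
    by (rule coloring_crossing[OF assms(4,3,5) tc(1), unfolded fst_conv]) blast
  have \<phi>q: "\<phi> ?q s \<in> carrier G" for s
    using coloring_closed[OF assms(5)] crossing_facts[OF assms(3) tc(1)] by blast
  have det: "det2 (velocity D' ?p) (velocity D' ?q) \<noteq> 0"
    using crossing_facts(5)[OF assms(3) tc(1)] .
  have pos: "det2 (velocity D p) (velocity D q) > 0 \<longleftrightarrow>
      (det2 (velocity D' ?p) (velocity D' ?q) > 0 \<longleftrightarrow> \<epsilon> i = \<epsilon> j)"
    using sgn_eq_signs[OF tc(2) det] e ej i j by simp
  \<comment> \<open>The factor \<open>flip (\<epsilon> j)\<close> accounts for the over-strand; the
    case distinction on \<open>\<epsilon> i\<close> is the change from first to second over-string
    caused by reversing the under-strand.\<close>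
  have sides: "first_over_side D Forward (p, q) = flip (\<epsilon> j)
        (if \<epsilon> i = 1 then first_over_side D' Forward (?p, ?q) else second_over_side D' Forward (?p, ?q))"
      "second_over_side D Forward (p, q) = flip (\<epsilon> j)
        (if \<epsilon> i = 1 then second_over_side D' Forward (?p, ?q) else first_over_side D' Forward (?p, ?q))"
    using e ej by (auto simp: first_over_side_def second_over_side_def pos)
  have jump: "jump G D ?\<psi> c = (if \<epsilon> i = 1 then jump G D' \<phi> (?p, ?q) else inv\<^bsub>G\<^esub> jump G D' \<phi> (?p, ?q))"
  proof -
    have "fst q = j" by (simp add: j(1))
    then show ?thesis
      using \<phi>q by (simp add: jump_def pq sides inv_mult_group del: flip.simps)
  qed
  have \<psi>_rot: "?\<psi> (rot p t) = (\<lambda>s. \<phi> (rot ?p (shift a t)) (flip (\<epsilon> i) s))" for t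
    unfolding i(1) transport_rot[OF assms(1) i(2)] by (simp add: rot_def)
  show "jumps_by G ?\<psi> (fst c) (jump G D ?\<psi> c)"
  proof (cases "\<epsilon> i = 1")
    case True
    have "\<forall>\<^sub>F t in at_left 0. \<phi> (rot ?p (shift a t)) = x"
        "\<forall>\<^sub>F t in at_right 0. \<phi> (rot ?p (shift a t)) = z"
      using eventually_compose_filterlim[OF xz(1) shift_at_side(2)[OF True]]
        eventually_compose_filterlim[OF xz(2) shift_at_side(1)[OF True]] by auto
    then have "(\<forall>\<^sub>F t in at_left 0. ?\<psi> (rot p t) = x) \<and> (\<forall>\<^sub>F t in at_right 0. ?\<psi> (rot p t) = z)"
      unfolding \<psi>_rot True by (simp add: True)
    moreover have "\<forall>s. z s = x s \<otimes>\<^bsub>G\<^esub> jump G D ?\<psi> c" using xz(5) True unfolding jump by simp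
    ultimately show ?thesis unfolding pq fst_conv by blast
  next
    case False
    then have e': "\<epsilon> i = - 1" using e by auto
    \<comment> \<open>On a reversed under-strand the limits \<open>x\<close> and \<open>z\<close>
      trade places, and \<open>z = x k\<close> is used in the form
      \<open>x = z k\<inverse>\<close>.\<close>
    have "\<forall>\<^sub>F t in at_left 0. \<phi> (rot ?p (shift a t)) = z"
        "\<forall>\<^sub>F t in at_right 0. \<phi> (rot ?p (shift a t)) = x"
      using eventually_compose_filterlim[OF xz(1) shift_at_side(3)[OF e']]
        eventually_compose_filterlim[OF xz(2) shift_at_side(4)[OF e']] by auto
    then have "(\<forall>\<^sub>F t in at_left 0. ?\<psi> (rot p t) = (\<lambda>s. z (flip (- 1) s))) \<and>
        (\<forall>\<^sub>F t in at_right 0. ?\<psi> (rot p t) = (\<lambda>s. x (flip (- 1) s)))"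
      unfolding \<psi>_rot e' by (auto elim: eventually_mono)
    moreover have "\<forall>s. x (flip (- 1) s) = z (flip (- 1) s) \<otimes>\<^bsub>G\<^esub> jump G D ?\<psi> c"
      using xz(3,5) jump_closed[OF assms(4,3,5) tc(1)] False unfolding jump
      by (simp add: m_assoc del: flip.simps)
    ultimately show ?thesis unfolding pq fst_conv by blast
  qed
qed

lemma reparametrizes_inverse:
  assumes "reparametrizes D D' \<sigma> \<epsilon> f"
  defines "\<tau> \<equiv> inv_into {..<ncomp D} \<sigma>"
  shows "reparametrizes D' D \<tau> (\<lambda>j. \<epsilon> (\<tau> j)) (\<lambda>j. inv_into UNIV (f (\<tau> j)))"
  unfolding reparametrizes_def
proof (intro conjI allI impI)
  have bij: "bij_betw \<sigma> {..<ncomp D} {..<ncomp D'}" using reparametrizesD(1)[OF assms(1)] .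
  show "bij_betw \<tau> {..<ncomp D'} {..<ncomp D}"
    unfolding \<tau>_def using bij by (rule bij_betw_inv_into)
  fix j assume "j < ncomp D'"
  then have i: "\<tau> j < ncomp D" "\<sigma> (\<tau> j) = j"
    using \<open>bij_betw \<tau> _ _\<close> bij_betw_inv_into_right[OF bij] by (auto simp: \<tau>_def dest: bij_betw_apply)
  interpret circle_lift "f (\<tau> j)" "\<epsilon> (\<tau> j)" using reparametrizesD(2)[OF assms(1) i(1)] .
  interpret inverse: circle_lift Finv "\<epsilon> (\<tau> j)" by (rule circle_lift_inv)
  show "\<epsilon> (\<tau> j) \<in> {1, - 1}" by (rule e)
  show "Finv C1_differentiable_on UNIV" by (rule inverse.C1)
  fix t
  show "vector_derivative Finv (at t) \<noteq> 0" by (rule inverse.nz)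
  show "Finv (t + 2 * pi) = Finv t + \<epsilon> (\<tau> j) * (2 * pi)" by (rule inverse.period)
  show "curve D (\<tau> j, cis (Finv t)) = curve D' (j, cis t)"
    using reparametrizesD(3)[OF assms(1) i(1), of "Finv t"] i by (simp add: F_Finv)
  show "(\<tau> j, cis (Finv t)) \<in> under_points D \<longleftrightarrow> (j, cis t) \<in> under_points D'"
    using reparametrizesD(4)[OF assms(1) i(1), of "Finv t"] i by (simp add: F_Finv)
qed

lemma same_diagram_heap_group:
  assumes "link_diagram D" "link_diagram D'" "same_diagram D D'"
  shows "heap_group D \<cong> heap_group D'"
proof -
  obtain \<sigma> \<epsilon> f where r: "reparametrizes D D' \<sigma> \<epsilon> f"
    using assms(3) unfolding same_diagram_iff by blast
  define \<tau> where "\<tau> = inv_into {..<ncomp D} \<sigma>"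
  define g where "g j = inv_into UNIV (f (\<tau> j))" for j
  have r': "reparametrizes D' D \<tau> (\<lambda>j. \<epsilon> (\<tau> j)) g"
    using reparametrizes_inverse[OF r] unfolding \<tau>_def g_def .
  have inverse: "transport \<tau> g (transport \<sigma> f p) = p" "\<tau> (fst (transport \<sigma> f p)) = fst p"
    if p: "p \<in> points D" for p
  proof -
    obtain i a where i: "p = (i, cis a)" "i < ncomp D" using points_cisE[OF p] .
    interpret circle_lift "f i" "\<epsilon> i" using reparametrizesD(2)[OF r i(2)] .
    have \<tau>: "\<tau> (\<sigma> i) = i"
      using bij_betw_inv_into_left[OF reparametrizesD(1)[OF r]] i by (simp add: \<tau>_def)
    show "transport \<tau> g (transport \<sigma> f p) = p" "\<tau> (fst (transport \<sigma> f p)) = fst p"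
      using transport_cis[OF r i(2)] transport_cis[OF r' reparametrizesD(5)[OF r i(2)]] i
      by (simp_all add: \<tau> g_def Finv_F)
  qed
  \<comment> \<open>The graph of the transport with its change of sides. It meets every position off
    the under-points in both diagrams, so that determination of colorings is immediate.\<close>
  let ?W = "{((p, s), (transport \<sigma> f p, flip (\<epsilon> (fst p)) s)) |p s. p \<in> arc_points D}"
  show ?thesis
  proof (rule heap_group_iso[OF assms(1,2), of ?W])
    show "colorings_extend D' D (?W\<inverse>)"
      unfolding colorings_extend_def
    proof (intro allI impI)
      fix G :: "heap_monoid" and \<phi>
      assume "group G \<and> coloring G D' \<phi>"
      then have "coloring G D (\<lambda>p s. \<phi> (transport \<sigma> f p) (flip (\<epsilon> (fst p)) s))"
        using coloring_pullback[OF r assms(1,2)] by blast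
      then show "\<exists>\<phi>'. coloring G D \<phi>' \<and> (\<forall>((p, s), (p', s'))\<in>?W\<inverse>. \<phi>' p' s' = \<phi> p s)"
        by (intro exI[of _ "\<lambda>p s. \<phi> (transport \<sigma> f p) (flip (\<epsilon> (fst p)) s)"] conjI) auto
    qed
    show "colorings_extend D D' ?W"
      unfolding colorings_extend_def
    proof (intro allI impI)
      fix G :: "heap_monoid" and \<phi>
      assume "group G \<and> coloring G D \<phi>"
      then have "coloring G D' (\<lambda>p s. \<phi> (transport \<tau> g p) (flip (\<epsilon> (\<tau> (fst p))) s))"
        using coloring_pullback[OF r' assms(2,1)] by blast
      moreover have "(\<lambda>((p, s), (p', s')).
          \<phi> (transport \<tau> g p') (flip (\<epsilon> (\<tau> (fst p'))) s') = \<phi> p s) w" if "w \<in> ?W" for w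
      proof -
        obtain p s where "w = ((p, s), (transport \<sigma> f p, flip (\<epsilon> (fst p)) s))" "p \<in> points D"
          using \<open>w \<in> ?W\<close> by blast
        then show ?thesis using inverse[of p] by (simp del: flip.simps)
      qed
      ultimately show "\<exists>\<phi>'. coloring G D' \<phi>' \<and> (\<forall>((p, s), (p', s'))\<in>?W. \<phi>' p' s' = \<phi> p s)"
        by (intro exI[of _ "\<lambda>p s. \<phi> (transport \<tau> g p) (flip (\<epsilon> (\<tau> (fst p))) s)"] conjI ballI)
    qed
    have "fst ` ?W = (arc_points D) \<times> UNIV"
      by (force simp: image_iff simp del: flip.simps)
    then show "colorings_determined D (fst ` ?W)" "fst ` fst ` ?W \<subseteq> arc_points D"
      by (auto simp: colorings_determined_def fun_eq_iff)
    have "snd ` ?W = (arc_points D') \<times> UNIV"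
    proof (intro equalityI subsetI)
      fix y assume "y \<in> snd ` ?W"
      then show "y \<in> (arc_points D') \<times> UNIV"
        using transport_points[OF r] by auto
    next
      fix y assume y: "y \<in> (arc_points D') \<times> (UNIV :: side set)"
      then obtain q s where q: "y = (q, s)" "q \<in> points D'" "q \<notin> under_points D'" by blast
      obtain p where p: "p \<in> points D" "transport \<sigma> f p = q"
        by (rule transport_surj[OF r q(2)])
      then have "p \<in> arc_points D" using transport_points(3)[OF r p(1)] q by auto
      then have "((p, flip (\<epsilon> (fst p)) s),
          (transport \<sigma> f p, flip (\<epsilon> (fst p)) (flip (\<epsilon> (fst p)) s))) \<in> ?W"
        by blast
      then have "((p, flip (\<epsilon> (fst p)) s), y) \<in> ?W"
        using p q by (simp only: flip_flip)
      then show "y \<in> snd ` ?W" by force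
    qed
    then show "colorings_determined D' (snd ` ?W)" "fst ` snd ` ?W \<subseteq> arc_points D'"
      by (auto simp: colorings_determined_def fun_eq_iff)
  qed
qed

section \<open>Colorings under local changes\<close>

text \<open>The jump as a function of the values on the over-strand and one bit, telling whether the
  left string is met first. By \<open>jump_eq_side_jump\<close> this bit says that the crossing is
  negative, so the moves in a disc only need the signs of crossings.\<close>

definition side_jump :: "('g, 'm) monoid_scheme \<Rightarrow> bool \<Rightarrow> (side \<Rightarrow> 'g) \<Rightarrow> 'g" where
  "side_jump G b v =
    (if b then inv\<^bsub>G\<^esub> v Left_Side \<otimes>\<^bsub>G\<^esub> v Right_Side
     else inv\<^bsub>G\<^esub> v Right_Side \<otimes>\<^bsub>G\<^esub> v Left_Side)"

lemma jump_eq_side_jump: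
  "jump G D \<phi> c = side_jump G (crossing_sign D c < 0) (\<phi> (snd c))"
proof -
  have "crossing_sign D c < 0 \<longleftrightarrow> det2 (velocity D (fst c)) (velocity D (snd c)) > 0"
    by (cases c) (auto simp: crossing_sign_def det2_def sgn_if algebra_simps)
  then show ?thesis
    by (cases c) (simp add: jump_def side_jump_def first_over_side_def second_over_side_def)
qed

lemma crossing_sign_cases:
  assumes "link_diagram D" "c \<in> crossings D"
  shows "crossing_sign D c = 1 \<or> crossing_sign D c = - 1"
proof -
  obtain p q where c: "c = (p, q)" by (cases c)
  have "det2 (velocity D q) (velocity D p) = - det2 (velocity D p) (velocity D q)"
    by (simp add: det2_def)
  then show ?thesis
    using crossing_facts(5)[OF assms(1) assms(2)[unfolded c]] by (auto simp: c crossing_sign_def sgn_if)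
qed

lemma connected_circle_interval: "connected ((\<lambda>t. (i :: nat, cis t)) ` {x..y})"
  by (intro connected_continuous_image continuous_intros) auto

lemma coloring_constant:
  assumes "coloring G D \<phi>" "i < ncomp D" "x \<le> t" "t \<le> y" "x \<le> u" "u \<le> y"
    "\<And>t. x \<le> t \<Longrightarrow> t \<le> y \<Longrightarrow> (i, cis t) \<notin> under_points D"
  shows "\<phi> (i, cis t) = \<phi> (i, cis u)"
  by (rule coloring_connected[OF assms(1) connected_circle_interval[of i x y]])
    (use assms(2-) in auto)

text \<open>Passes from one-sided limits to points at a finite distance: on either side of
  \<open>\<tau>\<close> the interval is free of under-points, so the coloring equals its limit
  there.\<close>

lemma coloring_jump:
  assumes "group G" "link_diagram D" "coloring G D \<phi>" "((i, cis \<tau>), q) \<in> crossings D" "i < ncomp D"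
    "x < \<tau>" "\<tau> < y" "\<And>t. x \<le> t \<Longrightarrow> t \<le> y \<Longrightarrow> t \<noteq> \<tau> \<Longrightarrow> (i, cis t) \<notin> under_points D"
  shows "\<phi> (i, cis y) s = \<phi> (i, cis x) s \<otimes>\<^bsub>G\<^esub> jump G D \<phi> ((i, cis \<tau>), q)"
proof -
  obtain u v where uv: "\<forall>\<^sub>F t in at_left 0. \<phi> (rot (i, cis \<tau>) t) = u"
      "\<forall>\<^sub>F t in at_right 0. \<phi> (rot (i, cis \<tau>) t) = v"
      "\<And>s. v s = u s \<otimes>\<^bsub>G\<^esub> jump G D \<phi> ((i, cis \<tau>), q)"
    by (rule coloring_crossing[OF assms(1-4), unfolded fst_conv]) blast
  have "\<forall>\<^sub>F t in at_left 0. t \<in> {x - \<tau><..<0}" using assms(6) by (intro eventually_at_left_real) simp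
  with uv(1) have "\<forall>\<^sub>F t in at_left (0::real). \<phi> (i, cis x) = u"
  proof eventually_elim
    case (elim t)
    have "\<phi> (i, cis x) = \<phi> (i, cis (\<tau> + t))"
      by (rule coloring_constant[OF assms(3,5), of x _ "\<tau> + t"]) (use elim assms(6-8) in auto)
    with elim show ?case by simp
  qed
  then have x: "\<phi> (i, cis x) = u" using eventually_happens'[of "at_left (0::real)"] by auto
  have "\<forall>\<^sub>F t in at_right 0. t \<in> {0<..<y - \<tau>}" using assms(7) by (intro eventually_at_right_real) simp
  with uv(2) have "\<forall>\<^sub>F t in at_right (0::real). \<phi> (i, cis y) = v"
  proof eventually_elim
    case (elim t)
    have "\<phi> (i, cis y) = \<phi> (i, cis (\<tau> + t))"
      by (rule coloring_constant[OF assms(3,5), of "\<tau> + t" _ y]) (use elim assms(6-8) in auto)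
    with elim show ?case by simp
  qed
  then have "\<phi> (i, cis y) = v" using eventually_happens'[of "at_right (0::real)"] by auto
  with x uv(3) show ?thesis by simp
qed

section \<open>Strands and diagrams that differ in a disc\<close>

lemma cis_inj_on_strand:
  assumes "cis s = cis t" "a \<le> s" "s \<le> b" "a \<le> t" "t \<le> b" "b < a + 2 * pi"
  shows "s = t"
proof -
  obtain k :: int where k: "s = t + 2 * pi * k" using assms(1) by (auto simp: cis_eq_cis_iff)
  have "(2 * pi) * real_of_int k < (2 * pi) * 1" using k assms by linarith
  then have "real_of_int k < 1" by (rule mult_left_less_imp_less) simp
  have "(2 * pi) * (- 1) < (2 * pi) * real_of_int k" using k assms by linarith
  then have "- 1 < real_of_int k" by (rule mult_left_less_imp_less) simp
  with \<open>real_of_int k < 1\<close> show ?thesis using k by simp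
qed

lemma compact_strand_points: "compact (strand_points S)"
proof -
  obtain i a b where "S = (i, a, b)" by (cases S)
  moreover have "compact ((\<lambda>t. (i :: nat, cis t)) ` {a..b})"
    by (intro compact_continuous_image continuous_intros) auto
  ultimately show ?thesis by (simp add: strand_points_def)
qed

lemma inner_subset_strand: "inner_strand_points S \<subseteq> strand_points S"
  by (cases S) (auto simp: inner_strand_points_def strand_points_def)

lemma local_change_sym: "local_change D D' \<S> \<Longrightarrow> local_change D' D \<S>"
  unfolding local_change_def by (auto simp: points_def insert_commute)

text \<open>The common part of the moves of types II and III and of the kinks. The assumption
  \<open>inner\<close>, which is read off from the explicit list of crossings of each move, keeps
  under-crossings away from the end points of the strands, where old and new values are
  glued.\<close>

locale local_move =
  fixes D D' :: diagram and \<S> :: "strand set"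
  assumes link: "link_diagram D" "link_diagram D'"
    and local_change: "local_change D D' \<S>"
    and finite_strands: "finite \<S>"
    and inner: "\<And>p q. (p, q) \<in> crossings_within D \<S> \<union> crossings_within D' \<S> \<Longrightarrow>
      p \<in> \<Union> (inner_strand_points ` \<S>) \<and> q \<in> \<Union> (inner_strand_points ` \<S>)"
begin

abbreviation Str :: "point set" where "Str \<equiv> \<Union> (strand_points ` \<S>)"
abbreviation Inn :: "point set" where "Inn \<equiv> \<Union> (inner_strand_points ` \<S>)"

lemma local_move_sym: "local_move D' D \<S>"
  using link local_change_sym[OF local_change] finite_strands inner
  by unfold_locales blast+

lemma ncomp_eq: "ncomp D' = ncomp D"
  using local_change by (simp add: local_change_def)

lemma points_eq: "points D' = points D"
  by (simp add: points_def ncomp_eq)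

lemma strandD:
  assumes "(i, a, b) \<in> \<S>"
  shows "i < ncomp D" "a < b" "b < a + 2 * pi"
  using local_change assms by (auto simp: local_change_def)

lemma strands_disjoint: "S \<in> \<S> \<Longrightarrow> T \<in> \<S> \<Longrightarrow> S \<noteq> T \<Longrightarrow> strand_points S \<inter> strand_points T = {}"
  using local_change by (auto simp: local_change_def pairwise_def disjnt_def)

lemma outside:
  assumes "p \<in> points D" "p \<notin> Str"
  shows "curve D' p = curve D p" "p \<in> under_points D' \<longleftrightarrow> p \<in> under_points D"
  using local_change assms unfolding local_change_def by blast+

lemma inner_subset: "Inn \<subseteq> Str"
  using inner_subset_strand by blast

lemma disc:
  obtains B where "\<And>p. p \<in> points D \<Longrightarrow> curve D p \<in> B \<longleftrightarrow> p \<in> Str"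
    "\<And>p. p \<in> points D \<Longrightarrow> curve D' p \<in> B \<longleftrightarrow> p \<in> Str"
proof -
  have "\<exists>B. B homeomorphic (cball 0 1 :: complex set) \<and>
        (\<forall>E\<in>{D, D'}. \<forall>p\<in>points E.
           (curve E p \<in> B \<longleftrightarrow> p \<in> Str) \<and> (curve E p \<in> interior B \<longleftrightarrow> p \<in> Inn))"
    using local_change by (simp only: local_change_def)
  then obtain B where B: "\<forall>E\<in>{D, D'}. \<forall>p\<in>points E.
      (curve E p \<in> B \<longleftrightarrow> p \<in> Str) \<and> (curve E p \<in> interior B \<longleftrightarrow> p \<in> Inn)"
    by (elim exE conjE)
  show ?thesis
  proof (rule that[of B])
    fix p assume "p \<in> points D"
    then show "curve D p \<in> B \<longleftrightarrow> p \<in> Str" "curve D' p \<in> B \<longleftrightarrow> p \<in> Str"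
      using B points_eq by simp_all
  qed
qed

text \<open>Both preimages have the same image in the plane, which lies in the disc or outside. This
  is how the disc excludes crossings between a strand of the family and the rest of the
  diagram.\<close>

lemma crossing_within_iff:
  assumes "(p, q) \<in> crossings D"
  shows "(p, q) \<in> crossings_within D \<S> \<longleftrightarrow> p \<in> Str" "(p, q) \<in> crossings_within D \<S> \<longleftrightarrow> q \<in> Str"
proof -
  obtain B where "\<And>p. p \<in> points D \<Longrightarrow> curve D p \<in> B \<longleftrightarrow> p \<in> Str"
    by (rule disc) blast
  moreover have "p \<in> points D" "q \<in> points D" "curve D p = curve D q"
    using assms by (auto simp: crossings_def)
  ultimately have "p \<in> Str \<longleftrightarrow> q \<in> Str" by metis
  then show "(p, q) \<in> crossings_within D \<S> \<longleftrightarrow> p \<in> Str" "(p, q) \<in> crossings_within D \<S> \<longleftrightarrow> q \<in> Str"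
    using assms by (auto simp: crossings_within_def)
qed

lemma under_within:
  assumes "p \<in> under_points D" "p \<in> Str"
  obtains q where "(p, q) \<in> crossings_within D \<S>"
  using under_in_crossing[OF link(1) assms(1)] crossing_within_iff assms(2) by metis

lemma under_inner: "p \<in> under_points D \<Longrightarrow> p \<in> Str \<Longrightarrow> p \<in> Inn"
  using under_within inner by (metis UnI1)

lemma closed_strands: "\<T> \<subseteq> \<S> \<Longrightarrow> closed (\<Union> (strand_points ` \<T>))"
  by (rule closed_Union)
    (auto intro: finite_subset[OF _ finite_strands] compact_imp_closed compact_strand_points)

lemma eventually_rot_not_in_strands:
  assumes "p \<notin> \<Union> (strand_points ` \<T>)" "\<T> \<subseteq> \<S>"
  shows "\<forall>\<^sub>F t in at 0. rot p t \<notin> \<Union> (strand_points ` \<T>)"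
proof -
  have "\<forall>\<^sub>F x in nhds p. x \<in> - \<Union> (strand_points ` \<T>)"
    using assms closed_strands[OF assms(2)] by (intro eventually_nhds_in_open open_Compl) auto
  with rot_tendsto show ?thesis
    using eventually_compose_filterlim by fastforce
qed

text \<open>The strands form a closed set, so both curves agree on a whole neighbourhood of a point
  off them.\<close>

lemma velocity_outside:
  assumes "p \<in> points D" "p \<notin> Str"
  shows "velocity D' p = velocity D p"
proof -
  obtain i a where p: "p = (i, cis a)" "i < ncomp D" using points_cisE[OF assms(1)] .
  have i': "i < ncomp D'" using p ncomp_eq by simp
  have "\<forall>\<^sub>F t in at 0. rot p t \<notin> Str"
    by (rule eventually_rot_not_in_strands[OF assms(2)]) simp
  then have "\<forall>\<^sub>F t in at 0. curve D (i, cis (a + t)) = curve D' (i, cis (a + t))"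
    by eventually_elim (use outside(1) p in auto)
  then have "\<forall>\<^sub>F t in at a. curve D (i, cis t) = curve D' (i, cis t)"
    by (simp add: at_to_0[of a] eventually_filtermap add.commute)
  then have "\<forall>\<^sub>F t in nhds a. curve D (i, cis t) = curve D' (i, cis t)"
    using outside(1)[OF assms] p by (auto simp: eventually_nhds_conv_at)
  then have "((\<lambda>t. curve D' (i, cis t)) has_vector_derivative velocity D p) (at a)"
    using has_velocity[OF link(1) p(2), of a] p(1)
      has_vector_derivative_cong_ev[where S = UNIV and f = "\<lambda>t. curve D (i, cis t)"
        and g = "\<lambda>t. curve D' (i, cis t)" and x = a] outside(1)[OF assms]
    by simp
  then show ?thesis using velocity_eqI[OF link(2) i'] p(1) by simp
qed

lemma crossing_outside:
  assumes "(p, q) \<in> crossings D'" "(p, q) \<notin> crossings_within D' \<S>"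
  shows "p \<in> points D - Str" "q \<in> points D - Str" "(p, q) \<in> crossings D"
    "crossing_sign D' (p, q) = crossing_sign D (p, q)"
proof -
  interpret sym: local_move D' D \<S> by (rule local_move_sym)
  show pq: "p \<in> points D - Str" "q \<in> points D - Str"
    using assms sym.crossing_within_iff[OF assms(1)] by (auto simp: crossings_def points_eq)
  then show "(p, q) \<in> crossings D"
    using assms(1) outside by (auto simp: crossings_def)
  show "crossing_sign D' (p, q) = crossing_sign D (p, q)"
    using velocity_outside pq by (simp add: crossing_sign_def)
qed

section \<open>Gluing values on the strands to a coloring outside\<close>

definition extension :: "(point \<Rightarrow> side \<Rightarrow> 'g) \<Rightarrow> (strand \<Rightarrow> real \<Rightarrow> side \<Rightarrow> 'g) \<Rightarrow> point \<Rightarrow> side \<Rightarrow> 'g" where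
  "extension \<phi> w p =
    (if p \<in> Inn then THE v. \<exists>i a b t. (i, a, b) \<in> \<S> \<and> a < t \<and> t < b \<and> p = (i, cis t) \<and> v = w (i, a, b) t
     else \<phi> p)"

lemma extension_outer: "p \<notin> Inn \<Longrightarrow> extension \<phi> w p = \<phi> p"
  by (simp add: extension_def)

lemma mem_strand: "a \<le> t \<Longrightarrow> t \<le> b \<Longrightarrow> (i, cis t) \<in> strand_points (i, a, b)"
  by (auto simp: strand_points_def)

lemma mem_Inn: "(i, a, b) \<in> \<S> \<Longrightarrow> a < t \<Longrightarrow> t < b \<Longrightarrow> (i, cis t) \<in> Inn"
  by (force simp: inner_strand_points_def)

lemma mem_Str: "(i, a, b) \<in> \<S> \<Longrightarrow> a \<le> t \<Longrightarrow> t \<le> b \<Longrightarrow> (i, cis t) \<in> Str"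
  by (force simp: strand_points_def)

lemma Inn_cases:
  assumes "p \<in> Inn"
  obtains i a b t where "(i, a, b) \<in> \<S>" "a < t" "t < b" "p = (i, cis t)"
  using assms by (force simp: inner_strand_points_def)

lemma strand_unique:
  assumes "(i, a, b) \<in> \<S>" "a \<le> t" "t \<le> b" "(i', a', b') \<in> \<S>" "a' \<le> t'" "t' \<le> b'"
    "(i, cis t) = (i', cis t')"
  shows "(i, a, b) = (i', a', b')" "t = t'"
proof -
  have "(i, cis t) \<in> strand_points (i, a, b)" using assms(2,3) by (rule mem_strand)
  moreover have "(i, cis t) \<in> strand_points (i', a', b')"
    unfolding assms(7) using assms(5,6) by (rule mem_strand)
  ultimately have "(i, cis t) \<in> strand_points (i, a, b) \<inter> strand_points (i', a', b')" ..
  then show *: "(i, a, b) = (i', a', b')"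
    using strands_disjoint[OF assms(1,4)] by auto
  then show "t = t'"
    using cis_inj_on_strand[of t t' a b] assms strandD(3)[OF assms(1)] by auto
qed

text \<open>The description by \<open>THE\<close> is unambiguous since the strands are disjoint and
  shorter than a full turn, so that a point determines its strand and its angle.\<close>

lemma extension_inner:
  assumes "(i, a, b) \<in> \<S>" "a < t" "t < b"
  shows "extension \<phi> w (i, cis t) = w (i, a, b) t"
proof -
  have "(THE v. \<exists>i' a' b' t'. (i', a', b') \<in> \<S> \<and> a' < t' \<and> t' < b' \<and> (i, cis t) = (i', cis t') \<and>
      v = w (i', a', b') t') = w (i, a, b) t"
  proof (rule the_equality)
    show "\<exists>i' a' b' t'. (i', a', b') \<in> \<S> \<and> a' < t' \<and> t' < b' \<and> (i, cis t) = (i', cis t') \<and>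
      w (i, a, b) t = w (i', a', b') t'" using assms by blast
    fix v assume "\<exists>i' a' b' t'. (i', a', b') \<in> \<S> \<and> a' < t' \<and> t' < b' \<and> (i, cis t) = (i', cis t') \<and>
      v = w (i', a', b') t'"
    then obtain i' a' b' t' where *: "(i', a', b') \<in> \<S>" "a' < t'" "t' < b'" "(i, cis t) = (i', cis t')"
      "v = w (i', a', b') t'" by blast
    then have "(i, a, b) = (i', a', b')" "t = t'"
      using strand_unique[OF assms(1) less_imp_le[OF assms(2)] less_imp_le[OF assms(3)]
          *(1) less_imp_le[OF *(2)] less_imp_le[OF *(3)] *(4)] by blast+
    with *(5) show "v = w (i, a, b) t" by simp
  qed
  then show ?thesis using mem_Inn[OF assms] by (simp add: extension_def)
qed

text \<open>Other strands stay at a distance by closedness. The strand itself could come back only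
  around the circle, and the gap between \<open>b\<close> and \<open>a + 2 * pi\<close> prevents
  that.\<close>

lemma rot_at_start:
  assumes "(i, a, b) \<in> \<S>"
  shows "\<forall>\<^sub>F t in at_left 0. rot (i, cis a) t \<notin> Inn"
    and "\<forall>\<^sub>F t in at_right 0. rot (i, cis b) t \<notin> Inn"
proof -
  note S = strandD[OF assms]
  have aux: "\<forall>\<^sub>F t in at 0. rot (i, cis u) t \<notin> \<Union> (strand_points ` (\<S> - {(i, a, b)}))"
    if "a \<le> u" "u \<le> b" for u
    using strands_disjoint[OF assms] mem_strand[OF that]
    by (intro eventually_rot_not_in_strands) blast+
  have out: "(i, cis u) \<notin> Inn"
    if "(i, cis u) \<notin> \<Union> (strand_points ` (\<S> - {(i, a, b)}))" "b \<le> u" "u \<le> a + 2 * pi" for u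
  proof
    assume "(i, cis u) \<in> Inn"
    then have "(i, cis u) \<in> inner_strand_points (i, a, b)"
      using that(1) inner_subset_strand by blast
    then obtain t where t: "a < t" "t < b" "cis u = cis t"
      by (auto simp: inner_strand_points_def)
    then have "t = u" using cis_inj_on_strand[of t u t u] that by simp
    then show False using t that by simp
  qed
  have "\<forall>\<^sub>F t in at_left 0. t \<in> {b - (a + 2 * pi)<..<0}"
    using S by (intro eventually_at_left_real) simp
  moreover have "\<forall>\<^sub>F t in at_left 0. rot (i, cis a) t \<notin> \<Union> (strand_points ` (\<S> - {(i, a, b)}))"
    using aux[of a] S by (simp add: eventually_at_split)
  ultimately show "\<forall>\<^sub>F t in at_left 0. rot (i, cis a) t \<notin> Inn"
  proof eventually_elim
    case (elim t)
    \<comment> \<open>Angles just before \<open>a\<close> become angles in the gap after adding a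
      full turn.\<close>
    have "cis (a + t) = cis (a + t + 2 * pi)" by (simp add: complex_eq_iff)
    then show ?case using out[of "a + t + 2 * pi"] elim by (simp del: cis_2pi)
  qed
  have "\<forall>\<^sub>F t in at_right 0. t \<in> {0<..<a + 2 * pi - b}"
    using S by (intro eventually_at_right_real) simp
  moreover have "\<forall>\<^sub>F t in at_right 0. rot (i, cis b) t \<notin> \<Union> (strand_points ` (\<S> - {(i, a, b)}))"
    using aux[of b] S by (simp add: eventually_at_split)
  ultimately show "\<forall>\<^sub>F t in at_right 0. rot (i, cis b) t \<notin> Inn"
    by eventually_elim (use out in auto)
qed

lemma eventually_shift:
  "(\<forall>\<^sub>F u in at a. P u) \<longleftrightarrow> (\<forall>\<^sub>F t in at 0. P (a + t))"
  "(\<forall>\<^sub>F u in at_left a. P u) \<longleftrightarrow> (\<forall>\<^sub>F t in at_left 0. P (a + t))"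
  "(\<forall>\<^sub>F u in at_right a. P u) \<longleftrightarrow> (\<forall>\<^sub>F t in at_right 0. P (a + t))" for a :: real
proof -
  have "at_left a = filtermap (\<lambda>x. x + a) (at_left 0)"
    using filtermap_at_left_shift[of "- a" 0] by simp
  then show "(\<forall>\<^sub>F u in at_left a. P u) \<longleftrightarrow> (\<forall>\<^sub>F t in at_left 0. P (a + t))"
    by (simp add: eventually_filtermap add.commute)
qed (simp_all add: at_to_0[of a] at_right_to_0[of a] eventually_filtermap add.commute)

lemma extension_near:
  assumes "(i, a, b) \<in> \<S>" "a < \<tau>" "\<tau> < b"
  shows "\<forall>\<^sub>F t in at 0. extension \<phi> w (rot (i, cis \<tau>) t) = w (i, a, b) (\<tau> + t)"
proof -
  have "\<forall>\<^sub>F t in at 0. t \<in> {a - \<tau><..<b - \<tau>}"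
    using assms by (intro eventually_at_in_open') auto
  then show ?thesis
    by eventually_elim (simp add: extension_inner[OF assms(1)])
qed

lemma Str_cases:
  assumes "p \<in> Str" "p \<notin> Inn"
  obtains i a b where "(i, a, b) \<in> \<S>" "p = (i, cis a) \<or> p = (i, cis b)"
proof -
  obtain i a b where S: "(i, a, b) \<in> \<S>" "p \<in> strand_points (i, a, b)" using assms(1) by auto
  then obtain t where t: "a \<le> t" "t \<le> b" "p = (i, cis t)" by (auto simp: strand_points_def)
  then have "t = a \<or> t = b" using mem_Inn[OF S(1), of t] assms(2) by force
  then show ?thesis using that[OF S(1)] t by auto
qed

text \<open>Off the strands the diagrams agree, and an end point of a strand is an under-point of
  neither diagram.\<close>

lemma under_outer: "p \<in> points D \<Longrightarrow> p \<notin> Inn \<Longrightarrow> p \<in> under_points D' \<longleftrightarrow> p \<in> under_points D"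
proof -
  interpret sym: local_move D' D \<S> by (rule local_move_sym)
  assume "p \<in> points D" "p \<notin> Inn"
  then show ?thesis using under_inner sym.under_inner outside(2) by metis
qed

text \<open>The delicate points are the ends of strands: one side is governed by
  \<open>\<phi>\<close>, the other by \<open>w\<close>, and \<open>start\<close> and
  \<open>final\<close> make the two match.\<close>

lemma extension_locally_constant_outer:
  assumes "coloring G D \<phi>" "p \<in> points D" "p \<notin> under_points D" "p \<notin> Inn"
    and start: "\<And>i a b. (i, a, b) \<in> \<S> \<Longrightarrow> \<forall>\<^sub>F u in at_right a. w (i, a, b) u = \<phi> (i, cis a)"
    and final: "\<And>i a b. (i, a, b) \<in> \<S> \<Longrightarrow> \<forall>\<^sub>F u in at_left b. w (i, a, b) u = \<phi> (i, cis b)"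
  shows "\<forall>\<^sub>F t in at 0. extension \<phi> w (rot p t) = \<phi> p"
proof -
  have loc: "\<forall>\<^sub>F t in at 0. \<phi> (rot p t) = \<phi> p" using assms by (simp add: coloring_def)
  show ?thesis
  proof (cases "p \<in> Str")
    case False
    then have "\<forall>\<^sub>F t in at 0. rot p t \<notin> Str" by (rule eventually_rot_not_in_strands) simp
    with loc show ?thesis
    proof eventually_elim
      case (elim t)
      then have "rot p t \<notin> Inn" using inner_subset by blast
      with elim show ?case by (simp add: extension_outer)
    qed
  next
    case True
    then obtain i a b where S: "(i, a, b) \<in> \<S>" "p = (i, cis a) \<or> p = (i, cis b)"
      using Str_cases assms(4) by metis
    note ab = strandD(2)[OF S(1)]
    have out: "extension \<phi> w (rot p t) = \<phi> p" if "rot p t \<notin> Inn" "\<phi> (rot p t) = \<phi> p" for t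
      using that by (simp add: extension_outer)
    have loc': "\<forall>\<^sub>F t in at_left 0. \<phi> (rot p t) = \<phi> p" "\<forall>\<^sub>F t in at_right 0. \<phi> (rot p t) = \<phi> p"
      using loc by (simp_all add: eventually_at_split)
    from S(2) show ?thesis
    proof
      assume p: "p = (i, cis a)"
      have "\<forall>\<^sub>F t in at_left 0. extension \<phi> w (rot p t) = \<phi> p"
        using rot_at_start(1)[OF S(1)] loc'(1) unfolding p[symmetric] by eventually_elim (rule out)
      moreover have "\<forall>\<^sub>F t in at_right 0. w (i, a, b) (a + t) = \<phi> p"
        using start[OF S(1)] unfolding eventually_shift(3)[of _ a] p .
      then have "\<forall>\<^sub>F t in at_right 0. extension \<phi> w (rot p t) = \<phi> p"
        using eventually_at_right_real[of 0 "b - a", simplified, OF ab]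
        by eventually_elim (simp add: p extension_inner[OF S(1)])
      ultimately show ?thesis by (simp add: eventually_at_split)
    next
      assume p: "p = (i, cis b)"
      have "\<forall>\<^sub>F t in at_right 0. extension \<phi> w (rot p t) = \<phi> p"
        using rot_at_start(2)[OF S(1)] loc'(2) unfolding p[symmetric] by eventually_elim (rule out)
      moreover have "\<forall>\<^sub>F t in at_left 0. w (i, a, b) (b + t) = \<phi> p"
        using final[OF S(1)] unfolding eventually_shift(2)[of _ b] p .
      then have "\<forall>\<^sub>F t in at_left 0. extension \<phi> w (rot p t) = \<phi> p"
        using eventually_at_left_real[of "a - b" 0, simplified, OF ab]
        by eventually_elim (simp add: p extension_inner[OF S(1)])
      ultimately show ?thesis by (simp add: eventually_at_split)
    qed
  qed
qed

text \<open>Reduces the construction of a coloring of \<open>D'\<close> to conditions in the angle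
  along each strand. A crossing outside the strands is a crossing of \<open>D\<close> with the same
  sign, and the values near it are those of \<open>\<phi>\<close>.\<close>

lemma coloring_extension:
  assumes \<phi>: "coloring G D \<phi>"
    and closed: "\<And>i a b t s. (i, a, b) \<in> \<S> \<Longrightarrow> a < t \<Longrightarrow> t < b \<Longrightarrow> w (i, a, b) t s \<in> carrier G"
    and start: "\<And>i a b. (i, a, b) \<in> \<S> \<Longrightarrow> \<forall>\<^sub>F u in at_right a. w (i, a, b) u = \<phi> (i, cis a)"
    and final: "\<And>i a b. (i, a, b) \<in> \<S> \<Longrightarrow> \<forall>\<^sub>F u in at_left b. w (i, a, b) u = \<phi> (i, cis b)"
    and locally_constant: "\<And>i a b t. (i, a, b) \<in> \<S> \<Longrightarrow> a < t \<Longrightarrow> t < b \<Longrightarrow>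
      (i, cis t) \<notin> under_points D' \<Longrightarrow> \<forall>\<^sub>F u in at t. w (i, a, b) u = w (i, a, b) t"
    and crossing: "\<And>i a b t q. (i, a, b) \<in> \<S> \<Longrightarrow> a < t \<Longrightarrow> t < b \<Longrightarrow>
      ((i, cis t), q) \<in> crossings_within D' \<S> \<Longrightarrow>
      \<exists>x z. (\<forall>\<^sub>F u in at_left t. w (i, a, b) u = x) \<and> (\<forall>\<^sub>F u in at_right t. w (i, a, b) u = z) \<and>
        (\<forall>s. z s = x s \<otimes>\<^bsub>G\<^esub> jump G D' (extension \<phi> w) ((i, cis t), q))"
  shows "coloring G D' (extension \<phi> w)"
  unfolding coloring_def
proof (intro conjI ballI)
  let ?e = "extension \<phi> w"
  fix p assume p: "p \<in> arc_points D'"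
  have "?e p \<in> UNIV \<rightarrow> carrier G \<and>
      (\<forall>\<^sub>F t in at 0. ?e (rot p t) = ?e p)"
  proof (cases "p \<in> Inn")
    case True
    then obtain i a b t where S: "(i, a, b) \<in> \<S>" "a < t" "t < b" "p = (i, cis t)"
      by (rule Inn_cases)
    have "\<forall>\<^sub>F u in at 0. w (i, a, b) (t + u) = w (i, a, b) t"
      using locally_constant[OF S(1-3)] p S(4) unfolding eventually_shift(1)[of _ t] by simp
    with extension_near[OF S(1-3)]
    have "\<forall>\<^sub>F u in at 0. ?e (rot p u) = w (i, a, b) t"
      unfolding S(4) by eventually_elim (rule HOL.trans)
    then show ?thesis
      using closed[OF S(1-3)] by (simp add: S(4) extension_inner[OF S(1-3)])
  next
    case False
    have "p \<in> points D" "p \<notin> under_points D"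
      using p under_outer[of p] False by (auto simp: points_eq)
    then show ?thesis
      using extension_locally_constant_outer[OF \<phi> _ _ False start final] coloring_closed[OF \<phi>]
      by (simp add: extension_outer[OF False])
  qed
  then show "?e p \<in> UNIV \<rightarrow> carrier G"
    "\<forall>\<^sub>F t in at 0. ?e (rot p t) = ?e p" by auto
next
  let ?e = "extension \<phi> w"
  fix c assume "c \<in> crossings D'"
  then obtain p q where c: "c = (p, q)" "(p, q) \<in> crossings D'" by (cases c) auto
  show "jumps_by G (?e) (fst c) (jump G D' (?e) c)"
  proof (cases "c \<in> crossings_within D' \<S>")
    case True
    then have "p \<in> Inn" using inner c by blast
    then obtain i a b t where S: "(i, a, b) \<in> \<S>" "a < t" "t < b" "p = (i, cis t)"
      by (rule Inn_cases)
    obtain x z where xz: "\<forall>\<^sub>F u in at_left t. w (i, a, b) u = x" "\<forall>\<^sub>F u in at_right t. w (i, a, b) u = z"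
        "\<forall>s. z s = x s \<otimes>\<^bsub>G\<^esub> jump G D' (?e) c"
      using crossing[OF S(1-3), of q] True S(4) c(1) by auto
    have near: "\<forall>\<^sub>F u in at_left 0. ?e (rot p u) = w (i, a, b) (t + u)"
        "\<forall>\<^sub>F u in at_right 0. ?e (rot p u) = w (i, a, b) (t + u)"
      using extension_near[OF S(1-3), of \<phi> w] by (simp_all add: S(4) eventually_at_split)
    have "\<forall>\<^sub>F u in at_left 0. ?e (rot p u) = x"
      using near(1) xz(1)[unfolded eventually_shift(2)[of _ t]] by eventually_elim (rule HOL.trans)
    moreover have "\<forall>\<^sub>F u in at_right 0. ?e (rot p u) = z"
      using near(2) xz(2)[unfolded eventually_shift(3)[of _ t]] by eventually_elim (rule HOL.trans)
    ultimately show ?thesis using xz(3) unfolding c(1) fst_conv by blast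
  next
    case False
    note out = crossing_outside[OF c(2) False[unfolded c(1)]]
    obtain x z where xz: "\<forall>\<^sub>F t in at_left 0. \<phi> (rot p t) = x" "\<forall>\<^sub>F t in at_right 0. \<phi> (rot p t) = z"
        "\<forall>s. z s = x s \<otimes>\<^bsub>G\<^esub> jump G D \<phi> (p, q)"
      using \<phi> out(3) unfolding coloring_def by fastforce
    have "\<forall>\<^sub>F t in at 0. rot p t \<notin> Str"
      using out(1) by (intro eventually_rot_not_in_strands) auto
    then have "\<forall>\<^sub>F t in at 0. ?e (rot p t) = \<phi> (rot p t)"
    proof eventually_elim
      case (elim t)
      then have "rot p t \<notin> Inn" using inner_subset by blast
      then show ?case by (rule extension_outer)
    qed
    then have near: "\<forall>\<^sub>F t in at_left 0. ?e (rot p t) = \<phi> (rot p t)"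
        "\<forall>\<^sub>F t in at_right 0. ?e (rot p t) = \<phi> (rot p t)"
      by (simp_all add: eventually_at_split)
    have "\<forall>\<^sub>F u in at_left 0. ?e (rot p u) = x"
      using near(1) xz(1) by eventually_elim (rule HOL.trans)
    moreover have "\<forall>\<^sub>F u in at_right 0. ?e (rot p u) = z"
      using near(2) xz(2) by eventually_elim (rule HOL.trans)
    moreover have "q \<notin> Inn" using out(2) inner_subset by blast
    then have "jump G D' (?e) (p, q) = jump G D \<phi> (p, q)"
      using out(4) by (simp add: jump_eq_side_jump extension_outer)
    ultimately show ?thesis using xz(3) unfolding c(1) fst_conv by metis
  qed
qed

text \<open>The matching of positions is the identity off the inner points, where the two diagrams
  have the same under-points. Each move supplies the extension and the uniqueness inside the
  disc.\<close>

lemma heap_group_iso_of_extensions: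
  assumes ext: "\<And>(G :: heap_monoid) \<phi>. group G \<Longrightarrow> coloring G D \<phi> \<Longrightarrow>
      \<exists>\<phi>'. coloring G D' \<phi>' \<and> (\<forall>p. p \<notin> Inn \<longrightarrow> \<phi>' p = \<phi> p)"
    and ext': "\<And>(G :: heap_monoid) \<phi>. group G \<Longrightarrow> coloring G D' \<phi> \<Longrightarrow>
      \<exists>\<phi>'. coloring G D \<phi>' \<and> (\<forall>p. p \<notin> Inn \<longrightarrow> \<phi>' p = \<phi> p)"
    and det: "\<And>(G :: heap_monoid) \<phi> \<psi> p. group G \<Longrightarrow> coloring G D \<phi> \<Longrightarrow> coloring G D \<psi> \<Longrightarrow>
      (\<And>p. p \<in> arc_points D \<Longrightarrow> p \<notin> Inn \<Longrightarrow> \<phi> p = \<psi> p) \<Longrightarrow>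
      p \<in> Inn \<Longrightarrow> p \<notin> under_points D \<Longrightarrow> \<phi> p = \<psi> p"
    and det': "\<And>(G :: heap_monoid) \<phi> \<psi> p. group G \<Longrightarrow> coloring G D' \<phi> \<Longrightarrow> coloring G D' \<psi> \<Longrightarrow>
      (\<And>p. p \<in> arc_points D' \<Longrightarrow> p \<notin> Inn \<Longrightarrow> \<phi> p = \<psi> p) \<Longrightarrow>
      p \<in> Inn \<Longrightarrow> p \<notin> under_points D' \<Longrightarrow> \<phi> p = \<psi> p"
  shows "heap_group D \<cong> heap_group D'"
proof -
  let ?P = "(arc_points D) - Inn"
  have P': "?P = (arc_points D') - Inn"
    using under_outer points_eq by auto
  let ?W = "Id_on (?P \<times> (UNIV :: side set))"
  have W: "fst ` ?W = ?P \<times> UNIV" "snd ` ?W = ?P \<times> UNIV" by (auto simp: Id_on_def image_iff)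
  have W': "snd ` ?W = (arc_points D' - Inn) \<times> UNIV" by (simp only: W(2) P'[symmetric])
  show ?thesis
  proof (rule heap_group_iso[OF link, of ?W])
    show "colorings_extend D D' ?W"
      unfolding colorings_extend_def
    proof (intro allI impI)
      fix G :: "heap_monoid" and \<phi>
      assume "group G \<and> coloring G D \<phi>"
      then obtain \<phi>' where "coloring G D' \<phi>'" "\<And>p. p \<notin> Inn \<Longrightarrow> \<phi>' p = \<phi> p"
        using ext by metis
      then show "\<exists>\<phi>'. coloring G D' \<phi>' \<and> (\<forall>((p, s), (p', s'))\<in>?W. \<phi>' p' s' = \<phi> p s)"
        by (intro exI[of _ \<phi>'] conjI) auto
    qed
    show "colorings_extend D' D (?W\<inverse>)"
      unfolding colorings_extend_def
    proof (intro allI impI)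
      fix G :: "heap_monoid" and \<phi>
      assume "group G \<and> coloring G D' \<phi>"
      then obtain \<phi>' where "coloring G D \<phi>'" "\<And>p. p \<notin> Inn \<Longrightarrow> \<phi>' p = \<phi> p"
        using ext' by metis
      then show "\<exists>\<phi>'. coloring G D \<phi>' \<and> (\<forall>((p, s), (p', s'))\<in>(?W\<inverse>). \<phi>' p' s' = \<phi> p s)"
        by (intro exI[of _ \<phi>'] conjI) auto
    qed
    show "colorings_determined D (fst ` ?W)"
      unfolding colorings_determined_def W
    proof (intro allI impI ballI)
      fix G :: "heap_monoid" and \<phi> \<psi> p
      assume *: "group G \<and> coloring G D \<phi> \<and> coloring G D \<psi> \<and> (\<forall>(p, s)\<in>?P \<times> UNIV. \<phi> p s = \<psi> p s)"
        and p: "p \<in> arc_points D"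
      have out: "\<phi> p = \<psi> p" if "p \<in> arc_points D" "p \<notin> Inn" for p
        using * that by (auto simp: fun_eq_iff)
      show "\<phi> p = \<psi> p"
        using det[of G \<phi> \<psi> p] * out p by (cases "p \<in> Inn") blast+
    qed
    show "colorings_determined D' (snd ` ?W)"
      unfolding colorings_determined_def W'
    proof (intro allI impI ballI)
      fix G :: "heap_monoid" and \<phi> \<psi> p
      assume *: "group G \<and> coloring G D' \<phi> \<and> coloring G D' \<psi> \<and>
          (\<forall>(p, s)\<in>(arc_points D' - Inn) \<times> UNIV. \<phi> p s = \<psi> p s)"
        and p: "p \<in> arc_points D'"
      have out: "\<phi> p = \<psi> p" if "p \<in> arc_points D'" "p \<notin> Inn" for p
        using * that by (auto simp: fun_eq_iff)
      show "\<phi> p = \<psi> p"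
        using det'[of G \<phi> \<psi> p] * out p by (cases "p \<in> Inn") blast+
    qed
    show "fst ` fst ` ?W \<subseteq> arc_points D" "fst ` snd ` ?W \<subseteq> arc_points D'"
      unfolding W using P' by auto
  qed
qed

end

section \<open>Piecewise constant values along a strand\<close>

definition step :: "real \<Rightarrow> real \<Rightarrow> 'v \<Rightarrow> 'v \<Rightarrow> 'v \<Rightarrow> real \<Rightarrow> 'v" where
  "step \<tau>1 \<tau>2 v0 v1 v2 u = (if u < \<tau>1 then v0 else if u < \<tau>2 then v1 else v2)"

lemma step_near:
  assumes "\<tau>1 < \<tau>2"
  shows "\<forall>\<^sub>F u in at_left \<tau>1. step \<tau>1 \<tau>2 v0 v1 v2 u = v0"
    and "\<forall>\<^sub>F u in at_right \<tau>1. step \<tau>1 \<tau>2 v0 v1 v2 u = v1"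
    and "\<forall>\<^sub>F u in at_left \<tau>2. step \<tau>1 \<tau>2 v0 v1 v2 u = v1"
    and "\<forall>\<^sub>F u in at_right \<tau>2. step \<tau>1 \<tau>2 v0 v1 v2 u = v2"
    and "a < \<tau>1 \<Longrightarrow> \<forall>\<^sub>F u in at_right a. step \<tau>1 \<tau>2 v0 v1 v2 u = v0"
    and "\<tau>2 < b \<Longrightarrow> \<forall>\<^sub>F u in at_left b. step \<tau>1 \<tau>2 v0 v1 v2 u = v2"
proof -
  show "\<forall>\<^sub>F u in at_left \<tau>1. step \<tau>1 \<tau>2 v0 v1 v2 u = v0"
    using eventually_at_left_real[of "\<tau>1 - 1" \<tau>1]
    by (simp add: step_def) (auto elim!: eventually_mono)
  show "\<forall>\<^sub>F u in at_right \<tau>1. step \<tau>1 \<tau>2 v0 v1 v2 u = v1"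
    using eventually_at_right_real[OF assms] by (rule eventually_mono) (simp add: step_def)
  show "\<forall>\<^sub>F u in at_left \<tau>2. step \<tau>1 \<tau>2 v0 v1 v2 u = v1"
    using eventually_at_left_real[OF assms] by (rule eventually_mono) (simp add: step_def)
  show "\<forall>\<^sub>F u in at_right \<tau>2. step \<tau>1 \<tau>2 v0 v1 v2 u = v2"
    using eventually_at_right_real[of \<tau>2 "\<tau>2 + 1"] assms
    by (simp add: step_def) (auto elim!: eventually_mono)
  show "\<forall>\<^sub>F u in at_right a. step \<tau>1 \<tau>2 v0 v1 v2 u = v0" if "a < \<tau>1"
    using eventually_at_right_real[OF that] by (rule eventually_mono) (simp add: step_def)
  show "\<forall>\<^sub>F u in at_left b. step \<tau>1 \<tau>2 v0 v1 v2 u = v2" if "\<tau>2 < b"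
    using eventually_at_left_real[OF that] by (rule eventually_mono) (use assms in \<open>simp add: step_def\<close>)
qed

text \<open>A break between equal values is no break, so \<open>step\<close> also describes a strand
  with a single under-crossing.\<close>

lemma step_locally_constant:
  assumes "t \<noteq> \<tau>1 \<or> v0 = v1" "t \<noteq> \<tau>2 \<or> v1 = v2" "\<tau>1 < \<tau>2"
  shows "\<forall>\<^sub>F u in at t. step \<tau>1 \<tau>2 v0 v1 v2 u = step \<tau>1 \<tau>2 v0 v1 v2 t"
proof -
  \<comment> \<open>Within this radius of \<open>t\<close> no break is met except possibly
    \<open>t\<close> itself, in which case the distance to the other break is the bound.\<close>
  let ?d = "\<lambda>\<tau>. if t = \<tau> then (\<tau>2 - \<tau>1) else \<bar>t - \<tau>\<bar>"
  define d where "d = min (?d \<tau>1) (?d \<tau>2)"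
  have "d > 0" using assms(3) by (auto simp: d_def)
  then have "\<forall>\<^sub>F u in at t. \<bar>u - t\<bar> < d"
    unfolding eventually_at by (auto simp: dist_real_def)
  then show ?thesis
    by eventually_elim (use assms in \<open>auto simp: step_def d_def split: if_splits\<close>)
qed

section \<open>Algebra of the jump across two strings\<close>

context group
begin

lemma side_jump_closed: "(\<And>s. v s \<in> carrier G) \<Longrightarrow> side_jump G b v \<in> carrier G"
  by (simp add: side_jump_def)

lemma side_jump_Not: "(\<And>s. v s \<in> carrier G) \<Longrightarrow> side_jump G (\<not> b) v = inv side_jump G b v"
  by (simp add: side_jump_def inv_mult_group)

lemma side_jump_mult:
  assumes "\<And>s. v s \<in> carrier G" "k \<in> carrier G"
  shows "side_jump G b (\<lambda>s. v s \<otimes> k) = inv k \<otimes> side_jump G b v \<otimes> k"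
  using assms by (simp add: side_jump_def inv_mult_group m_assoc)

text \<open>Right multiplication by \<open>k\<close> conjugates a side jump by \<open>k\<close>.
  Here \<open>k\<close> equals that side jump or its inverse and commutes with it, so a strand
  passing under itself keeps its side jumps.\<close>

lemma side_jump_mult_own:
  assumes "\<And>s. v s \<in> carrier G"
  shows "side_jump G b' (\<lambda>s. v s \<otimes> side_jump G b v) = side_jump G b' v"
proof -
  have J: "side_jump G b v \<in> carrier G" using assms by (rule side_jump_closed)
  consider "b' = b" | "b' = (\<not> b)" by auto
  then show ?thesis
    using side_jump_mult[where v = v and b = b', OF assms J] side_jump_Not[OF assms, of b] J
    by cases (simp_all add: m_assoc)
qed

text \<open>For a kink whose lower point comes first, the over-strand carries the outgoing value
  \<open>u\<close>, which is then given only implicitly. With \<open>k\<close> the side jump of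
  \<open>u\<close>, the conjugation formula reads \<open>k = k\<inverse> J k\<close>, where
  \<open>J\<close> is the side jump of \<open>v\<close>; hence \<open>k = J\<close>.\<close>

lemma side_jump_fixed_point:
  assumes "\<And>s. v s \<in> carrier G" "\<And>s. u s \<in> carrier G" "\<And>s. u s = v s \<otimes> side_jump G b u"
  shows "side_jump G b u = side_jump G b v"
proof -
  define k where "k = side_jump G b u"
  have k: "k \<in> carrier G" unfolding k_def using assms(2) by (rule side_jump_closed)
  have J: "side_jump G b v \<in> carrier G" using assms(1) by (rule side_jump_closed)
  have u: "(\<lambda>s. v s \<otimes> k) = u" using assms(3) unfolding k_def by (intro ext) simp
  have "k = inv k \<otimes> side_jump G b v \<otimes> k"
    using side_jump_mult[where v = v and b = b, OF assms(1) k]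
    unfolding u by (simp add: k_def[symmetric])
  then have "k \<otimes> k = k \<otimes> (inv k \<otimes> side_jump G b v \<otimes> k)" by simp
  also have "\<dots> = side_jump G b v \<otimes> k"
    using k J by (simp add: m_assoc[symmetric])
  finally show ?thesis using k J by (simp add: k_def[symmetric])
qed

end

section \<open>Uniqueness along a strand with at most two under-crossings\<close>

lemma colorings_agree0:
  assumes "coloring G D \<phi>" "coloring G D \<psi>" "i < ncomp D" "a < t" "t < b"
    "\<And>t. a \<le> t \<Longrightarrow> t \<le> b \<Longrightarrow> (i, cis t) \<notin> under_points D"
    "\<phi> (i, cis a) = \<psi> (i, cis a)"
  shows "\<phi> (i, cis t) = \<psi> (i, cis t)"
proof -
  have "\<theta> (i, cis a) = \<theta> (i, cis t)" if "coloring G D \<theta>" for \<theta>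
    by (rule coloring_constant[OF that assms(3), of a _ b]) (use assms(4-6) in auto)
  then show ?thesis using assms(1,2,7) by metis
qed

text \<open>The single under-crossing cuts the strand into two pieces, and each of them contains an
  end point.\<close>

lemma colorings_agree1:
  assumes "coloring G D \<phi>" "coloring G D \<psi>" "i < ncomp D" "a < t" "t < b"
    "\<And>t. a \<le> t \<Longrightarrow> t \<le> b \<Longrightarrow> (i, cis t) \<in> under_points D \<Longrightarrow> t = \<tau>"
    "\<phi> (i, cis a) = \<psi> (i, cis a)" "\<phi> (i, cis b) = \<psi> (i, cis b)" "t \<noteq> \<tau>"
  shows "\<phi> (i, cis t) = \<psi> (i, cis t)"
proof (cases "t < \<tau>")
  case True
  have "\<theta> (i, cis a) = \<theta> (i, cis t)" if "coloring G D \<theta>" for \<theta>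
    by (rule coloring_constant[OF that assms(3), of a _ t]) (use assms(4-6) True in force)+
  then show ?thesis using assms(1,2,7) by metis
next
  case False
  have "\<theta> (i, cis b) = \<theta> (i, cis t)" if "coloring G D \<theta>" for \<theta>
    by (rule coloring_constant[OF that assms(3), of t _ b])
      (use assms(4,5,9) False in \<open>auto dest!: assms(6)[rotated 2]\<close>)
  then show ?thesis using assms(1,2,8) by metis
qed

text \<open>The two outer pieces contain end points; the middle one is reached from the start across
  the first under-crossing, whose jump has to agree for both colorings.\<close>

lemma colorings_agree2:
  assumes "group G" "link_diagram D" "coloring G D \<phi>" "coloring G D \<psi>" "i < ncomp D" "a < t" "t < b"
    and \<tau>: "a < \<tau>1" "\<tau>1 < \<tau>2"
    and under: "\<And>t. a \<le> t \<Longrightarrow> t \<le> b \<Longrightarrow> (i, cis t) \<in> under_points D \<Longrightarrow> t = \<tau>1 \<or> t = \<tau>2"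
    and ends: "\<phi> (i, cis a) = \<psi> (i, cis a)" "\<phi> (i, cis b) = \<psi> (i, cis b)"
    and t: "t \<noteq> \<tau>1" "t \<noteq> \<tau>2"
    and q: "((i, cis \<tau>1), q) \<in> crossings D"
    and jump: "\<tau>1 < t \<Longrightarrow> t < \<tau>2 \<Longrightarrow>
      jump G D \<phi> ((i, cis \<tau>1), q) = jump G D \<psi> ((i, cis \<tau>1), q)"
  shows "\<phi> (i, cis t) = \<psi> (i, cis t)"
proof -
  consider "t < \<tau>1" | "\<tau>1 < t" "t < \<tau>2" | "\<tau>2 < t" using t by linarith
  then show ?thesis
  proof cases
    case 1
    have "\<theta> (i, cis a) = \<theta> (i, cis t)" if "coloring G D \<theta>" for \<theta>
      by (rule coloring_constant[OF that assms(5), of a _ t]) (use assms(6-10) 1 in force)+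
    then show ?thesis using assms(3,4) ends by metis
  next
    case 2
    have "\<theta> (i, cis t) s = \<theta> (i, cis a) s \<otimes>\<^bsub>G\<^esub> jump G D \<theta> ((i, cis \<tau>1), q)"
      if "coloring G D \<theta>" for \<theta> s
      by (rule coloring_jump[OF assms(1,2) that q assms(5)]) (use assms(6-10) 2 in force)+
    from this[OF assms(3)] this[OF assms(4)] show ?thesis
      using ends(1) jump[OF 2] by (simp add: fun_eq_iff)
  next
    case 3
    have "\<theta> (i, cis b) = \<theta> (i, cis t)" if "coloring G D \<theta>" for \<theta>
      by (rule coloring_constant[OF that assms(5), of t _ b])
        (use assms(6-9) \<tau> 3 in \<open>auto dest!: under[rotated 2]\<close>)
    then show ?thesis using assms(3,4) ends by metis
  qed
qed

section \<open>Strands without crossings\<close>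

context local_move
begin

lemma under_crossing_within:
  assumes "(i, a, b) \<in> \<S>" "a \<le> t" "t \<le> b" "(i, cis t) \<in> under_points D"
  obtains q where "((i, cis t), q) \<in> crossings_within D \<S>"
  using under_within[OF assms(4) mem_Str[OF assms(1-3)]] .

lemma end_points_outer:
  assumes "(i, a, b) \<in> \<S>"
  shows "(i, cis a) \<notin> Inn" "(i, cis b) \<notin> Inn" "(i, cis a) \<in> arc_points D"
    "(i, cis b) \<in> arc_points D"
proof -
  note S = strandD[OF assms]
  have Inn: "(i, cis u) \<notin> Inn" if "u = a \<or> u = b" for u
  proof
    assume "(i, cis u) \<in> Inn"
    then obtain i' a' b' t where *: "(i', a', b') \<in> \<S>" "a' < t" "t < b'" "(i, cis u) = (i', cis t)"
      by (rule Inn_cases)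
    then have "(i, a, b) = (i', a', b')" "u = t"
      using strand_unique[OF assms _ _ *(1) less_imp_le[OF *(2)] less_imp_le[OF *(3)] *(4)] that S
      by auto
    then show False using * that by auto
  qed
  have "(i, cis u) \<in> arc_points D" if "u = a \<or> u = b" for u
    using Inn[OF that] under_inner[of "(i, cis u)"] mem_Str[OF assms, of u] S that by fastforce
  then show "(i, cis a) \<notin> Inn" "(i, cis b) \<notin> Inn" "(i, cis a) \<in> arc_points D"
    "(i, cis b) \<in> arc_points D"
    using Inn by blast+
qed

lemma crossingless_not_under:
  assumes "crossings_within D \<S> = {}" "(i, a, b) \<in> \<S>" "a \<le> t" "t \<le> b"
  shows "(i, cis t) \<notin> under_points D"
  using under_crossing_within[OF assms(2-4)] assms(1) by blast

lemma crossingless_constant: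
  assumes "crossings_within D \<S> = {}" "coloring G D \<phi>" "(i, a, b) \<in> \<S>" "a \<le> t" "t \<le> b"
  shows "\<phi> (i, cis t) = \<phi> (i, cis a)"
  by (rule coloring_constant[OF assms(2) strandD(1)[OF assms(3)], of a _ b])
    (use assms(4,5) crossingless_not_under[OF assms(1,3)] in auto)

lemma crossingless_colorings_agree:
  assumes "crossings_within D \<S> = {}" "coloring G D \<phi>" "coloring G D \<psi>"
    and "\<And>p. p \<in> arc_points D \<Longrightarrow> p \<notin> Inn \<Longrightarrow> \<phi> p = \<psi> p"
    and "p \<in> Inn"
  shows "\<phi> p = \<psi> p"
proof -
  obtain i a b t where t: "(i, a, b) \<in> \<S>" "a < t" "t < b" "p = (i, cis t)"
    by (rule Inn_cases[OF assms(5)])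
  have "\<theta> p = \<theta> (i, cis a)" if "coloring G D \<theta>" for \<theta>
    unfolding t(4) by (rule crossingless_constant[OF assms(1) that t(1)]) (use t in auto)
  then show ?thesis
    using assms(2-4) end_points_outer(1,3)[OF t(1)] by metis
qed

text \<open>Without crossings the only obstruction is that the two ends of each strand carry the
  same value. For the simplifying direction of a move this is the statement that the removed jumps
  cancel.\<close>

lemma crossingless_extension:
  assumes "crossings_within D' \<S> = {}" "coloring G D \<phi>"
    and "\<And>i a b. (i, a, b) \<in> \<S> \<Longrightarrow> \<phi> (i, cis a) = \<phi> (i, cis b)"
  shows "\<exists>\<phi>'. coloring G D' \<phi>' \<and> (\<forall>p. p \<notin> Inn \<longrightarrow> \<phi>' p = \<phi> p)"
proof -
  have "coloring G D' (extension \<phi> (\<lambda>(i, a, b) _. \<phi> (i, cis a)))"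
  proof (rule coloring_extension[OF assms(2)])
    fix i a b t s assume "(i, a, b) \<in> \<S>"
    then show "(case (i, a, b) of (i, a, b) \<Rightarrow> \<lambda>_. \<phi> (i, cis a)) t s \<in> carrier G"
      using coloring_closed[OF assms(2)] end_points_outer(3) by auto
  qed (use assms(1,3) in auto)
  then show ?thesis using extension_outer by blast
qed

end

section \<open>Reidemeister moves of type II\<close>

text \<open>The crossings are numbered along the lower strand, while the order of \<open>u1\<close>
  and \<open>u2\<close> is left open; this covers both parallel and antiparallel strands. The upper
  strand carries one value \<open>y\<close> throughout, so opposite signs make the two jumps inverse
  to each other.\<close>

lemma reidemeister2_ordered:
  assumes links: "link_diagram D" "link_diagram D'"
    and local: "local_change D D' {(i, a, b), (j, c, d)}" and ne: "(i, a, b) \<noteq> (j, c, d)"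
    and no_crossings: "crossings_within D {(i, a, b), (j, c, d)} = {}"
    and t: "a < t1" "t1 < t2" "t2 < b" and u: "c < u1" "u1 < d" "c < u2" "u2 < d"
    and crossings: "crossings_within D' {(i, a, b), (j, c, d)} =
      {((i, cis t1), (j, cis u1)), ((i, cis t2), (j, cis u2))}"
    and signs: "crossing_sign D' ((i, cis t1), (j, cis u1)) =
      - crossing_sign D' ((i, cis t2), (j, cis u2))"
  shows "heap_group D \<cong> heap_group D'"
proof -
  let ?S = "(i, a, b)" and ?S' = "(j, c, d)"
  let ?c1 = "((i, cis t1), (j, cis u1))" and ?c2 = "((i, cis t2), (j, cis u2))"
  interpret local_move D D' "{?S, ?S'}"
  proof
    show "p \<in> \<Union> (inner_strand_points ` {?S, ?S'}) \<and> q \<in> \<Union> (inner_strand_points ` {?S, ?S'})"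
      if "(p, q) \<in> crossings_within D {?S, ?S'} \<union> crossings_within D' {?S, ?S'}" for p q
      using that t u unfolding no_crossings crossings by (auto simp: inner_strand_points_def)
  qed (use links local in auto)
  interpret sym: local_move D' D "{?S, ?S'}" by (rule local_move_sym)
  have S: "?S \<in> {?S, ?S'}" "?S' \<in> {?S, ?S'}" by auto
  note SD = strandD[OF S(1)] strandD[OF S(2)]
  have c: "?c1 \<in> crossings D'" "?c2 \<in> crossings D'"
    using crossings by (auto simp: crossings_within_def)
  define pos where "pos \<longleftrightarrow> crossing_sign D' ?c1 < 0"
  have pos2: "crossing_sign D' ?c2 < 0 \<longleftrightarrow> \<not> pos"
    unfolding pos_def using signs crossing_sign_cases[OF links(2) c(1)] by auto
  have angle: "?S = (k, e, f) \<and> (t = t1 \<and> q = (j, cis u1) \<or> t = t2 \<and> q = (j, cis u2))"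
    if *: "(k, e, f) \<in> {?S, ?S'}" "e \<le> t" "t \<le> f"
      "((k, cis t), q) \<in> crossings_within D' {?S, ?S'}" for k e f t q
  proof -
    consider "(i, cis t1) = (k, cis t)" "q = (j, cis u1)" | "(i, cis t2) = (k, cis t)" "q = (j, cis u2)"
      using *(4) crossings by auto
    then show ?thesis
      using strand_unique[OF S(1) _ _ *(1-3), of t1] strand_unique[OF S(1) _ _ *(1-3), of t2] t
      by cases auto
  qed
  have under: "?S = (k, e, f) \<and> (t = t1 \<or> t = t2)"
    if *: "(k, e, f) \<in> {?S, ?S'}" "e \<le> t" "t \<le> f" "(k, cis t) \<in> under_points D'" for k e f t
  proof -
    obtain q where "((k, cis t), q) \<in> crossings_within D' {?S, ?S'}"
      using sym.under_crossing_within[OF *] .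
    then show ?thesis using angle[OF *(1-3)] by blast
  qed
  have not_under': "(j, cis t) \<notin> under_points D'" if "c \<le> t" "t \<le> d" for t
    using under[OF S(2) that] ne by blast
  show ?thesis
  proof (rule heap_group_iso_of_extensions)
    fix G :: "heap_monoid" and \<phi>
    assume "group G" and \<phi>: "coloring G D \<phi>"
    interpret group G by fact
    define x where "x = \<phi> (i, cis a)"
    define y where "y = \<phi> (j, cis c)"
    have closed: "x s \<in> carrier G" "y s \<in> carrier G" for s
      using coloring_closed[OF \<phi>] end_points_outer(3)[OF S(1)] end_points_outer(3)[OF S(2)]
      by (auto simp: x_def y_def)
    define J where "J = side_jump G pos y"
    have J: "J \<in> carrier G" unfolding J_def using closed(2) by (rule side_jump_closed)
    have x': "x = \<phi> (i, cis b)" and y': "y = \<phi> (j, cis d)"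
      unfolding x_def y_def
      using crossingless_constant[OF no_crossings \<phi> S(1), of b]
        crossingless_constant[OF no_crossings \<phi> S(2), of d] SD by simp_all
    \<comment> \<open>Between its two crossings the lower strand carries \<open>x\<close> shifted by
      the first jump; the second jump leads back to \<open>x\<close>, as required by the unchanged
      end.\<close>
    define w where "w = (\<lambda>S. if S = ?S then step t1 t2 x (\<lambda>s. x s \<otimes>\<^bsub>G\<^esub> J) x else (\<lambda>_. y))"
    have w: "w ?S = step t1 t2 x (\<lambda>s. x s \<otimes>\<^bsub>G\<^esub> J) x" "w ?S' = (\<lambda>_. y)"
      using ne by (auto simp: w_def)
    have ext_u: "extension \<phi> w (j, cis u1) = y" "extension \<phi> w (j, cis u2) = y"
      by (simp_all add: extension_inner[OF S(2)] u w(2))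
    have jumps: "jump G D' (extension \<phi> w) ?c1 = J" "jump G D' (extension \<phi> w) ?c2 = inv\<^bsub>G\<^esub> J"
      by (simp_all add: jump_eq_side_jump ext_u pos_def[symmetric] pos2 J_def side_jump_Not closed)
    have "coloring G D' (extension \<phi> w)"
    proof (rule coloring_extension[OF \<phi>])
      fix k e f
      assume kef: "(k, e, f) \<in> {?S, ?S'}"
      then consider "(k, e, f) = ?S" | "(k, e, f) = ?S'" by blast
      note cases = this
      show "\<forall>\<^sub>F u in at_right e. w (k, e, f) u = \<phi> (k, cis e)"
        by (cases rule: cases) (use step_near(5)[OF t(2,1)] in \<open>auto simp: w x_def y_def\<close>)
      show "\<forall>\<^sub>F u in at_left f. w (k, e, f) u = \<phi> (k, cis f)"
        by (cases rule: cases)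
          (use step_near(6)[OF t(2,3)] in \<open>auto simp: w x'[symmetric] y'[symmetric]\<close>)
      fix t assume ef: "e < t" "t < f"
      show "w (k, e, f) t s \<in> carrier G" for s
        by (cases rule: cases) (auto simp: w step_def closed J)
      show "\<forall>\<^sub>F u in at t. w (k, e, f) u = w (k, e, f) t" if "(k, cis t) \<notin> under_points D'"
      proof (cases rule: cases)
        case 1
        then have "t \<noteq> t1" "t \<noteq> t2" using that crossing_facts(3)[OF links(2)] c by auto
        then show ?thesis using step_locally_constant[of t t1 _ _ t2] t(2) by (auto simp: 1 w)
      qed (simp add: w)
      fix q assume q: "((k, cis t), q) \<in> crossings_within D' {?S, ?S'}"
      consider "(k, e, f) = ?S" "t = t1" "q = (j, cis u1)" | "(k, e, f) = ?S" "t = t2" "q = (j, cis u2)"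
        using angle[OF kef less_imp_le[OF ef(1)] less_imp_le[OF ef(2)] q] by metis
      then show "\<exists>x z. (\<forall>\<^sub>F u in at_left t. w (k, e, f) u = x) \<and>
          (\<forall>\<^sub>F u in at_right t. w (k, e, f) u = z) \<and>
          (\<forall>s. z s = x s \<otimes>\<^bsub>G\<^esub> jump G D' (extension \<phi> w) ((k, cis t), q))"
      proof cases
        case 1
        then show ?thesis using step_near(1,2)[OF t(2)] jumps(1) w(1)
          by (intro exI[of _ x] exI[of _ "\<lambda>s. x s \<otimes>\<^bsub>G\<^esub> J"]) auto
      next
        case 2
        then show ?thesis using step_near(3,4)[OF t(2)] jumps(2) w(1)
          by (intro exI[of _ x] exI[of _ "\<lambda>s. x s \<otimes>\<^bsub>G\<^esub> J"]) (auto simp: m_assoc closed J)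
      qed
    qed
    then show "\<exists>\<phi>'. coloring G D' \<phi>' \<and> (\<forall>p. p \<notin> Inn \<longrightarrow> \<phi>' p = \<phi> p)"
      using extension_outer by blast
  next
    fix G :: "heap_monoid" and \<phi>
    assume "group G" and \<phi>: "coloring G D' \<phi>"
    interpret group G by fact
    define x where "x = \<phi> (i, cis a)"
    define y where "y = \<phi> (j, cis c)"
    \<comment> \<open>An angle between the two crossings, at which the jumps are composed.\<close>
    define m where "m = (t1 + t2) / 2"
    have m: "t1 < m" "m < t2" using t by (auto simp: m_def)
    have closed: "x s \<in> carrier G" "y s \<in> carrier G" for s
      using coloring_closed[OF \<phi>] sym.end_points_outer(3)[OF S(1)] sym.end_points_outer(3)[OF S(2)]
      by (auto simp: x_def y_def)
    have y: "\<phi> (j, cis t) = y" if "c \<le> t" "t \<le> d" for t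
      unfolding y_def by (rule coloring_constant[OF \<phi> sym.strandD(1)[OF S(2)], of c _ d])
        (use that SD not_under' in auto)
    have jumps: "jump G D' \<phi> ?c1 = side_jump G pos y" "jump G D' \<phi> ?c2 = inv\<^bsub>G\<^esub> side_jump G pos y"
      using u by (simp_all add: jump_eq_side_jump y pos_def[symmetric] pos2 side_jump_Not closed)
    have "\<phi> (i, cis m) s = x s \<otimes>\<^bsub>G\<^esub> side_jump G pos y" for s
      unfolding x_def jumps(1)[symmetric]
      by (rule coloring_jump[OF \<open>group G\<close> links(2) \<phi> c(1) sym.strandD(1)[OF S(1)] t(1) m(1)])
        (use under[OF S(1)] m t in force)
    moreover have "\<phi> (i, cis b) s = \<phi> (i, cis m) s \<otimes>\<^bsub>G\<^esub> inv\<^bsub>G\<^esub> side_jump G pos y" for s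
      unfolding jumps(2)[symmetric]
      by (rule coloring_jump[OF \<open>group G\<close> links(2) \<phi> c(2) sym.strandD(1)[OF S(1)] m(2) t(3)])
        (use m t in \<open>auto dest!: under[OF S(1), rotated 2]\<close>)
    ultimately have x': "\<phi> (i, cis b) = x"
      by (intro ext) (simp add: m_assoc closed side_jump_closed)
    then show "\<exists>\<phi>'. coloring G D \<phi>' \<and> (\<forall>p. p \<notin> Inn \<longrightarrow> \<phi>' p = \<phi> p)"
      using SD y[of d] by (intro sym.crossingless_extension[OF no_crossings \<phi>]) (auto simp: x_def y_def)
  next
    fix G :: "heap_monoid" and \<phi> \<psi> p
    assume "group G" and \<phi>: "coloring G D \<phi>" and \<psi>: "coloring G D \<psi>"
      and outer: "\<And>p. p \<in> arc_points D \<Longrightarrow> p \<notin> Inn \<Longrightarrow> \<phi> p = \<psi> p"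
      and p: "p \<in> Inn"
    show "\<phi> p = \<psi> p"
      by (rule crossingless_colorings_agree[OF no_crossings \<phi> \<psi> outer p])
  next
    fix G :: "heap_monoid" and \<phi> \<psi> p
    assume "group G" and \<phi>: "coloring G D' \<phi>" and \<psi>: "coloring G D' \<psi>"
      and outer: "\<And>p. p \<in> arc_points D' \<Longrightarrow> p \<notin> Inn \<Longrightarrow> \<phi> p = \<psi> p"
      and p: "p \<in> Inn" "p \<notin> under_points D'"
    have ends: "\<phi> (k, cis e) = \<psi> (k, cis e)" "\<phi> (k, cis f) = \<psi> (k, cis f)"
      if "(k, e, f) \<in> {?S, ?S'}" for k e f
      using outer sym.end_points_outer[OF that] by blast+
    have S': "\<phi> (j, cis t) = \<psi> (j, cis t)" if "c < t" "t < d" for t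
      using colorings_agree0[OF \<phi> \<psi> sym.strandD(1)[OF S(2)] that not_under' ends(1)[OF S(2)]] .
    obtain k e f \<tau> where \<tau>: "(k, e, f) \<in> {?S, ?S'}" "e < \<tau>" "\<tau> < f" "p = (k, cis \<tau>)"
      by (rule Inn_cases[OF p(1)])
    from \<tau>(1) consider "(k, e, f) = ?S" | "(k, e, f) = ?S'" by blast
    then show "\<phi> p = \<psi> p"
    proof cases
      case 1
      have "\<tau> \<noteq> t1" "\<tau> \<noteq> t2"
        using p(2) \<tau>(4) 1 crossing_facts(3)[OF links(2)] c by auto
      moreover have "jump G D' \<phi> ?c1 = jump G D' \<psi> ?c1"
        using S' u by (simp add: jump_eq_side_jump)
      ultimately show ?thesis
        using colorings_agree2[OF \<open>group G\<close> links(2) \<phi> \<psi> sym.strandD(1)[OF S(1)] _ _ t(1,2)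
            conjunct2[OF under[OF S(1)]] ends[OF S(1)] _ _ c(1)] \<tau> 1 by auto
    next
      case 2
      then show ?thesis using S' \<tau> by auto
    qed
  qed
qed

lemma reidemeister2_heap_group:
  assumes "link_diagram D" "link_diagram D'" "reidemeister2 D D'"
  shows "heap_group D \<cong> heap_group D'"
proof -
  obtain S S' p1 p2 q1 q2 where r: "S \<noteq> S'" "local_change D D' {S, S'}"
    "crossings_within D {S, S'} = {}"
    "p1 \<in> inner_strand_points S" "p2 \<in> inner_strand_points S"
    "q1 \<in> inner_strand_points S'" "q2 \<in> inner_strand_points S'"
    "p1 \<noteq> p2" "crossings_within D' {S, S'} = {(p1, q1), (p2, q2)}"
    "crossing_sign D' (p1, q1) = - crossing_sign D' (p2, q2)"
    using assms(3) unfolding reidemeister2_def by blast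
  obtain i a b j c d where S: "S = (i, a, b)" "S' = (j, c, d)" by (cases S, cases S')
  obtain t1 t2 u1 u2 where t: "a < t1" "t1 < b" "p1 = (i, cis t1)" "a < t2" "t2 < b" "p2 = (i, cis t2)"
    and u: "c < u1" "u1 < d" "q1 = (j, cis u1)" "c < u2" "u2 < d" "q2 = (j, cis u2)"
    using r(4-7) by (auto simp: S inner_strand_points_def)
  have "t1 \<noteq> t2" using r(8) t by auto
  then consider "t1 < t2" | "t2 < t1" by linarith
  then show ?thesis
  proof cases
    case 1
    show ?thesis
      by (rule reidemeister2_ordered[OF assms(1,2) r(2)[unfolded S] r(1)[unfolded S] r(3)[unfolded S]
            t(1) 1 t(5) u(1,2,4,5)])
        (use r(9,10) in \<open>simp_all add: S t u\<close>)
  next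
    case 2
    show ?thesis
      by (rule reidemeister2_ordered[OF assms(1,2) r(2)[unfolded S] r(1)[unfolded S] r(3)[unfolded S]
            t(4) 2 t(2) u(4,5,1,2)])
        (use r(9,10) in \<open>simp_all add: S t u insert_commute\<close>)
  qed
qed

section \<open>Cancelling kinks\<close>

text \<open>Here \<open>t1\<close>, \<open>t2\<close> are the lower and \<open>u1\<close>,
  \<open>u2\<close> the upper angles of the kinks. The inequalities place \<open>u1\<close> on the
  first or middle piece of the strand and \<open>u2\<close> on the middle or last piece, so both
  kinds of kink are treated together.\<close>

lemma cancelling_kinks_ordered:
  assumes links: "link_diagram D" "link_diagram D'"
    and local: "local_change D D' {(i, a, b)}"
    and no_crossings: "crossings_within D {(i, a, b)} = {}"
    and t: "a < t1" "t1 < t2" "t2 < b"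
    and u: "a < u1" "u1 < t2" "u1 \<noteq> t1" "t1 < u2" "u2 < b" "u2 \<noteq> t2"
    and crossings: "crossings_within D' {(i, a, b)} =
      {((i, cis t1), (i, cis u1)), ((i, cis t2), (i, cis u2))}"
    and signs: "crossing_sign D' ((i, cis t1), (i, cis u1)) =
      - crossing_sign D' ((i, cis t2), (i, cis u2))"
  shows "heap_group D \<cong> heap_group D'"
proof -
  let ?S = "(i, a, b)"
  let ?c1 = "((i, cis t1), (i, cis u1))" and ?c2 = "((i, cis t2), (i, cis u2))"
  interpret local_move D D' "{?S}"
  proof
    show "p \<in> \<Union> (inner_strand_points ` {?S}) \<and> q \<in> \<Union> (inner_strand_points ` {?S})"
      if "(p, q) \<in> crossings_within D {?S} \<union> crossings_within D' {?S}" for p q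
      using that t u unfolding no_crossings crossings by (auto simp: inner_strand_points_def)
  qed (use links local in auto)
  interpret sym: local_move D' D "{?S}" by (rule local_move_sym)
  have S: "?S \<in> {?S}" by auto
  note SD = strandD[OF S] and SD' = sym.strandD[OF S]
  have c: "?c1 \<in> crossings D'" "?c2 \<in> crossings D'"
    using crossings by (auto simp: crossings_within_def)
  define pos where "pos \<longleftrightarrow> crossing_sign D' ?c1 < 0"
  have pos2: "crossing_sign D' ?c2 < 0 \<longleftrightarrow> \<not> pos"
    unfolding pos_def using signs crossing_sign_cases[OF links(2) c(1)] by auto
  have angle: "t = t1 \<and> q = (i, cis u1) \<or> t = t2 \<and> q = (i, cis u2)"
    if *: "a \<le> t" "t \<le> b" "((i, cis t), q) \<in> crossings_within D' {?S}" for t q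
  proof -
    consider "(i, cis t1) = (i, cis t)" "q = (i, cis u1)" | "(i, cis t2) = (i, cis t)" "q = (i, cis u2)"
      using *(3) crossings by auto
    then show ?thesis
      using strand_unique[OF S _ _ S *(1-2), of t1] strand_unique[OF S _ _ S *(1-2), of t2] t
      by cases auto
  qed
  have under: "t = t1 \<or> t = t2" if *: "a \<le> t" "t \<le> b" "(i, cis t) \<in> under_points D'" for t
  proof -
    obtain q where "((i, cis t), q) \<in> crossings_within D' {?S}"
      using sym.under_crossing_within[OF S *] .
    then show ?thesis using angle[OF *(1,2)] by blast
  qed
  define m where "m = (t1 + t2) / 2"
  have m: "t1 < m" "m < t2" using t by (auto simp: m_def)
  have before: "\<phi> (i, cis t) = \<phi> (i, cis a)" if "coloring G D' \<phi>" "a \<le> t" "t < t1"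
    for G :: "heap_monoid" and \<phi> t
    by (rule coloring_constant[OF that(1) SD'(1), of a _ t])
      (use that t in \<open>auto dest!: under[rotated 2]\<close>)
  have middle: "\<phi> (i, cis t) = \<phi> (i, cis m)" if "coloring G D' \<phi>" "t1 < t" "t < t2"
    for G :: "heap_monoid" and \<phi> t
    by (rule coloring_constant[OF that(1) SD'(1), of "min t m" _ "max t m"])
      (use that t m in \<open>auto dest!: under[rotated 2]\<close>)
  have after: "\<phi> (i, cis t) = \<phi> (i, cis b)" if "coloring G D' \<phi>" "t2 < t" "t \<le> b"
    for G :: "heap_monoid" and \<phi> t
    by (rule coloring_constant[OF that(1) SD'(1), of t _ b])
      (use that t in \<open>auto dest!: under[rotated 2]\<close>)
  \<comment> \<open>The jump at the first kink depends only on the incoming value, whichever of its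
    two preimages comes first.\<close>
  have first_jump: "\<phi> (i, cis m) = (\<lambda>s. \<phi> (i, cis a) s \<otimes>\<^bsub>G\<^esub> side_jump G pos (\<phi> (i, cis a)))"
    and jump1: "jump G D' \<phi> ?c1 = side_jump G pos (\<phi> (i, cis a))"
    if "group G" "coloring G D' \<phi>" for G :: "heap_monoid" and \<phi>
  proof -
    interpret group G by fact
    define x where "x = \<phi> (i, cis a)"
    have x: "x s \<in> carrier G" for s
      using coloring_closed[OF that(2)] sym.end_points_outer(3)[OF S] by (auto simp: x_def)
    have y: "\<phi> (i, cis m) s \<in> carrier G" for s
      by (rule coloring_closed[OF that(2)]) (use SD' m t in \<open>auto dest!: under[rotated 2]\<close>)
    have jump: "jump G D' \<phi> ?c1 = side_jump G pos (\<phi> (i, cis u1))"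
      by (simp add: jump_eq_side_jump pos_def)
    have step: "\<phi> (i, cis m) s = x s \<otimes>\<^bsub>G\<^esub> side_jump G pos (\<phi> (i, cis u1))" for s
      unfolding x_def jump[symmetric]
      by (rule coloring_jump[OF that(1) links(2) that(2) c(1) SD'(1) t(1) m(1)])
        (use m t in \<open>auto dest!: under[rotated 2]\<close>)
    \<comment> \<open>If the upper preimage comes first, it carries the incoming value; otherwise it
      carries the outgoing one and the fixed-point equation resolves the circularity.\<close>
    have "side_jump G pos (\<phi> (i, cis u1)) = side_jump G pos x"
    proof (cases "u1 < t1")
      case True
      then show ?thesis using before[OF that(2), of u1] u by (simp add: x_def)
    next
      case False
      then have "\<phi> (i, cis u1) = \<phi> (i, cis m)" using middle[OF that(2), of u1] u by simp
      then show ?thesis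
        using side_jump_fixed_point[of x "\<phi> (i, cis m)" pos, OF x y] step by simp
    qed
    with jump step show "\<phi> (i, cis m) = (\<lambda>s. \<phi> (i, cis a) s \<otimes>\<^bsub>G\<^esub> side_jump G pos (\<phi> (i, cis a)))"
      "jump G D' \<phi> ?c1 = side_jump G pos (\<phi> (i, cis a))"
      by (simp_all add: x_def fun_eq_iff)
  qed
  show ?thesis
  proof (rule heap_group_iso_of_extensions)
    fix G :: "heap_monoid" and \<phi>
    assume "group G" and \<phi>: "coloring G D \<phi>"
    interpret group G by fact
    define x where "x = \<phi> (i, cis a)"
    have x: "x s \<in> carrier G" for s
      using coloring_closed[OF \<phi>] end_points_outer(3)[OF S] by (auto simp: x_def)
    define J where "J = side_jump G pos x"
    have J: "J \<in> carrier G" unfolding J_def using x by (rule side_jump_closed)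
    have x': "x = \<phi> (i, cis b)"
      unfolding x_def using crossingless_constant[OF no_crossings \<phi> S, of b] SD by simp
    define y where "y = (\<lambda>s. x s \<otimes>\<^bsub>G\<^esub> J)"
    have y: "y s \<in> carrier G" for s using x J by (simp add: y_def)
    have jump_y: "side_jump G b y = side_jump G b x" for b
      unfolding y_def J_def using x by (rule side_jump_mult_own)
    define w where "w = (\<lambda>_ :: strand. step t1 t2 x y x)"
    \<comment> \<open>All three pieces have the same side jumps, so the positions of the upper
      preimages among them have no influence on the jumps.\<close>
    have "side_jump G p (extension \<phi> w (i, cis u)) = side_jump G p x" if "a < u" "u < b" for p u
      by (simp add: extension_inner[OF S that] w_def step_def jump_y)
    then have "side_jump G p (extension \<phi> w (i, cis u1)) = side_jump G p x"
        "side_jump G p (extension \<phi> w (i, cis u2)) = side_jump G p x" for p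
      using u t by simp_all
    then have jumps: "jump G D' (extension \<phi> w) ?c1 = J" "jump G D' (extension \<phi> w) ?c2 = inv\<^bsub>G\<^esub> J"
      by (simp_all add: jump_eq_side_jump pos_def[symmetric] pos2 J_def side_jump_Not x)
    have "coloring G D' (extension \<phi> w)"
    proof (rule coloring_extension[OF \<phi>])
      fix k e f
      assume "(k, e, f) \<in> {?S}"
      then have kef: "k = i" "e = a" "f = b" by auto
      show "\<forall>\<^sub>F u in at_right e. w (k, e, f) u = \<phi> (k, cis e)"
        using step_near(5)[OF t(2,1)] by (simp add: kef w_def x_def[symmetric])
      show "\<forall>\<^sub>F u in at_left f. w (k, e, f) u = \<phi> (k, cis f)"
        using step_near(6)[OF t(2,3)] by (simp add: kef w_def x'[symmetric])
      fix t assume ef: "e < t" "t < f"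
      show "w (k, e, f) t s \<in> carrier G" for s
        by (simp add: w_def step_def x y)
      show "\<forall>\<^sub>F u in at t. w (k, e, f) u = w (k, e, f) t" if "(k, cis t) \<notin> under_points D'"
      proof -
        have "t \<noteq> t1" "t \<noteq> t2" using that crossing_facts(3)[OF links(2)] c kef by auto
        then show ?thesis unfolding w_def using t by (intro step_locally_constant) auto
      qed
      fix q assume q: "((k, cis t), q) \<in> crossings_within D' {?S}"
      consider "t = t1" "q = (i, cis u1)" | "t = t2" "q = (i, cis u2)"
        using angle[of t q] ef q kef by auto
      then show "\<exists>x z. (\<forall>\<^sub>F u in at_left t. w (k, e, f) u = x) \<and>
          (\<forall>\<^sub>F u in at_right t. w (k, e, f) u = z) \<and>
          (\<forall>s. z s = x s \<otimes>\<^bsub>G\<^esub> jump G D' (extension \<phi> w) ((k, cis t), q))"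
      proof cases
        case 1
        then show ?thesis using step_near(1,2)[OF \<open>t1 < t2\<close>] jumps(1)
          by (intro exI[of _ x] exI[of _ y]) (auto simp: kef w_def y_def)
      next
        case 2
        then show ?thesis using step_near(3,4)[OF \<open>t1 < t2\<close>] jumps(2)
          by (intro exI[of _ y] exI[of _ x]) (auto simp: kef w_def y_def m_assoc x J)
      qed
    qed
    then show "\<exists>\<phi>'. coloring G D' \<phi>' \<and> (\<forall>p. p \<notin> Inn \<longrightarrow> \<phi>' p = \<phi> p)"
      using extension_outer by blast
  next
    fix G :: "heap_monoid" and \<phi>
    assume "group G" and \<phi>: "coloring G D' \<phi>"
    interpret group G by fact
    define x where "x = \<phi> (i, cis a)"
    define y where "y = \<phi> (i, cis m)"
    define z where "z = \<phi> (i, cis b)"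
    have x: "x s \<in> carrier G" and z: "z s \<in> carrier G" for s
      using coloring_closed[OF \<phi>] sym.end_points_outer(3,4)[OF S] by (auto simp: x_def z_def)
    have y_eq: "y = (\<lambda>s. x s \<otimes>\<^bsub>G\<^esub> side_jump G pos x)"
      unfolding x_def y_def by (rule first_jump[OF \<open>group G\<close> \<phi>])
    then have y: "y s \<in> carrier G" for s using x side_jump_closed[OF x] by simp
    have jump_y: "side_jump G b y = side_jump G b x" for b
      unfolding y_eq using x by (rule side_jump_mult_own)
    have jump2: "jump G D' \<phi> ?c2 = side_jump G (\<not> pos) (\<phi> (i, cis u2))"
      by (simp add: jump_eq_side_jump pos2)
    have step: "z s = y s \<otimes>\<^bsub>G\<^esub> side_jump G (\<not> pos) (\<phi> (i, cis u2))" for s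
      unfolding y_def z_def jump2[symmetric]
      by (rule coloring_jump[OF \<open>group G\<close> links(2) \<phi> c(2) SD'(1) m(2) t(3)])
        (use m t in \<open>auto dest!: under[rotated 2]\<close>)
    \<comment> \<open>The same alternative at the second kink, now with incoming value
      \<open>y\<close> and outgoing value \<open>z\<close>.\<close>
    have "side_jump G (\<not> pos) (\<phi> (i, cis u2)) = side_jump G (\<not> pos) y"
    proof (cases "u2 < t2")
      case True
      then show ?thesis using middle[OF \<phi>, of u2] u by (simp add: y_def)
    next
      case False
      then have "\<phi> (i, cis u2) = z" using after[OF \<phi>, of u2] u by (simp add: z_def)
      then show ?thesis
        using side_jump_fixed_point[of y z "\<not> pos", OF y z] step by simp
    qed
    then have "z s = x s" for s
      using step[of s] jump_y x side_jump_closed[OF x] side_jump_Not[OF x]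
      by (simp add: y_eq m_assoc)
    then have z_eq: "z = x" by (intro ext)
    then show "\<exists>\<phi>'. coloring G D \<phi>' \<and> (\<forall>p. p \<notin> Inn \<longrightarrow> \<phi>' p = \<phi> p)"
      by (intro sym.crossingless_extension[OF no_crossings \<phi>]) (auto simp: x_def z_def)
  next
    fix G :: "heap_monoid" and \<phi> \<psi> p
    assume "group G" and \<phi>: "coloring G D \<phi>" and \<psi>: "coloring G D \<psi>"
      and outer: "\<And>p. p \<in> arc_points D \<Longrightarrow> p \<notin> Inn \<Longrightarrow> \<phi> p = \<psi> p"
      and p: "p \<in> Inn"
    show "\<phi> p = \<psi> p"
      by (rule crossingless_colorings_agree[OF no_crossings \<phi> \<psi> outer p])
  next
    fix G :: "heap_monoid" and \<phi> \<psi> p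
    assume "group G" and \<phi>: "coloring G D' \<phi>" and \<psi>: "coloring G D' \<psi>"
      and outer: "\<And>p. p \<in> arc_points D' \<Longrightarrow> p \<notin> Inn \<Longrightarrow> \<phi> p = \<psi> p"
      and p: "p \<in> Inn" "p \<notin> under_points D'"
    have ends: "\<phi> (i, cis a) = \<psi> (i, cis a)" "\<phi> (i, cis b) = \<psi> (i, cis b)"
      using outer sym.end_points_outer[OF S] by blast+
    obtain k e f \<tau> where \<tau>: "(k, e, f) \<in> {?S}" "e < \<tau>" "\<tau> < f" "p = (k, cis \<tau>)"
      by (rule Inn_cases[OF p(1)])
    then have \<tau>': "a < \<tau>" "\<tau> < b" "p = (i, cis \<tau>)" by auto
    then have "\<tau> \<noteq> t1" "\<tau> \<noteq> t2"
      using p(2) crossing_facts(3)[OF links(2)] c by auto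
    moreover have "jump G D' \<phi> ?c1 = jump G D' \<psi> ?c1"
      using jump1[OF \<open>group G\<close> \<phi>] jump1[OF \<open>group G\<close> \<psi>] ends by simp
    ultimately show "\<phi> p = \<psi> p"
      using colorings_agree2[OF \<open>group G\<close> links(2) \<phi> \<psi> SD'(1) \<tau>'(1,2) t(1,2) under ends _ _ c(1)] \<tau>'(3)
      by blast
  qed
qed

text \<open>In each kink either angle may be the lower one. After renaming, \<open>u1\<close>,
  \<open>u2\<close> are the lower and \<open>v1\<close>, \<open>v2\<close> the upper angles, and the
  separation of the kinks along the strand gives the inequalities.\<close>

lemma insert_cancelling_kinks_heap_group:
  assumes "link_diagram D" "link_diagram D'" "insert_cancelling_kinks D D'"
  shows "heap_group D \<cong> heap_group D'"
proof -
  obtain i a b t1 t2 t3 t4 c c' where k: "local_change D D' {(i, a, b)}"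
    "crossings_within D {(i, a, b)} = {}" "a < t1" "t1 < t2" "t2 < t3" "t3 < t4" "t4 < b"
    "crossings_within D' {(i, a, b)} = {c, c'}"
    "c \<in> {((i, cis t1), (i, cis t2)), ((i, cis t2), (i, cis t1))}"
    "c' \<in> {((i, cis t3), (i, cis t4)), ((i, cis t4), (i, cis t3))}"
    "crossing_sign D' c = - crossing_sign D' c'"
    using assms(3) unfolding insert_cancelling_kinks_def by blast
  obtain u1 v1 where 1: "c = ((i, cis u1), (i, cis v1))" "{u1, v1} = {t1, t2}" "u1 \<noteq> v1"
    using k(4,9) by fastforce
  obtain u2 v2 where 2: "c' = ((i, cis u2), (i, cis v2))" "{u2, v2} = {t3, t4}" "u2 \<noteq> v2"
    using k(6,10) by fastforce
  have "u1 = t1 \<and> v1 = t2 \<or> u1 = t2 \<and> v1 = t1" "u2 = t3 \<and> v2 = t4 \<or> u2 = t4 \<and> v2 = t3"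
    using 1(2) 2(2) by (auto simp: doubleton_eq_iff)
  then have "a < u1" "u1 < u2" "u2 < b" "a < v1" "v1 < u2" "u1 < v2" "v2 < b"
    using k(3-7) by auto
  then show ?thesis
    using cancelling_kinks_ordered[OF assms(1,2) k(1,2), of u1 u2 v1 v2] k(8,11) 1 2 by auto
qed

section \<open>Reidemeister moves of type III\<close>

text \<open>The position data of \<open>triangle\<close> without its turning conditions, together
  with the distinctness of the two angles on the middle and on the bottom strand.\<close>

definition three_crossings where
  "three_crossings D T M U tm tu mt mu ut um \<longleftrightarrow>
     (let (i, a, b) = T; (j, c, d) = M; (k, e, f) = U
      in a < tm \<and> tm < b \<and> a < tu \<and> tu < b \<and> c < mt \<and> mt < d \<and> c < mu \<and> mu < d \<and>
        e < ut \<and> ut < f \<and> e < um \<and> um < f \<and> mt \<noteq> mu \<and> ut \<noteq> um \<and>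
        crossings_within D {T, M, U} =
          {((j, cis mt), (i, cis tm)), ((k, cis ut), (i, cis tu)), ((k, cis um), (j, cis mu))})"

text \<open>Describes one of the two diagrams of the move, so that it can be instantiated for either
  of them.\<close>

locale triple_point_move =
  local_move D D' "{(i, a, b), (j, c, d), (k, e, f)}" for D D' i a b j c d k e f +
  fixes tm tu mt mu ut um :: real
  assumes distinct_strands: "(i, a, b) \<noteq> (j, c, d)" "(i, a, b) \<noteq> (k, e, f)" "(j, c, d) \<noteq> (k, e, f)"
    and three: "three_crossings D (i, a, b) (j, c, d) (k, e, f) tm tu mt mu ut um"
begin

abbreviation "T \<equiv> (i, a, b)"
abbreviation "M \<equiv> (j, c, d)"
abbreviation "U \<equiv> (k, e, f)"
abbreviation "MT \<equiv> ((j, cis mt), (i, cis tm))"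
abbreviation "UT \<equiv> ((k, cis ut), (i, cis tu))"
abbreviation "UM \<equiv> ((k, cis um), (j, cis mu))"

lemma TMU: "T \<in> {T, M, U}" "M \<in> {T, M, U}" "U \<in> {T, M, U}"
  by auto

lemma bounds: "a < tm" "tm < b" "a < tu" "tu < b" "c < mt" "mt < d" "c < mu" "mu < d"
    "e < ut" "ut < f" "e < um" "um < f" "mt \<noteq> mu" "ut \<noteq> um"
  using three by (simp_all add: three_crossings_def)

lemma crossings_within_eq: "crossings_within D {T, M, U} =
    {MT, UT, UM}"
  using three by (simp add: three_crossings_def)

lemma in_crossings: "MT \<in> crossings D"
    "UT \<in> crossings D" "UM \<in> crossings D"
  using crossings_within_eq by (auto simp: crossings_within_def)

lemma angle:
  assumes "(r, x, y) \<in> {T, M, U}" "x \<le> t" "t \<le> y" "((r, cis t), q) \<in> crossings_within D {T, M, U}"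
  shows "(r, x, y) = M \<and> t = mt \<and> q = (i, cis tm) \<or> (r, x, y) = U \<and> t = ut \<and> q = (i, cis tu) \<or>
    (r, x, y) = U \<and> t = um \<and> q = (j, cis mu)"
proof -
  consider "(j, cis mt) = (r, cis t)" "q = (i, cis tm)" | "(k, cis ut) = (r, cis t)" "q = (i, cis tu)"
    | "(k, cis um) = (r, cis t)" "q = (j, cis mu)"
    using assms(4) unfolding crossings_within_eq by auto
  then show ?thesis
    using strand_unique[OF TMU(2) _ _ assms(1-3), of mt] strand_unique[OF TMU(3) _ _ assms(1-3), of ut]
      strand_unique[OF TMU(3) _ _ assms(1-3), of um] bounds
    by cases auto
qed

lemma under_angle:
  assumes "(r, x, y) \<in> {T, M, U}" "x \<le> t" "t \<le> y" "(r, cis t) \<in> under_points D"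
  shows "(r, x, y) = M \<and> t = mt \<or> (r, x, y) = U \<and> (t = ut \<or> t = um)"
proof -
  obtain q where "((r, cis t), q) \<in> crossings_within D {T, M, U}"
    using under_crossing_within[OF assms] .
  then show ?thesis using angle[OF assms(1-3)] by blast
qed

lemma not_under_T: "a \<le> t \<Longrightarrow> t \<le> b \<Longrightarrow> (i, cis t) \<notin> under_points D"
  using under_angle[OF TMU(1)] distinct_strands by blast

lemma under_M: "c \<le> t \<Longrightarrow> t \<le> d \<Longrightarrow> (j, cis t) \<in> under_points D \<Longrightarrow> t = mt"
  using under_angle[OF TMU(2)] distinct_strands by blast

lemma under_U: "e \<le> t \<Longrightarrow> t \<le> f \<Longrightarrow> (k, cis t) \<in> under_points D \<Longrightarrow> t = ut \<or> t = um"
  using under_angle[OF TMU(3)] distinct_strands by blast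

lemma under_points: "(j, cis mt) \<in> under_points D" "(k, cis ut) \<in> under_points D"
    "(k, cis um) \<in> under_points D"
  using crossing_facts(3)[OF link(1)] in_crossings by blast+

text \<open>Uniqueness propagates downwards: the top strand has no under-crossing, the middle strand
  one, the bottom strand two. The jumps on the bottom strand are already known from the values on
  the upper two.\<close>

lemma colorings_agree:
  assumes "group G" and \<phi>: "coloring G D \<phi>" and \<psi>: "coloring G D \<psi>"
    and outer: "\<And>p. p \<in> arc_points D \<Longrightarrow> p \<notin> Inn \<Longrightarrow> \<phi> p = \<psi> p"
    and p: "p \<in> Inn" "p \<notin> under_points D"
  shows "\<phi> p = \<psi> p"
proof -
  have ends: "\<phi> (r, cis x) = \<psi> (r, cis x)" "\<phi> (r, cis y) = \<psi> (r, cis y)"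
    if "(r, x, y) \<in> {T, M, U}" for r x y
    using outer end_points_outer[OF that] by blast+
  have T: "\<phi> (i, cis t) = \<psi> (i, cis t)" if "a < t" "t < b" for t
    using colorings_agree0[OF \<phi> \<psi> strandD(1)[OF TMU(1)] that not_under_T ends(1)[OF TMU(1)]] .
  have M: "\<phi> (j, cis t) = \<psi> (j, cis t)" if "c < t" "t < d" "t \<noteq> mt" for t
    using colorings_agree1[OF \<phi> \<psi> strandD(1)[OF TMU(2)] that(1,2) under_M ends[OF TMU(2)] that(3)] .
  have jumps: "jump G D \<phi> UT = jump G D \<psi> UT"
    "jump G D \<phi> UM = jump G D \<psi> UM"
    using T[of tu] M[of mu] bounds by (simp_all add: jump_eq_side_jump)
  have U: "\<phi> (k, cis t) = \<psi> (k, cis t)" if "e < t" "t < f" "t \<noteq> ut" "t \<noteq> um" for t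
  proof (cases "ut < um")
    case True
    show ?thesis
      by (rule colorings_agree2[OF assms(1) link(1) \<phi> \<psi> strandD(1)[OF TMU(3)] that(1,2) bounds(9) True
            under_U ends[OF TMU(3)] that(3,4) in_crossings(2) jumps(1)])
  next
    case False
    then have "um < ut" using bounds by simp
    show ?thesis
      by (rule colorings_agree2[OF assms(1) link(1) \<phi> \<psi> strandD(1)[OF TMU(3)] that(1,2)
            bounds(11) \<open>um < ut\<close> _ ends[OF TMU(3)] that(4,3) in_crossings(3) jumps(2)]) (use under_U in blast)
  qed
  obtain r x y t where t: "(r, x, y) \<in> {T, M, U}" "x < t" "t < y" "p = (r, cis t)"
    by (rule Inn_cases[OF p(1)])
  then consider "(r, x, y) = T" | "(r, x, y) = M" "t \<noteq> mt" | "(r, x, y) = U" "t \<noteq> ut" "t \<noteq> um"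
    using p(2) under_points by blast
  then show ?thesis
    using T M U t by cases auto
qed

end

text \<open>Here \<open>v\<close> and \<open>u\<close> are the values on the middle strand before and after it passes below the top
  strand, and \<open>A\<close> is the jump across the top strand.\<close>

lemma (in group) side_jump_conjugate:
  assumes "\<And>s. v s \<in> carrier G" "A \<in> carrier G" "u = (\<lambda>s. v s \<otimes> A)"
  shows "A \<otimes> side_jump G p u = side_jump G p v \<otimes> A"
    and "inv A \<otimes> side_jump G p v = side_jump G p u \<otimes> inv A"
proof -
  have v: "side_jump G p v \<in> carrier G" using assms(1) by (rule side_jump_closed)
  have u: "side_jump G p u = inv A \<otimes> side_jump G p v \<otimes> A"
    unfolding assms(3) by (rule side_jump_mult) (use assms in auto)
  show "A \<otimes> side_jump G p u = side_jump G p v \<otimes> A"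
    using v assms(2) by (simp add: u m_assoc[symmetric])
  show "inv A \<otimes> side_jump G p v = side_jump G p u \<otimes> inv A"
    using v assms(2) by (simp add: u m_assoc)
qed

text \<open>The assumption \<open>turning\<close> links the jumps that the middle and the bottom
  strand undergo below the top strand: equal when the strands meet their two crossings in
  corresponding order, inverse otherwise.\<close>

locale reidemeister3_move =
  triple_point_move D D' i a b j c d k e f tm tu mt mu ut um +
  new: triple_point_move D' D i a b j c d k e f tm' tu' mt' mu' ut' um'
  for D D' i a b j c d k e f tm tu mt mu ut um tm' tu' mt' mu' ut' um' +
  assumes reversed: "mt' < mu' \<longleftrightarrow> mu < mt" "ut' < um' \<longleftrightarrow> um < ut"
    and signs: "crossing_sign D' ((j, cis mt'), (i, cis tm')) =
        crossing_sign D ((j, cis mt), (i, cis tm))"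
      "crossing_sign D' ((k, cis ut'), (i, cis tu')) = crossing_sign D ((k, cis ut), (i, cis tu))"
      "crossing_sign D' ((k, cis um'), (j, cis mu')) = crossing_sign D ((k, cis um), (j, cis mu))"
    and turning: "(crossing_sign D ((j, cis mt), (i, cis tm)) < 0) =
        (crossing_sign D ((k, cis ut), (i, cis tu)) < 0) \<longleftrightarrow> (ut < um \<longleftrightarrow> mt < mu)"
begin

text \<open>The end values of the bottom strand force its total jump to be the same before and after
  the move. The jump \<open>E\<close> across the top strand is unchanged, while the jump across the
  middle strand is taken at its other half, so the claim is \<open>E B = B' E\<close> or
  \<open>B E = E B'\<close>.\<close>

lemma coloring_extends:
  fixes G :: "('g, 'm) monoid_scheme"
  assumes "group G" and \<phi>: "coloring G D \<phi>"
  shows "\<exists>\<phi>'. coloring G D' \<phi>' \<and> (\<forall>p. p \<notin> Inn \<longrightarrow> \<phi>' p = \<phi> p)"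
proof -
  interpret group G by fact
  note SD = strandD[OF TMU(1)] strandD[OF TMU(2)] strandD[OF TMU(3)]
  define x where "x = \<phi> (i, cis a)"
  define m1 where "m1 = \<phi> (j, cis c)"
  define m2 where "m2 = \<phi> (j, cis d)"
  define u1 where "u1 = \<phi> (k, cis e)"
  define u3 where "u3 = \<phi> (k, cis f)"
  have closed: "x s \<in> carrier G" "m1 s \<in> carrier G" "m2 s \<in> carrier G"
    "u1 s \<in> carrier G" "u3 s \<in> carrier G" for s
    using coloring_closed[OF \<phi>] end_points_outer(3,4)[OF TMU(1)] end_points_outer(3,4)[OF TMU(2)]
      end_points_outer(3,4)[OF TMU(3)]
    by (auto simp: x_def m1_def m2_def u1_def u3_def)
  define pM where "pM \<longleftrightarrow> crossing_sign D MT < 0"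
  define pU where "pU \<longleftrightarrow> crossing_sign D UT < 0"
  define pB where "pB \<longleftrightarrow> crossing_sign D UM < 0"
  define A where "A = side_jump G pM x"
  define E where "E = side_jump G pU x"
  \<comment> \<open>The middle strand carries \<open>m1\<close> before and \<open>m2\<close> after
    passing below the top strand; \<open>B\<close> and \<open>B'\<close> use the half that lies
    above the bottom strand in \<open>D\<close> and \<open>D'\<close>.\<close>
  define B where "B = side_jump G pB (if mu < mt then m1 else m2)"
  define B' where "B' = side_jump G pB (if mu' < mt' then m1 else m2)"
  have closed_jumps: "A \<in> carrier G" "E \<in> carrier G" "B \<in> carrier G" "B' \<in> carrier G"
    unfolding A_def E_def B_def B'_def using closed by (auto intro: side_jump_closed)
  have T: "\<phi> (i, cis t) = x" if "a \<le> t" "t \<le> b" for t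
    unfolding x_def by (rule coloring_constant[OF \<phi> SD(1), of a _ b]) (use that SD not_under_T in auto)
  have M: "\<phi> (j, cis mu) = (if mu < mt then m1 else m2)"
  proof (cases "mu < mt")
    case True
    have "\<phi> (j, cis mu) = \<phi> (j, cis c)"
      by (rule coloring_constant[OF \<phi> SD(4), of c _ mu])
        (use True bounds in \<open>auto dest!: under_M[rotated 2]\<close>)
    then show ?thesis using True by (simp add: m1_def)
  next
    case False
    have "\<phi> (j, cis mu) = \<phi> (j, cis d)"
      by (rule coloring_constant[OF \<phi> SD(4), of mu _ d])
        (use False bounds in \<open>auto dest!: under_M[rotated 2]\<close>)
    then show ?thesis using False by (simp add: m2_def)
  qed
  have jumps: "jump G D \<phi> MT = A" "jump G D \<phi> UT = E"
    "jump G D \<phi> UM = B"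
    using bounds by (simp_all add: jump_eq_side_jump pM_def pU_def pB_def A_def E_def B_def M T)
  have m2: "m2 = (\<lambda>s. m1 s \<otimes>\<^bsub>G\<^esub> A)"
  proof
    show "m2 s = m1 s \<otimes>\<^bsub>G\<^esub> A" for s
      unfolding m1_def m2_def jumps(1)[symmetric]
      by (rule coloring_jump[OF \<open>group G\<close> link(1) \<phi> in_crossings(1) SD(4) bounds(5,6)])
        (use under_M in blast)
  qed
  define n where "n = (ut + um) / 2"
  have u3: "u3 s = (if ut < um then u1 s \<otimes>\<^bsub>G\<^esub> E \<otimes>\<^bsub>G\<^esub> B else u1 s \<otimes>\<^bsub>G\<^esub> B \<otimes>\<^bsub>G\<^esub> E)" for s
  proof (cases "ut < um")
    case True
    have n: "ut < n" "n < um" using True by (auto simp: n_def)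
    have "\<phi> (k, cis n) s = u1 s \<otimes>\<^bsub>G\<^esub> E"
      unfolding u1_def jumps(2)[symmetric]
      by (rule coloring_jump[OF \<open>group G\<close> link(1) \<phi> in_crossings(2) SD(7) bounds(9) n(1)])
        (use n bounds in \<open>auto dest!: under_U[rotated 2]\<close>)
    moreover have "u3 s = \<phi> (k, cis n) s \<otimes>\<^bsub>G\<^esub> B"
      unfolding u3_def jumps(3)[symmetric]
      by (rule coloring_jump[OF \<open>group G\<close> link(1) \<phi> in_crossings(3) SD(7) n(2) bounds(12)])
        (use n bounds in \<open>auto dest!: under_U[rotated 2]\<close>)
    ultimately show ?thesis using True by simp
  next
    case False
    have n: "um < n" "n < ut" using False bounds by (auto simp: n_def)
    have "\<phi> (k, cis n) s = u1 s \<otimes>\<^bsub>G\<^esub> B"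
      unfolding u1_def jumps(3)[symmetric]
      by (rule coloring_jump[OF \<open>group G\<close> link(1) \<phi> in_crossings(3) SD(7) bounds(11) n(1)])
        (use n bounds in \<open>auto dest!: under_U[rotated 2]\<close>)
    moreover have "u3 s = \<phi> (k, cis n) s \<otimes>\<^bsub>G\<^esub> E"
      unfolding u3_def jumps(2)[symmetric]
      by (rule coloring_jump[OF \<open>group G\<close> link(1) \<phi> in_crossings(2) SD(7) n(2) bounds(10)])
        (use n bounds in \<open>auto dest!: under_U[rotated 2]\<close>)
    ultimately show ?thesis using False by simp
  qed
  have E: "E = (if ut < um \<longleftrightarrow> mt < mu then A else inv\<^bsub>G\<^esub> A)"
  proof -
    have "pU = (if ut < um \<longleftrightarrow> mt < mu then pM else \<not> pM)"
      using turning unfolding pM_def pU_def by auto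
    then show ?thesis using side_jump_Not[OF closed(1), of pM] by (simp add: E_def A_def)
  qed
  have order: "mu' < mt' \<longleftrightarrow> mt < mu" "um' < ut' \<longleftrightarrow> ut < um"
    using reversed bounds new.bounds by linarith+
  have u3': "u3 s = (if ut' < um' then u1 s \<otimes>\<^bsub>G\<^esub> E \<otimes>\<^bsub>G\<^esub> B' else u1 s \<otimes>\<^bsub>G\<^esub> B' \<otimes>\<^bsub>G\<^esub> E)" for s
  proof -
    note conj = side_jump_conjugate[OF closed(2) closed_jumps(1) m2, of pB]
    \<comment> \<open>\<open>E\<close> is \<open>A\<close> or its inverse, and \<open>B\<close>,
      \<open>B'\<close> are the side jumps of \<open>m1\<close> and \<open>m2\<close> in one order
      or the other. In each case the choice of \<open>E\<close> fits one of the two conjugation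
      identities.\<close>
    have "mt < mu \<longleftrightarrow> \<not> mu < mt" "ut < um \<longleftrightarrow> \<not> um < ut" using bounds by linarith+
    then have "ut < um \<Longrightarrow> E \<otimes>\<^bsub>G\<^esub> B = B' \<otimes>\<^bsub>G\<^esub> E" "um < ut \<Longrightarrow> B \<otimes>\<^bsub>G\<^esub> E = E \<otimes>\<^bsub>G\<^esub> B'"
      unfolding E B_def B'_def order by (auto simp: conj)
    then show ?thesis
      using u3[of s] reversed(2) bounds(14) closed closed_jumps by (auto simp: m_assoc)
  qed
  \<comment> \<open>The first jump met along the bottom strand in the new diagram; its value there
    is determined by it.\<close>
  define K where "K = (if ut' < um' then E else B')"
  have K: "K \<in> carrier G" using closed_jumps by (simp add: K_def)
  define v1 where "v1 = min ut' um'"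
  define v2 where "v2 = max ut' um'"
  have v: "e < v1" "v1 < v2" "v2 < f" using new.bounds by (auto simp: v1_def v2_def)
  \<comment> \<open>The middle strand has one under-crossing, so the second break of
    \<open>step\<close> is a dummy placed anywhere between it and the end.\<close>
  define h where "h = (mt' + d) / 2"
  have h: "mt' < h" "h < d" using new.bounds by (auto simp: h_def)
  define w where "w S = (if S = T then (\<lambda>_. x) else if S = M then step mt' h m1 m2 m2
    else step v1 v2 u1 (\<lambda>s. u1 s \<otimes>\<^bsub>G\<^esub> K) u3)" for S
  have w: "w T = (\<lambda>_. x)" "w M = step mt' h m1 m2 m2" "w U = step v1 v2 u1 (\<lambda>s. u1 s \<otimes>\<^bsub>G\<^esub> K) u3"
    using distinct_strands by (auto simp: w_def)
  have ext: "extension \<phi> w (i, cis tm') = x" "extension \<phi> w (i, cis tu') = x"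
    "extension \<phi> w (j, cis mu') = (if mu' < mt' then m1 else m2)"
    using new.bounds by (simp_all add: extension_inner[OF TMU(1)] extension_inner[OF TMU(2)] w step_def)
  have new_jumps: "jump G D' (extension \<phi> w) new.MT = A"
    "jump G D' (extension \<phi> w) new.UT = E"
    "jump G D' (extension \<phi> w) new.UM = B'"
    by (simp_all add: jump_eq_side_jump signs ext pM_def pU_def pB_def A_def E_def B'_def)
  have "coloring G D' (extension \<phi> w)"
  proof (rule coloring_extension[OF \<phi>])
    fix r p q
    assume rpq: "(r, p, q) \<in> {T, M, U}"
    then consider "(r, p, q) = T" | "(r, p, q) = M" | "(r, p, q) = U" by blast
    note cases = this
    show "\<forall>\<^sub>F u in at_right p. w (r, p, q) u = \<phi> (r, cis p)"
      by (cases rule: cases)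
        (use step_near(5)[OF h(1) new.bounds(5)] step_near(5)[OF v(2,1)] in
          \<open>auto simp: w x_def m1_def u1_def\<close>)
    show "\<forall>\<^sub>F u in at_left q. w (r, p, q) u = \<phi> (r, cis q)"
      by (cases rule: cases)
        (use step_near(6)[OF h] step_near(6)[OF v(2,3)] SD T[of b] in \<open>auto simp: w m2_def u3_def\<close>)
    fix t assume t: "p < t" "t < q"
    show "w (r, p, q) t s \<in> carrier G" for s
      by (cases rule: cases) (auto simp: w step_def closed K)
    show "\<forall>\<^sub>F u in at t. w (r, p, q) u = w (r, p, q) t" if "(r, cis t) \<notin> under_points D'"
    proof (cases rule: cases)
      case 1
      then show ?thesis by (simp add: w)
    next
      case 2
      then have "t \<noteq> mt'" using that new.under_points by auto
      then show ?thesis using h by (simp add: 2 w step_locally_constant)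
    next
      case 3
      then have "t \<noteq> v1" "t \<noteq> v2"
        using that new.under_points by (auto simp: v1_def v2_def min_def max_def)
      then show ?thesis using v by (simp add: 3 w step_locally_constant)
    qed
    fix y assume y: "((r, cis t), y) \<in> crossings_within D' {T, M, U}"
    consider "(r, p, q) = M" "t = mt'" "y = (i, cis tm')" | "(r, p, q) = U" "t = ut'" "y = (i, cis tu')"
      | "(r, p, q) = U" "t = um'" "y = (j, cis mu')"
      using new.angle[OF rpq less_imp_le[OF t(1)] less_imp_le[OF t(2)] y] by blast
    then show "\<exists>x z. (\<forall>\<^sub>F u in at_left t. w (r, p, q) u = x) \<and> (\<forall>\<^sub>F u in at_right t. w (r, p, q) u = z) \<and>
        (\<forall>s. z s = x s \<otimes>\<^bsub>G\<^esub> jump G D' (extension \<phi> w) ((r, cis t), y))"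
    proof cases
      case 1
      then show ?thesis
        using step_near(1,2)[OF h(1)] new_jumps(1) m2
        by (intro exI[of _ m1] exI[of _ m2]) (auto simp: w)
    next
      case 2
      show ?thesis
      proof (cases "ut' < um'")
        case True
        then have "v1 = ut'" by (simp add: v1_def)
        then show ?thesis using step_near(1,2)[OF v(2)] 2 new_jumps(2) True
          by (intro exI[of _ u1] exI[of _ "\<lambda>s. u1 s \<otimes>\<^bsub>G\<^esub> K"]) (auto simp: w K_def)
      next
        case False
        then have "v2 = ut'" by (simp add: v2_def)
        then show ?thesis using step_near(3,4)[OF v(2)] 2 new_jumps(2) False u3'
          by (intro exI[of _ "\<lambda>s. u1 s \<otimes>\<^bsub>G\<^esub> K"] exI[of _ u3]) (auto simp: w K_def)
      qed
    next
      case 3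
      show ?thesis
      proof (cases "ut' < um'")
        case True
        then have "v2 = um'" by (simp add: v2_def)
        then show ?thesis using step_near(3,4)[OF v(2)] 3 new_jumps(3) True u3'
          by (intro exI[of _ "\<lambda>s. u1 s \<otimes>\<^bsub>G\<^esub> K"] exI[of _ u3]) (auto simp: w K_def)
      next
        case False
        then have "v1 = um'" by (simp add: v1_def)
        then show ?thesis using step_near(1,2)[OF v(2)] 3 new_jumps(3) False
          by (intro exI[of _ u1] exI[of _ "\<lambda>s. u1 s \<otimes>\<^bsub>G\<^esub> K"]) (auto simp: w K_def)
      qed
    qed
  qed
  then show ?thesis using extension_outer by blast
qed

end

section \<open>Signs at the corners of the triangle\<close>

lemma det2_scaleR: "det2 (r *\<^sub>R v) (s *\<^sub>R w) = r * s * det2 v w"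
  by (simp add: det2_def algebra_simps)

lemma opposite_signs_iff:
  assumes "T = 1 \<or> T = - 1" "M = (if P then 1 else - 1)" "U = (if Q then - 1 else 1)"
    and "U * T * - x = T * M * y" "x = 1 \<or> x = - 1" "y = 1 \<or> y = - 1"
  shows "(y < 0) = ((x :: real) < 0) \<longleftrightarrow> (Q \<longleftrightarrow> P)"
  using assms by (cases P; cases Q) auto

text \<open>The equality of the turns at the corners \<open>UT\<close> and \<open>MT\<close>
  compares the signs of two crossings below the top strand. Its direction enters at both corners and
  cancels, leaving the directions of the other two strands.\<close>

lemma triangle_turning:
  assumes "link_diagram D" "triangle D (i, a, b) (j, c, d) (k, e, f) tm tu mt mu ut um"
    and "{(i, cis tm), (i, cis tu)} \<inter> {(j, cis mt), (j, cis mu)} = {}"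
    and "{(i, cis tm), (i, cis tu)} \<inter> {(k, cis ut), (k, cis um)} = {}"
    and "{(j, cis mt), (j, cis mu)} \<inter> {(k, cis ut), (k, cis um)} = {}"
  shows "three_crossings D (i, a, b) (j, c, d) (k, e, f) tm tu mt mu ut um"
    and "(crossing_sign D ((j, cis mt), (i, cis tm)) < 0) =
        (crossing_sign D ((k, cis ut), (i, cis tu)) < 0) \<longleftrightarrow> (ut < um \<longleftrightarrow> mt < mu)"
proof -
  define T_dir where "T_dir = sgn (tm - tu)"
  define M_dir where "M_dir = sgn (mu - mt)"
  define U_dir where "U_dir = sgn (ut - um)"
  note triangle = assms(2)[unfolded triangle_def Let_def prod.case,
      folded T_dir_def M_dir_def U_dir_def]
  have tri: "a < tm" "tm < b" "a < tu" "tu < b" "c < mt" "mt < d" "c < mu" "mu < d"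
    "e < ut" "ut < f" "e < um" "um < f"
    using triangle[THEN conjunct1] triangle[THEN conjunct2, THEN conjunct1]
      triangle[THEN conjunct2, THEN conjunct2, THEN conjunct1] by auto
  have within: "crossings_within D {(i, a, b), (j, c, d), (k, e, f)} =
      {((j, cis mt), (i, cis tm)), ((k, cis ut), (i, cis tu)), ((k, cis um), (j, cis mu))}"
    and turn: "sgn (det2 (U_dir *\<^sub>R velocity D (k, cis ut)) (T_dir *\<^sub>R velocity D (i, cis tu))) =
         sgn (det2 (T_dir *\<^sub>R velocity D (i, cis tm)) (M_dir *\<^sub>R velocity D (j, cis mt)))"
    using triangle[THEN conjunct2, THEN conjunct2, THEN conjunct2, THEN conjunct1]
      triangle[THEN conjunct2, THEN conjunct2, THEN conjunct2, THEN conjunct2, THEN conjunct2] .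
  have cr: "((j, cis mt), (i, cis tm)) \<in> crossings D" "((k, cis ut), (i, cis tu)) \<in> crossings D"
    "((k, cis um), (j, cis mu)) \<in> crossings D"
    using within by (auto simp: crossings_within_def)
  \<comment> \<open>On the middle strand one crossing is passed below and the other above, so they
    cannot be the same point.\<close>
  have "mt \<noteq> mu"
    using crossing_facts(3)[OF assms(1) cr(1)] crossing_facts(4)[OF assms(1) cr(3)] by auto
  \<comment> \<open>An under-point has a unique point above it, and the top and middle strands are
    disjoint.\<close>
  moreover have "ut \<noteq> um"
  proof
    assume "ut = um"
    then have "(i, cis tu) = (j, cis mu)"
      using crossing_unique[OF assms(1) cr(2), of "(j, cis mu)"] cr(3) by simp
    then show False using assms(3) by blast
  qed
  ultimately show "three_crossings D (i, a, b) (j, c, d) (k, e, f) tm tu mt mu ut um"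
    using tri within by (simp add: three_crossings_def)
  \<comment> \<open>Equality would produce a triple point; the inequality makes \<open>T_dir\<close>
    non-zero.\<close>
  have "tm \<noteq> tu"
  proof
    assume "tm = tu"
    then have "curve D (j, cis mt) = curve D (i, cis tm)" "curve D (i, cis tm) = curve D (k, cis ut)"
      using cr by (auto simp: crossings_def)
    moreover have "\<forall>p\<in>points D. \<forall>q\<in>points D. \<forall>r\<in>points D.
        curve D p = curve D q \<and> curve D q = curve D r \<longrightarrow> p = q \<or> q = r \<or> p = r"
      using assms(1) unfolding link_diagram_def by blast
    ultimately have "(j, cis mt) = (i, cis tm) \<or> (i, cis tm) = (k, cis ut) \<or> (j, cis mt) = (k, cis ut)"
      using crossing_facts(1,2)[OF assms(1) cr(1)] crossing_facts(1)[OF assms(1) cr(2)] by metis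
    then show False using assms(3-5) by blast
  qed
  then have "T_dir = 1 \<or> T_dir = - 1" by (auto simp: T_dir_def sgn_if)
  moreover have "M_dir = (if mt < mu then 1 else - 1)" "U_dir = (if ut < um then - 1 else 1)"
    using \<open>mt \<noteq> mu\<close> \<open>ut \<noteq> um\<close> by (auto simp: M_dir_def U_dir_def sgn_if)
  moreover have "det2 v w = - det2 w v" for v w by (simp add: det2_def)
  then have "crossing_sign D ((k, cis ut), (i, cis tu)) =
      sgn (- det2 (velocity D (k, cis ut)) (velocity D (i, cis tu)))"
    unfolding crossing_sign_def prod.case by (rule arg_cong)
  \<comment> \<open>The minus sign arises because the triangle is walked from the lower to the upper
    strand at \<open>UT\<close> but from the upper to the lower strand at \<open>MT\<close>, while
    \<open>crossing_sign\<close> always takes the upper strand first.\<close>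
  then have "U_dir * T_dir * - crossing_sign D ((k, cis ut), (i, cis tu)) =
      T_dir * M_dir * crossing_sign D ((j, cis mt), (i, cis tm))"
    using turn unfolding det2_scaleR
    by (simp add: crossing_sign_def sgn_mult T_dir_def M_dir_def U_dir_def)
  ultimately show "(crossing_sign D ((j, cis mt), (i, cis tm)) < 0) =
        (crossing_sign D ((k, cis ut), (i, cis tu)) < 0) \<longleftrightarrow> (ut < um \<longleftrightarrow> mt < mu)"
    using crossing_sign_cases[OF assms(1) cr(1)] crossing_sign_cases[OF assms(1) cr(2)]
    by (intro opposite_signs_iff)
qed

text \<open>The conditions are symmetric under exchanging the two diagrams, so the same extension
  lemma, instantiated twice, serves both directions.\<close>

lemma reidemeister3_heap_group:
  assumes links: "link_diagram D" "link_diagram D'" and "reidemeister3 D D'"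
  shows "heap_group D \<cong> heap_group D'"
proof -
  obtain T M U tm tu mt mu ut um tm' tu' mt' mu' ut' um' where
    ne: "T \<noteq> M" "T \<noteq> U" "M \<noteq> U" and local: "local_change D D' {T, M, U}"
    and triangle: "triangle D T M U tm tu mt mu ut um" "triangle D' T M U tm' tu' mt' mu' ut' um'"
    and reversed: "sgn (mt' - mu') = - sgn (mt - mu)" "sgn (ut' - um') = - sgn (ut - um)"
    and signs: "crossing_sign D' ((fst M, cis mt'), (fst T, cis tm')) =
        crossing_sign D ((fst M, cis mt), (fst T, cis tm))"
      "crossing_sign D' ((fst U, cis ut'), (fst T, cis tu')) =
        crossing_sign D ((fst U, cis ut), (fst T, cis tu))"
      "crossing_sign D' ((fst U, cis um'), (fst M, cis mu')) =
        crossing_sign D ((fst U, cis um), (fst M, cis mu))"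
    using assms(3) unfolding reidemeister3_def by (elim exE conjE)
  obtain i a b j c d k e f where S: "T = (i, a, b)" "M = (j, c, d)" "U = (k, e, f)"
    by (cases T, cases M, cases U)
  let ?S = "{(i, a, b), (j, c, d), (k, e, f)}"
  have "pairwise (\<lambda>S T. disjnt (strand_points S) (strand_points T)) ?S"
    using local[unfolded S local_change_def] by (elim conjE)
  then have disjoint: "strand_points S \<inter> strand_points S' = {}" if "S \<in> ?S" "S' \<in> ?S" "S \<noteq> S'" for S S'
    using that pairwiseD[of _ ?S S S'] by (simp add: disjnt_def)
  have three: "three_crossings E (i, a, b) (j, c, d) (k, e, f) tm tu mt mu ut um"
    "(crossing_sign E ((j, cis mt), (i, cis tm)) < 0) =
      (crossing_sign E ((k, cis ut), (i, cis tu)) < 0) \<longleftrightarrow> (ut < um \<longleftrightarrow> mt < mu)"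
    if E: "link_diagram E" "triangle E T M U tm tu mt mu ut um" for E tm tu mt mu ut um
  proof -
    have mono: "A \<inter> B = {}" if "A \<subseteq> X" "B \<subseteq> Y" "X \<inter> Y = {}" for A B X Y :: "point set"
      using that by blast
    have "{tm, tu} \<subseteq> {a<..<b} \<and> {mt, mu} \<subseteq> {c<..<d} \<and> {ut, um} \<subseteq> {e<..<f}"
      using E(2) unfolding S triangle_def Let_def prod.case by (elim conjE) (intro conjI; assumption)
    then have "{(i, cis tm), (i, cis tu)} \<subseteq> strand_points (i, a, b)"
      "{(j, cis mt), (j, cis mu)} \<subseteq> strand_points (j, c, d)"
      "{(k, cis ut), (k, cis um)} \<subseteq> strand_points (k, e, f)"
      by (auto simp: strand_points_def)
    moreover have "strand_points (i, a, b) \<inter> strand_points (j, c, d) = {}"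
        "strand_points (i, a, b) \<inter> strand_points (k, e, f) = {}"
        "strand_points (j, c, d) \<inter> strand_points (k, e, f) = {}"
      by (rule disjoint; use ne in \<open>simp add: S\<close>)+
    ultimately have "{(i, cis tm), (i, cis tu)} \<inter> {(j, cis mt), (j, cis mu)} = {}"
      "{(i, cis tm), (i, cis tu)} \<inter> {(k, cis ut), (k, cis um)} = {}"
      "{(j, cis mt), (j, cis mu)} \<inter> {(k, cis ut), (k, cis um)} = {}"
      by - (rule mono, assumption, assumption, assumption)+
    from triangle_turning[OF E(1) E(2)[unfolded S] this]
    show "three_crossings E (i, a, b) (j, c, d) (k, e, f) tm tu mt mu ut um"
      "(crossing_sign E ((j, cis mt), (i, cis tm)) < 0) =
        (crossing_sign E ((k, cis ut), (i, cis tu)) < 0) \<longleftrightarrow> (ut < um \<longleftrightarrow> mt < mu)" .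
  qed
  note old = three[OF links(1) triangle(1)] and new = three[OF links(2) triangle(2)]
  have within: "p \<in> \<Union> (inner_strand_points ` ?S) \<and> q \<in> \<Union> (inner_strand_points ` ?S)"
    if "three_crossings E (i, a, b) (j, c, d) (k, e, f) tm tu mt mu ut um"
      "(p, q) \<in> crossings_within E ?S"
    for E tm tu mt mu ut um p q
    using that by (auto simp: three_crossings_def inner_strand_points_def)
  have move: "local_move D D' ?S" "local_move D' D ?S"
    using links local local_change_sym[OF local] within[OF old(1)] within[OF new(1)]
    unfolding S by (unfold_locales; blast)+
  have triple: "triple_point_move D D' i a b j c d k e f tm tu mt mu ut um"
    "triple_point_move D' D i a b j c d k e f tm' tu' mt' mu' ut' um'"
    using move old(1) new(1) ne unfolding S
    by (simp_all add: triple_point_move_def triple_point_move_axioms_def)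
  have "mt \<noteq> mu" "ut \<noteq> um" "mt' \<noteq> mu'" "ut' \<noteq> um'"
    using old(1) new(1) by (simp_all add: three_crossings_def)
  then have order: "mt' < mu' \<longleftrightarrow> mu < mt" "ut' < um' \<longleftrightarrow> um < ut"
    using reversed by (auto simp: sgn_if split: if_splits)
  interpret r: reidemeister3_move D D' i a b j c d k e f tm tu mt mu ut um tm' tu' mt' mu' ut' um'
    using triple order signs old(2) unfolding S
    by (simp add: reidemeister3_move_def reidemeister3_move_axioms_def)
  interpret r': reidemeister3_move D' D i a b j c d k e f tm' tu' mt' mu' ut' um' tm tu mt mu ut um
    using triple order signs new(2) \<open>mt \<noteq> mu\<close> \<open>ut \<noteq> um\<close> \<open>mt' \<noteq> mu'\<close> \<open>ut' \<noteq> um'\<close> unfolding S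
    by (auto simp: reidemeister3_move_def reidemeister3_move_axioms_def)
  show ?thesis
    by (rule r.heap_group_iso_of_extensions, erule (1) r.coloring_extends,
        erule (1) r'.coloring_extends, (rule r.colorings_agree; blast),
        (rule r.new.colorings_agree; blast))
qed

section \<open>Invariance\<close>

lemma fundamental_heap_eq_heap_group:
  assumes "link_diagram D"
  shows "fundamental_heap D \<delta> = heap_group D"
  using fundamental_heap_direction[OF assms, of \<delta> "\<lambda>_. Forward"] by (simp add: fundamental_heap_def)

lemma framed_move_heap_group:
  assumes "framed_move D D'"
  shows "heap_group D \<cong> heap_group D'"
proof -
  have links: "link_diagram D" "link_diagram D'" using assms by (auto simp: framed_move_def)
  show ?thesis
    using assms unfolding framed_move_def
    using same_diagram_heap_group[OF links] reidemeister2_heap_group[OF links]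
      reidemeister3_heap_group[OF links] insert_cancelling_kinks_heap_group[OF links]
      planar_isotopic_heap_group[OF links] iso_refl by metis
qed

lemma same_framed_link_heap_group:
  assumes "same_framed_link D D'"
  shows "heap_group D \<cong> heap_group D'"
  using assms unfolding same_framed_link_def
proof (induction rule: equivclp_induct)
  case (step D' D'')
  have "heap_group D' \<cong> heap_group D''"
    using step.hyps(2) framed_move_heap_group group.iso_sym[OF group_presented_group] by blast
  with step.IH show ?case by (rule iso_trans)
qed (rule iso_refl)

theorem lemma4p2:
  fixes D D' :: diagram
  assumes "link_diagram D" and "link_diagram D'"
  shows "(\<forall>c\<in>crossings D. \<forall>d d'.
            word_eq (strings D) (crossing_relations D d c) =
            word_eq (strings D) (crossing_relations D d' c)) \<and>
         (\<forall>\<delta> \<delta>'. group (fundamental_heap D \<delta>) \<and>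
            fundamental_heap D \<delta> = fundamental_heap D \<delta>') \<and>
         (same_framed_link D D' \<longrightarrow>
            (\<forall>\<delta> \<delta>'. \<exists>f. f \<in> iso (fundamental_heap D \<delta>) (fundamental_heap D' \<delta>') \<and>
                          f \<in> heap_iso (fundamental_heap D \<delta>) (fundamental_heap D' \<delta>')))"
proof (intro conjI ballI allI impI)
  show "word_eq (strings D) (crossing_relations D d c) = word_eq (strings D) (crossing_relations D d' c)"
    if "c \<in> crossings D" for c d d'
    using word_eq_crossing_direction[OF assms(1) that] .
  show "group (fundamental_heap D \<delta>)" for \<delta>
    unfolding fundamental_heap_def by (rule group_presented_group)
  show "fundamental_heap D \<delta> = fundamental_heap D \<delta>'" for \<delta> \<delta>'
    by (rule fundamental_heap_direction[OF assms(1)])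
  show "\<exists>f. f \<in> iso (fundamental_heap D \<delta>) (fundamental_heap D' \<delta>') \<and>
      f \<in> heap_iso (fundamental_heap D \<delta>) (fundamental_heap D' \<delta>')"
    if link: "same_framed_link D D'" for \<delta> \<delta>'
  proof -
    obtain f where f: "f \<in> iso (heap_group D) (heap_group D')"
      using same_framed_link_heap_group[OF link] unfolding is_iso_def by blast
    then have "f \<in> heap_iso (heap_group D) (heap_group D')"
      by (rule iso_imp_heap_iso[OF group_presented_group group_presented_group])
    with f show ?thesis
      unfolding fundamental_heap_eq_heap_group[OF assms(1)] fundamental_heap_eq_heap_group[OF assms(2)]
      by blast
  qed
qed

end
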